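(* Assume function extensionality. Let $X$ be a type, $f : X\to X$, $I : \prod_{x:X}(f(f(x)) = f(x))$, and $J : \prod_{x:X}(\mathsf{ap}_f(I(x)) = I(f(x)))$. Then $f$ has a splitting. That is, there exist a type $A$, functions $r:X\to A$ and $s:A\to X$, and homotopies $H:\prod_{a:A}(r(s(a))=a)$ and $K:\prod_{x:X}(s(r(x))=f(x))$.
   Context: We work in intensional Martin-Löf type theory. $\mathsf{ap}_f(p) : f(x)=f(y)$ denotes the action of $f$ on a path $p:x=y$. A triple $(f,I,J)$ as in the claim is called a quasi-idempotent. *)

theory Defs
  imports Main
begin

text \<open>
  Syntax and rules of intensional Martin-Loef type theory with \<open>\<Pi>\<close>, \<open>\<Sigma>\<close>, binary sum, empty, unit,
  natural number and identity types and a cumulative hierarchy of Russell universes, in the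
  formulation of the second presentation in the appendix of the Homotopy Type Theory book.  Terms
  are raw de Bruijn terms; types are terms that inhabit some universe.

  Binding: the last argument of \<open>Pi\<close>, \<open>Lam\<close>, \<open>Sg\<close> binds one variable.  In an eliminator the motive
  \<open>C\<close> binds the scrutinee (for \<open>EqInd\<close>: both endpoints and the path), and the branches bind
  the arguments of the constructor (for \<open>NatInd\<close>: the predecessor and the induction hypothesis).  The
  variable bound last has index 0.
\<close>

datatype tm =
    Var nat
  | Univ nat
  | Pi tm tm
  | Lam tm tm
  | App tm tm  (infixl \<open>\<cdot>\<close> 75)
  | Sg tm tm
  | Tup tm tm
  | SgInd tm tm tm
  | Plus tm tm
  | Inj1 tm
  | Inj2 tm
  | PlusInd tm tm tm tm
  | Empty
  | EmptyInd tm tm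
  | Unit
  | Star
  | UnitInd tm tm tm
  | Nat
  | Zero
  | Succ tm
  | NatInd tm tm tm tm
  | Eq tm tm tm
  | Refl tm
  | EqInd tm tm tm tm tm

primrec up_ren :: "(nat \<Rightarrow> nat) \<Rightarrow> nat \<Rightarrow> nat" where
  "up_ren \<rho> 0 = 0"
| "up_ren \<rho> (Suc n) = Suc (\<rho> n)"

primrec ren :: "(nat \<Rightarrow> nat) \<Rightarrow> tm \<Rightarrow> tm" where
  "ren \<rho> (Var n) = Var (\<rho> n)"
| "ren \<rho> (Univ i) = Univ i"
| "ren \<rho> (Pi A B) = Pi (ren \<rho> A) (ren (up_ren \<rho>) B)"
| "ren \<rho> (Lam A b) = Lam (ren \<rho> A) (ren (up_ren \<rho>) b)"
| "ren \<rho> (App f a) = App (ren \<rho> f) (ren \<rho> a)"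
| "ren \<rho> (Sg A B) = Sg (ren \<rho> A) (ren (up_ren \<rho>) B)"
| "ren \<rho> (Tup a b) = Tup (ren \<rho> a) (ren \<rho> b)"
| "ren \<rho> (SgInd C c p) = SgInd (ren (up_ren \<rho>) C) (ren (up_ren (up_ren \<rho>)) c) (ren \<rho> p)"
| "ren \<rho> (Plus A B) = Plus (ren \<rho> A) (ren \<rho> B)"
| "ren \<rho> (Inj1 a) = Inj1 (ren \<rho> a)"
| "ren \<rho> (Inj2 b) = Inj2 (ren \<rho> b)"
| "ren \<rho> (PlusInd C c d e) =
    PlusInd (ren (up_ren \<rho>) C) (ren (up_ren \<rho>) c) (ren (up_ren \<rho>) d) (ren \<rho> e)"
| "ren \<rho> Empty = Empty"
| "ren \<rho> (EmptyInd C a) = EmptyInd (ren (up_ren \<rho>) C) (ren \<rho> a)"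
| "ren \<rho> Unit = Unit"
| "ren \<rho> Star = Star"
| "ren \<rho> (UnitInd C c a) = UnitInd (ren (up_ren \<rho>) C) (ren \<rho> c) (ren \<rho> a)"
| "ren \<rho> Nat = Nat"
| "ren \<rho> Zero = Zero"
| "ren \<rho> (Succ n) = Succ (ren \<rho> n)"
| "ren \<rho> (NatInd C c d n) =
    NatInd (ren (up_ren \<rho>) C) (ren \<rho> c) (ren (up_ren (up_ren \<rho>)) d) (ren \<rho> n)"
| "ren \<rho> (Eq A a b) = Eq (ren \<rho> A) (ren \<rho> a) (ren \<rho> b)"
| "ren \<rho> (Refl a) = Refl (ren \<rho> a)"
| "ren \<rho> (EqInd C c a b p) =
    EqInd (ren (up_ren (up_ren (up_ren \<rho>))) C) (ren (up_ren \<rho>) c) (ren \<rho> a) (ren \<rho> b) (ren \<rho> p)"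

definition shift :: "nat \<Rightarrow> tm \<Rightarrow> tm"  (\<open>\<up>\<close>) where
  "\<up> k t = ren (\<lambda>n. n + k) t"

primrec scons :: "tm \<Rightarrow> (nat \<Rightarrow> tm) \<Rightarrow> nat \<Rightarrow> tm"  (infixr \<open>\<bullet>\<close> 65) where
  "(t \<bullet> \<sigma>) 0 = t"
| "(t \<bullet> \<sigma>) (Suc n) = \<sigma> n"

definition up :: "(nat \<Rightarrow> tm) \<Rightarrow> nat \<Rightarrow> tm" where
  "up \<sigma> = Var 0 \<bullet> (\<lambda>n. \<up> 1 (\<sigma> n))"

primrec subst :: "(nat \<Rightarrow> tm) \<Rightarrow> tm \<Rightarrow> tm" where
  "subst \<sigma> (Var n) = \<sigma> n"
| "subst \<sigma> (Univ i) = Univ i"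
| "subst \<sigma> (Pi A B) = Pi (subst \<sigma> A) (subst (up \<sigma>) B)"
| "subst \<sigma> (Lam A b) = Lam (subst \<sigma> A) (subst (up \<sigma>) b)"
| "subst \<sigma> (App f a) = App (subst \<sigma> f) (subst \<sigma> a)"
| "subst \<sigma> (Sg A B) = Sg (subst \<sigma> A) (subst (up \<sigma>) B)"
| "subst \<sigma> (Tup a b) = Tup (subst \<sigma> a) (subst \<sigma> b)"
| "subst \<sigma> (SgInd C c p) = SgInd (subst (up \<sigma>) C) (subst (up (up \<sigma>)) c) (subst \<sigma> p)"
| "subst \<sigma> (Plus A B) = Plus (subst \<sigma> A) (subst \<sigma> B)"
| "subst \<sigma> (Inj1 a) = Inj1 (subst \<sigma> a)"
| "subst \<sigma> (Inj2 b) = Inj2 (subst \<sigma> b)"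
| "subst \<sigma> (PlusInd C c d e) =
    PlusInd (subst (up \<sigma>) C) (subst (up \<sigma>) c) (subst (up \<sigma>) d) (subst \<sigma> e)"
| "subst \<sigma> Empty = Empty"
| "subst \<sigma> (EmptyInd C a) = EmptyInd (subst (up \<sigma>) C) (subst \<sigma> a)"
| "subst \<sigma> Unit = Unit"
| "subst \<sigma> Star = Star"
| "subst \<sigma> (UnitInd C c a) = UnitInd (subst (up \<sigma>) C) (subst \<sigma> c) (subst \<sigma> a)"
| "subst \<sigma> Nat = Nat"
| "subst \<sigma> Zero = Zero"
| "subst \<sigma> (Succ n) = Succ (subst \<sigma> n)"
| "subst \<sigma> (NatInd C c d n) =
    NatInd (subst (up \<sigma>) C) (subst \<sigma> c) (subst (up (up \<sigma>)) d) (subst \<sigma> n)"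
| "subst \<sigma> (Eq A a b) = Eq (subst \<sigma> A) (subst \<sigma> a) (subst \<sigma> b)"
| "subst \<sigma> (Refl a) = Refl (subst \<sigma> a)"
| "subst \<sigma> (EqInd C c a b p) =
    EqInd (subst (up (up (up \<sigma>))) C) (subst (up \<sigma>) c) (subst \<sigma> a) (subst \<sigma> b) (subst \<sigma> p)"

definition wk :: "nat \<Rightarrow> nat \<Rightarrow> tm" where
  "wk k n = Var (n + k)"

definition inst :: "tm \<Rightarrow> tm \<Rightarrow> tm"  (\<open>_\<lblot>_\<rblot>\<close> [1000, 0] 1000) where
  "B\<lblot>a\<rblot> = subst (a \<bullet> Var) B"

text \<open>
  The three judgements.  A context lists the types of its variables with the most recent one first.
  Weakening and substitution are not primitive, since they are admissible.
\<close>

inductive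
  ctx :: "tm list \<Rightarrow> bool"  (\<open>\<turnstile> _ ctx\<close> [50] 50) and
  typing :: "tm list \<Rightarrow> tm \<Rightarrow> tm \<Rightarrow> bool"  (\<open>_ \<turnstile> _ \<^bold>: _\<close> [50, 50, 50] 50) and
  jdeq :: "tm list \<Rightarrow> tm \<Rightarrow> tm \<Rightarrow> tm \<Rightarrow> bool"  (\<open>_ \<turnstile> _ \<doteq> _ \<^bold>: _\<close> [50, 50, 50, 50] 50)
where
  ctx_empty: "\<turnstile> [] ctx"
| ctx_ext: "\<Gamma> \<turnstile> A \<^bold>: Univ i \<Longrightarrow> \<turnstile> A # \<Gamma> ctx"

| var: "\<lbrakk>\<turnstile> \<Gamma> ctx; n < length \<Gamma>\<rbrakk> \<Longrightarrow> \<Gamma> \<turnstile> Var n \<^bold>: \<up> (Suc n) (\<Gamma> ! n)"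
| conv: "\<lbrakk>\<Gamma> \<turnstile> a \<^bold>: A; \<Gamma> \<turnstile> A \<doteq> B \<^bold>: Univ i\<rbrakk> \<Longrightarrow> \<Gamma> \<turnstile> a \<^bold>: B"
| eq_refl: "\<Gamma> \<turnstile> a \<^bold>: A \<Longrightarrow> \<Gamma> \<turnstile> a \<doteq> a \<^bold>: A"
| eq_sym: "\<Gamma> \<turnstile> a \<doteq> b \<^bold>: A \<Longrightarrow> \<Gamma> \<turnstile> b \<doteq> a \<^bold>: A"
| eq_trans: "\<lbrakk>\<Gamma> \<turnstile> a \<doteq> b \<^bold>: A; \<Gamma> \<turnstile> b \<doteq> c \<^bold>: A\<rbrakk> \<Longrightarrow> \<Gamma> \<turnstile> a \<doteq> c \<^bold>: A"
| eq_conv: "\<lbrakk>\<Gamma> \<turnstile> a \<doteq> b \<^bold>: A; \<Gamma> \<turnstile> A \<doteq> B \<^bold>: Univ i\<rbrakk> \<Longrightarrow> \<Gamma> \<turnstile> a \<doteq> b \<^bold>: B"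

| univ: "\<turnstile> \<Gamma> ctx \<Longrightarrow> \<Gamma> \<turnstile> Univ i \<^bold>: Univ (Suc i)"
| cumul: "\<Gamma> \<turnstile> A \<^bold>: Univ i \<Longrightarrow> \<Gamma> \<turnstile> A \<^bold>: Univ (Suc i)"
| eq_cumul: "\<Gamma> \<turnstile> A \<doteq> B \<^bold>: Univ i \<Longrightarrow> \<Gamma> \<turnstile> A \<doteq> B \<^bold>: Univ (Suc i)"

| pi_form: "\<lbrakk>\<Gamma> \<turnstile> A \<^bold>: Univ i; A # \<Gamma> \<turnstile> B \<^bold>: Univ i\<rbrakk> \<Longrightarrow> \<Gamma> \<turnstile> Pi A B \<^bold>: Univ i"
| pi_intro: "A # \<Gamma> \<turnstile> b \<^bold>: B \<Longrightarrow> \<Gamma> \<turnstile> Lam A b \<^bold>: Pi A B"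
| pi_elim: "\<lbrakk>\<Gamma> \<turnstile> f \<^bold>: Pi A B; \<Gamma> \<turnstile> a \<^bold>: A\<rbrakk> \<Longrightarrow> \<Gamma> \<turnstile> f \<cdot> a \<^bold>: B\<lblot>a\<rblot>"
| pi_beta: "\<lbrakk>A # \<Gamma> \<turnstile> b \<^bold>: B; \<Gamma> \<turnstile> a \<^bold>: A\<rbrakk> \<Longrightarrow> \<Gamma> \<turnstile> Lam A b \<cdot> a \<doteq> b\<lblot>a\<rblot> \<^bold>: B\<lblot>a\<rblot>"
| pi_eta: "\<Gamma> \<turnstile> f \<^bold>: Pi A B \<Longrightarrow> \<Gamma> \<turnstile> f \<doteq> Lam A (\<up> 1 f \<cdot> Var 0) \<^bold>: Pi A B"
| pi_form_cong: "\<lbrakk>\<Gamma> \<turnstile> A \<doteq> A' \<^bold>: Univ i; A # \<Gamma> \<turnstile> B \<doteq> B' \<^bold>: Univ i\<rbrakk>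
    \<Longrightarrow> \<Gamma> \<turnstile> Pi A B \<doteq> Pi A' B' \<^bold>: Univ i"
| pi_intro_cong: "\<lbrakk>\<Gamma> \<turnstile> A \<doteq> A' \<^bold>: Univ i; A # \<Gamma> \<turnstile> b \<doteq> b' \<^bold>: B\<rbrakk>
    \<Longrightarrow> \<Gamma> \<turnstile> Lam A b \<doteq> Lam A' b' \<^bold>: Pi A B"
| pi_elim_cong: "\<lbrakk>\<Gamma> \<turnstile> f \<doteq> f' \<^bold>: Pi A B; \<Gamma> \<turnstile> a \<doteq> a' \<^bold>: A\<rbrakk> \<Longrightarrow> \<Gamma> \<turnstile> f \<cdot> a \<doteq> f' \<cdot> a' \<^bold>: B\<lblot>a\<rblot>"

| sg_form: "\<lbrakk>\<Gamma> \<turnstile> A \<^bold>: Univ i; A # \<Gamma> \<turnstile> B \<^bold>: Univ i\<rbrakk> \<Longrightarrow> \<Gamma> \<turnstile> Sg A B \<^bold>: Univ i"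
| sg_intro: "\<lbrakk>A # \<Gamma> \<turnstile> B \<^bold>: Univ i; \<Gamma> \<turnstile> a \<^bold>: A; \<Gamma> \<turnstile> b \<^bold>: B\<lblot>a\<rblot>\<rbrakk> \<Longrightarrow> \<Gamma> \<turnstile> Tup a b \<^bold>: Sg A B"
| sg_elim: "\<lbrakk>Sg A B # \<Gamma> \<turnstile> C \<^bold>: Univ i;
     B # A # \<Gamma> \<turnstile> c \<^bold>: subst (Tup (Var 1) (Var 0) \<bullet> wk 2) C; \<Gamma> \<turnstile> p \<^bold>: Sg A B\<rbrakk>
    \<Longrightarrow> \<Gamma> \<turnstile> SgInd C c p \<^bold>: C\<lblot>p\<rblot>"
| sg_beta: "\<lbrakk>Sg A B # \<Gamma> \<turnstile> C \<^bold>: Univ i;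
     B # A # \<Gamma> \<turnstile> c \<^bold>: subst (Tup (Var 1) (Var 0) \<bullet> wk 2) C; \<Gamma> \<turnstile> a \<^bold>: A; \<Gamma> \<turnstile> b \<^bold>: B\<lblot>a\<rblot>\<rbrakk>
    \<Longrightarrow> \<Gamma> \<turnstile> SgInd C c (Tup a b) \<doteq> subst (b \<bullet> a \<bullet> Var) c \<^bold>: C\<lblot>Tup a b\<rblot>"
| sg_form_cong: "\<lbrakk>\<Gamma> \<turnstile> A \<doteq> A' \<^bold>: Univ i; A # \<Gamma> \<turnstile> B \<doteq> B' \<^bold>: Univ i\<rbrakk>
    \<Longrightarrow> \<Gamma> \<turnstile> Sg A B \<doteq> Sg A' B' \<^bold>: Univ i"
| sg_intro_cong: "\<lbrakk>A # \<Gamma> \<turnstile> B \<^bold>: Univ i; \<Gamma> \<turnstile> a \<doteq> a' \<^bold>: A; \<Gamma> \<turnstile> b \<doteq> b' \<^bold>: B\<lblot>a\<rblot>\<rbrakk>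
    \<Longrightarrow> \<Gamma> \<turnstile> Tup a b \<doteq> Tup a' b' \<^bold>: Sg A B"
| sg_elim_cong: "\<lbrakk>Sg A B # \<Gamma> \<turnstile> C \<doteq> C' \<^bold>: Univ i;
     B # A # \<Gamma> \<turnstile> c \<doteq> c' \<^bold>: subst (Tup (Var 1) (Var 0) \<bullet> wk 2) C; \<Gamma> \<turnstile> p \<doteq> p' \<^bold>: Sg A B\<rbrakk>
    \<Longrightarrow> \<Gamma> \<turnstile> SgInd C c p \<doteq> SgInd C' c' p' \<^bold>: C\<lblot>p\<rblot>"

| plus_form: "\<lbrakk>\<Gamma> \<turnstile> A \<^bold>: Univ i; \<Gamma> \<turnstile> B \<^bold>: Univ i\<rbrakk> \<Longrightarrow> \<Gamma> \<turnstile> Plus A B \<^bold>: Univ i"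
| plus_intro1: "\<lbrakk>\<Gamma> \<turnstile> A \<^bold>: Univ i; \<Gamma> \<turnstile> B \<^bold>: Univ i; \<Gamma> \<turnstile> a \<^bold>: A\<rbrakk> \<Longrightarrow> \<Gamma> \<turnstile> Inj1 a \<^bold>: Plus A B"
| plus_intro2: "\<lbrakk>\<Gamma> \<turnstile> A \<^bold>: Univ i; \<Gamma> \<turnstile> B \<^bold>: Univ i; \<Gamma> \<turnstile> b \<^bold>: B\<rbrakk> \<Longrightarrow> \<Gamma> \<turnstile> Inj2 b \<^bold>: Plus A B"
| plus_elim: "\<lbrakk>Plus A B # \<Gamma> \<turnstile> C \<^bold>: Univ i; A # \<Gamma> \<turnstile> c \<^bold>: subst (Inj1 (Var 0) \<bullet> wk 1) C;
     B # \<Gamma> \<turnstile> d \<^bold>: subst (Inj2 (Var 0) \<bullet> wk 1) C; \<Gamma> \<turnstile> e \<^bold>: Plus A B\<rbrakk>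
    \<Longrightarrow> \<Gamma> \<turnstile> PlusInd C c d e \<^bold>: C\<lblot>e\<rblot>"
| plus_beta1: "\<lbrakk>Plus A B # \<Gamma> \<turnstile> C \<^bold>: Univ i; A # \<Gamma> \<turnstile> c \<^bold>: subst (Inj1 (Var 0) \<bullet> wk 1) C;
     B # \<Gamma> \<turnstile> d \<^bold>: subst (Inj2 (Var 0) \<bullet> wk 1) C; \<Gamma> \<turnstile> a \<^bold>: A\<rbrakk>
    \<Longrightarrow> \<Gamma> \<turnstile> PlusInd C c d (Inj1 a) \<doteq> c\<lblot>a\<rblot> \<^bold>: C\<lblot>Inj1 a\<rblot>"
| plus_beta2: "\<lbrakk>Plus A B # \<Gamma> \<turnstile> C \<^bold>: Univ i; A # \<Gamma> \<turnstile> c \<^bold>: subst (Inj1 (Var 0) \<bullet> wk 1) C;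
     B # \<Gamma> \<turnstile> d \<^bold>: subst (Inj2 (Var 0) \<bullet> wk 1) C; \<Gamma> \<turnstile> b \<^bold>: B\<rbrakk>
    \<Longrightarrow> \<Gamma> \<turnstile> PlusInd C c d (Inj2 b) \<doteq> d\<lblot>b\<rblot> \<^bold>: C\<lblot>Inj2 b\<rblot>"
| plus_form_cong: "\<lbrakk>\<Gamma> \<turnstile> A \<doteq> A' \<^bold>: Univ i; \<Gamma> \<turnstile> B \<doteq> B' \<^bold>: Univ i\<rbrakk>
    \<Longrightarrow> \<Gamma> \<turnstile> Plus A B \<doteq> Plus A' B' \<^bold>: Univ i"
| plus_intro1_cong: "\<lbrakk>\<Gamma> \<turnstile> A \<^bold>: Univ i; \<Gamma> \<turnstile> B \<^bold>: Univ i; \<Gamma> \<turnstile> a \<doteq> a' \<^bold>: A\<rbrakk>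
    \<Longrightarrow> \<Gamma> \<turnstile> Inj1 a \<doteq> Inj1 a' \<^bold>: Plus A B"
| plus_intro2_cong: "\<lbrakk>\<Gamma> \<turnstile> A \<^bold>: Univ i; \<Gamma> \<turnstile> B \<^bold>: Univ i; \<Gamma> \<turnstile> b \<doteq> b' \<^bold>: B\<rbrakk>
    \<Longrightarrow> \<Gamma> \<turnstile> Inj2 b \<doteq> Inj2 b' \<^bold>: Plus A B"
| plus_elim_cong: "\<lbrakk>Plus A B # \<Gamma> \<turnstile> C \<doteq> C' \<^bold>: Univ i;
     A # \<Gamma> \<turnstile> c \<doteq> c' \<^bold>: subst (Inj1 (Var 0) \<bullet> wk 1) C;
     B # \<Gamma> \<turnstile> d \<doteq> d' \<^bold>: subst (Inj2 (Var 0) \<bullet> wk 1) C; \<Gamma> \<turnstile> e \<doteq> e' \<^bold>: Plus A B\<rbrakk>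
    \<Longrightarrow> \<Gamma> \<turnstile> PlusInd C c d e \<doteq> PlusInd C' c' d' e' \<^bold>: C\<lblot>e\<rblot>"

| empty_form: "\<turnstile> \<Gamma> ctx \<Longrightarrow> \<Gamma> \<turnstile> Empty \<^bold>: Univ i"
| empty_elim: "\<lbrakk>Empty # \<Gamma> \<turnstile> C \<^bold>: Univ i; \<Gamma> \<turnstile> a \<^bold>: Empty\<rbrakk> \<Longrightarrow> \<Gamma> \<turnstile> EmptyInd C a \<^bold>: C\<lblot>a\<rblot>"
| empty_elim_cong: "\<lbrakk>Empty # \<Gamma> \<turnstile> C \<doteq> C' \<^bold>: Univ i; \<Gamma> \<turnstile> a \<doteq> a' \<^bold>: Empty\<rbrakk>
    \<Longrightarrow> \<Gamma> \<turnstile> EmptyInd C a \<doteq> EmptyInd C' a' \<^bold>: C\<lblot>a\<rblot>"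

| unit_form: "\<turnstile> \<Gamma> ctx \<Longrightarrow> \<Gamma> \<turnstile> Unit \<^bold>: Univ i"
| unit_intro: "\<turnstile> \<Gamma> ctx \<Longrightarrow> \<Gamma> \<turnstile> Star \<^bold>: Unit"
| unit_elim: "\<lbrakk>Unit # \<Gamma> \<turnstile> C \<^bold>: Univ i; \<Gamma> \<turnstile> c \<^bold>: C\<lblot>Star\<rblot>; \<Gamma> \<turnstile> a \<^bold>: Unit\<rbrakk>
    \<Longrightarrow> \<Gamma> \<turnstile> UnitInd C c a \<^bold>: C\<lblot>a\<rblot>"
| unit_beta: "\<lbrakk>Unit # \<Gamma> \<turnstile> C \<^bold>: Univ i; \<Gamma> \<turnstile> c \<^bold>: C\<lblot>Star\<rblot>\<rbrakk>
    \<Longrightarrow> \<Gamma> \<turnstile> UnitInd C c Star \<doteq> c \<^bold>: C\<lblot>Star\<rblot>"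
| unit_elim_cong: "\<lbrakk>Unit # \<Gamma> \<turnstile> C \<doteq> C' \<^bold>: Univ i; \<Gamma> \<turnstile> c \<doteq> c' \<^bold>: C\<lblot>Star\<rblot>; \<Gamma> \<turnstile> a \<doteq> a' \<^bold>: Unit\<rbrakk>
    \<Longrightarrow> \<Gamma> \<turnstile> UnitInd C c a \<doteq> UnitInd C' c' a' \<^bold>: C\<lblot>a\<rblot>"

| nat_form: "\<turnstile> \<Gamma> ctx \<Longrightarrow> \<Gamma> \<turnstile> Nat \<^bold>: Univ i"
| nat_zero: "\<turnstile> \<Gamma> ctx \<Longrightarrow> \<Gamma> \<turnstile> Zero \<^bold>: Nat"
| nat_succ: "\<Gamma> \<turnstile> n \<^bold>: Nat \<Longrightarrow> \<Gamma> \<turnstile> Succ n \<^bold>: Nat"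
| nat_elim: "\<lbrakk>Nat # \<Gamma> \<turnstile> C \<^bold>: Univ i; \<Gamma> \<turnstile> c \<^bold>: C\<lblot>Zero\<rblot>;
     C # Nat # \<Gamma> \<turnstile> d \<^bold>: subst (Succ (Var 1) \<bullet> wk 2) C; \<Gamma> \<turnstile> n \<^bold>: Nat\<rbrakk>
    \<Longrightarrow> \<Gamma> \<turnstile> NatInd C c d n \<^bold>: C\<lblot>n\<rblot>"
| nat_beta_zero: "\<lbrakk>Nat # \<Gamma> \<turnstile> C \<^bold>: Univ i; \<Gamma> \<turnstile> c \<^bold>: C\<lblot>Zero\<rblot>;
     C # Nat # \<Gamma> \<turnstile> d \<^bold>: subst (Succ (Var 1) \<bullet> wk 2) C\<rbrakk>
    \<Longrightarrow> \<Gamma> \<turnstile> NatInd C c d Zero \<doteq> c \<^bold>: C\<lblot>Zero\<rblot>"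
| nat_beta_succ: "\<lbrakk>Nat # \<Gamma> \<turnstile> C \<^bold>: Univ i; \<Gamma> \<turnstile> c \<^bold>: C\<lblot>Zero\<rblot>;
     C # Nat # \<Gamma> \<turnstile> d \<^bold>: subst (Succ (Var 1) \<bullet> wk 2) C; \<Gamma> \<turnstile> n \<^bold>: Nat\<rbrakk>
    \<Longrightarrow> \<Gamma> \<turnstile> NatInd C c d (Succ n) \<doteq> subst (NatInd C c d n \<bullet> n \<bullet> Var) d \<^bold>: C\<lblot>Succ n\<rblot>"
| nat_succ_cong: "\<Gamma> \<turnstile> n \<doteq> n' \<^bold>: Nat \<Longrightarrow> \<Gamma> \<turnstile> Succ n \<doteq> Succ n' \<^bold>: Nat"
| nat_elim_cong: "\<lbrakk>Nat # \<Gamma> \<turnstile> C \<doteq> C' \<^bold>: Univ i; \<Gamma> \<turnstile> c \<doteq> c' \<^bold>: C\<lblot>Zero\<rblot>;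
     C # Nat # \<Gamma> \<turnstile> d \<doteq> d' \<^bold>: subst (Succ (Var 1) \<bullet> wk 2) C; \<Gamma> \<turnstile> n \<doteq> n' \<^bold>: Nat\<rbrakk>
    \<Longrightarrow> \<Gamma> \<turnstile> NatInd C c d n \<doteq> NatInd C' c' d' n' \<^bold>: C\<lblot>n\<rblot>"

| id_form: "\<lbrakk>\<Gamma> \<turnstile> A \<^bold>: Univ i; \<Gamma> \<turnstile> a \<^bold>: A; \<Gamma> \<turnstile> b \<^bold>: A\<rbrakk> \<Longrightarrow> \<Gamma> \<turnstile> Eq A a b \<^bold>: Univ i"
| id_intro: "\<lbrakk>\<Gamma> \<turnstile> A \<^bold>: Univ i; \<Gamma> \<turnstile> a \<^bold>: A\<rbrakk> \<Longrightarrow> \<Gamma> \<turnstile> Refl a \<^bold>: Eq A a a"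
| id_elim: "\<lbrakk>Eq (\<up> 2 A) (Var 1) (Var 0) # \<up> 1 A # A # \<Gamma> \<turnstile> C \<^bold>: Univ i;
     A # \<Gamma> \<turnstile> c \<^bold>: subst (Refl (Var 0) \<bullet> Var 0 \<bullet> Var 0 \<bullet> wk 1) C;
     \<Gamma> \<turnstile> a \<^bold>: A; \<Gamma> \<turnstile> b \<^bold>: A; \<Gamma> \<turnstile> p \<^bold>: Eq A a b\<rbrakk>
    \<Longrightarrow> \<Gamma> \<turnstile> EqInd C c a b p \<^bold>: subst (p \<bullet> b \<bullet> a \<bullet> Var) C"
| id_beta: "\<lbrakk>Eq (\<up> 2 A) (Var 1) (Var 0) # \<up> 1 A # A # \<Gamma> \<turnstile> C \<^bold>: Univ i;
     A # \<Gamma> \<turnstile> c \<^bold>: subst (Refl (Var 0) \<bullet> Var 0 \<bullet> Var 0 \<bullet> wk 1) C; \<Gamma> \<turnstile> a \<^bold>: A\<rbrakk>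
    \<Longrightarrow> \<Gamma> \<turnstile> EqInd C c a a (Refl a) \<doteq> c\<lblot>a\<rblot> \<^bold>: subst (Refl a \<bullet> a \<bullet> a \<bullet> Var) C"
| id_form_cong: "\<lbrakk>\<Gamma> \<turnstile> A \<doteq> A' \<^bold>: Univ i; \<Gamma> \<turnstile> a \<doteq> a' \<^bold>: A; \<Gamma> \<turnstile> b \<doteq> b' \<^bold>: A\<rbrakk>
    \<Longrightarrow> \<Gamma> \<turnstile> Eq A a b \<doteq> Eq A' a' b' \<^bold>: Univ i"
| id_intro_cong: "\<lbrakk>\<Gamma> \<turnstile> A \<^bold>: Univ i; \<Gamma> \<turnstile> a \<doteq> a' \<^bold>: A\<rbrakk> \<Longrightarrow> \<Gamma> \<turnstile> Refl a \<doteq> Refl a' \<^bold>: Eq A a a"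
| id_elim_cong: "\<lbrakk>Eq (\<up> 2 A) (Var 1) (Var 0) # \<up> 1 A # A # \<Gamma> \<turnstile> C \<doteq> C' \<^bold>: Univ i;
     A # \<Gamma> \<turnstile> c \<doteq> c' \<^bold>: subst (Refl (Var 0) \<bullet> Var 0 \<bullet> Var 0 \<bullet> wk 1) C;
     \<Gamma> \<turnstile> a \<doteq> a' \<^bold>: A; \<Gamma> \<turnstile> b \<doteq> b' \<^bold>: A; \<Gamma> \<turnstile> p \<doteq> p' \<^bold>: Eq A a b\<rbrakk>
    \<Longrightarrow> \<Gamma> \<turnstile> EqInd C c a b p \<doteq> EqInd C' c' a' b' p' \<^bold>: subst (p \<bullet> b \<bullet> a \<bullet> Var) C"

definition arrow :: "tm \<Rightarrow> tm \<Rightarrow> tm"  (infixr \<open>\<rightarrow>\<^sub>t\<close> 60) where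
  "A \<rightarrow>\<^sub>t B = Pi A (\<up> 1 B)"

definition times :: "tm \<Rightarrow> tm \<Rightarrow> tm"  (infixr \<open>\<times>\<^sub>t\<close> 65) where
  "A \<times>\<^sub>t B = Sg A (\<up> 1 B)"

text \<open>
  For \<open>f : A \<rightarrow> B\<close> and \<open>p : Eq A x y\<close>, the term \<open>ap B f x y p : Eq B (f x) (f y)\<close> is the action of \<open>f\<close>
  on \<open>p\<close>.
\<close>

definition ap :: "tm \<Rightarrow> tm \<Rightarrow> tm \<Rightarrow> tm \<Rightarrow> tm \<Rightarrow> tm" where
  "ap B f x y p =
    EqInd (Eq (\<up> 3 B) (\<up> 3 f \<cdot> Var 2) (\<up> 3 f \<cdot> Var 1)) (Refl (\<up> 1 f \<cdot> Var 0)) x y p"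

text \<open>
  \<open>isequiv A B f\<close> is
  \<open>(\<Sigma>(g : B \<rightarrow> A). \<Pi>(b : B). f (g b) = b) \<times> (\<Sigma>(h : B \<rightarrow> A). \<Pi>(a : A). h (f a) = a)\<close>.
\<close>

definition isequiv :: "tm \<Rightarrow> tm \<Rightarrow> tm \<Rightarrow> tm" where
  "isequiv A B f =
    Sg (B \<rightarrow>\<^sub>t A) (Pi (\<up> 1 B) (Eq (\<up> 2 B) (\<up> 2 f \<cdot> (Var 1 \<cdot> Var 0)) (Var 0))) \<times>\<^sub>t
    Sg (B \<rightarrow>\<^sub>t A) (Pi (\<up> 1 A) (Eq (\<up> 2 A) (Var 1 \<cdot> (\<up> 2 f \<cdot> Var 0)) (Var 0)))"

text \<open>In the following three definitions \<open>B\<close> is a type family \<open>B : A \<rightarrow> Univ i\<close>.\<close>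

definition Pi_fam :: "tm \<Rightarrow> tm \<Rightarrow> tm" where
  "Pi_fam A B = Pi A (\<up> 1 B \<cdot> Var 0)"

definition htpy :: "tm \<Rightarrow> tm \<Rightarrow> tm \<Rightarrow> tm \<Rightarrow> tm" where
  "htpy A B f g = Pi A (Eq (\<up> 1 B \<cdot> Var 0) (\<up> 1 f \<cdot> Var 0) (\<up> 1 g \<cdot> Var 0))"

text \<open>
  The canonical map from \<open>Eq (Pi_fam A B) f g\<close> to \<open>htpy A B f g\<close>, by path induction: with motive
  \<open>h. k. p. \<Pi>(x : A). h x = k x\<close> and branch \<open>h. \<lambda>(x : A). refl (h x)\<close>.
\<close>

definition happly :: "tm \<Rightarrow> tm \<Rightarrow> tm \<Rightarrow> tm \<Rightarrow> tm" where
  "happly A B f g =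
    Lam (Eq (Pi_fam A B) f g)
      (EqInd (Pi (\<up> 4 A) (Eq (\<up> 5 B \<cdot> Var 0) (Var 3 \<cdot> Var 0) (Var 2 \<cdot> Var 0)))
             (Lam (\<up> 2 A) (Refl (Var 1 \<cdot> Var 0)))
             (\<up> 1 f) (\<up> 1 g) (Var 0))"

text \<open>
  Function extensionality for the universe \<open>Univ i\<close>:
  \<open>\<Pi>(A : Univ i) (B : A \<rightarrow> Univ i) (f g : \<Pi>(x : A). B x). isequiv (happly f g)\<close>.
\<close>

definition FunExt :: "nat \<Rightarrow> tm" where
  "FunExt i =
    Pi (Univ i) (Pi (Var 0 \<rightarrow>\<^sub>t Univ i) (Pi (Pi_fam (Var 1) (Var 0)) (Pi (Pi_fam (Var 2) (Var 1))
      (let A = Var 3; B = Var 2; f = Var 1; g = Var 0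
       in isequiv (Eq (Pi_fam A B) f g) (htpy A B f g) (happly A B f g)))))"

end

theory Submission
  imports Defs "HOL-Library.Monad_Syntax"
begin

text \<open>
  The splitting is the limit \<open>A = \<Sigma>(a : Nat \<rightarrow> X). \<Pi>n. f (a (n + 1)) = a n\<close> of the tower
  \<open>\<dots> \<rightarrow> X \<rightarrow> X \<rightarrow> X\<close> of copies of \<open>f\<close>, with \<open>s (a, \<alpha>) = a 0\<close> and \<open>r x = (\<lambda>n. f x, \<lambda>n. I x)\<close>, so that
  \<open>s (r x)\<close> reduces to \<open>f x\<close>.  For \<open>r (s (a, \<alpha>)) = (a, \<alpha>)\<close> one builds by recursion on \<open>n\<close> paths
  \<open>\<gamma> n : f (a 0) = f (a n)\<close>, going from \<open>f (a n)\<close> through \<open>f (f (a (n + 1)))\<close> to \<open>f (a (n + 1))\<close> along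
  \<open>\<alpha> n\<close> and \<open>I\<close>, and shows with \<open>J\<close> that transport along \<open>\<gamma> n\<close> takes \<open>I (a 0)\<close> to \<open>I (a n)\<close>.  Function
  extensionality turns the homotopy \<open>\<gamma> (n + 1)\<close> followed by \<open>\<alpha> n\<close> into a path in \<open>A\<close>.  All coherence
  conditions are phrased with transport, so that path induction on every path in sight reduces them
  to \<open>J\<close>.

  The derivations are not written out.  A type checker that normalizes terms is proved sound
  for the calculus, and the simplifier runs it on explicit proof terms.  Soundness has to do
  without injectivity of \<open>\<Pi>\<close>, and therefore the checker recomputes the type of the body before it
  contracts a \<open>\<beta>\<close>-redex.
\<close>

section \<open>Substitution\<close>

text \<open>The type \<open>\<Sigma>x. f x = x\<close> is not a splitting: for the identity with I =
  refl it consists of all loops of X, whereas a splitting of the identity is equivalent to X. The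
  tower adds room in which a point and its path can be contracted together. J enters as follows.
  Contracting the paths \<alpha> and \<gamma> makes every point in sight an iterate of f at one
  point z, and the naturality hypothesis turns I (a 0) into I (f z). Now J trades I (f z) for ap_f
  (I z). What is left says that transport along a path p cancels ap_f p, which holds for every p by
  induction on p; I itself is never contracted. The path to a n uses \<gamma> (n + 1) because
  \<alpha> n starts at f (a (n + 1)); comparing only values of f lets \<gamma> 0 be refl. On the
  side of the calculus, a judgement \<open>Lam A b\<close> : \<open>Pi A B\<close> does not by
  itself yield b : B, since B is known only up to an equality of \<Pi>-types. Rechecking the body
  against B supplies the premise of the \<beta> rule without that metatheory. The checker compares
  normalized types as terms and may give up; neither completeness nor termination has to be
  proved.\<close>

lemma nat_fun_eqI: "f 0 = g 0 \<Longrightarrow> (\<And>n. f (Suc n) = g (Suc n)) \<Longrightarrow> f = g"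
  by (rule ext, case_tac x) auto

lemma up_0 [simp]: "up \<sigma> 0 = Var 0"
  and up_Suc [simp]: "up \<sigma> (Suc n) = \<up> 1 (\<sigma> n)"
  by (simp_all add: up_def)

lemma wk_app [simp]: "wk k n = Var (n + k)"
  by (simp add: wk_def)

lemma up_Var_comp: "up (\<lambda>n. Var (\<rho> n)) = (\<lambda>n. Var (up_ren \<rho> n))"
  by (rule nat_fun_eqI) (simp_all add: shift_def)

lemma ren_eq_subst: "ren \<rho> t = subst (\<lambda>n. Var (\<rho> n)) t"
  by (induction t arbitrary: \<rho>) (simp_all add: up_Var_comp)

lemma up_Var [simp]: "up Var = Var"
  by (rule nat_fun_eqI) (simp_all add: shift_def)

lemma subst_Var [simp]: "subst Var t = t"
  by (induction t) simp_all

lemma shift_eq_subst: "\<up> k t = subst (wk k) t"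
  by (simp add: shift_def ren_eq_subst wk_def[abs_def])

lemma up_comp_ren: "up (\<lambda>n. \<sigma> (\<rho> n)) = (\<lambda>n. up \<sigma> (up_ren \<rho> n))"
  by (rule nat_fun_eqI) simp_all

lemma subst_ren: "subst \<sigma> (ren \<rho> t) = subst (\<lambda>n. \<sigma> (\<rho> n)) t"
  by (induction t arbitrary: \<sigma> \<rho>) (simp_all add: up_comp_ren)

lemma ren_ren: "ren \<rho> (ren \<rho>' t) = ren (\<lambda>n. \<rho> (\<rho>' n)) t"
  by (simp only: ren_eq_subst[of \<rho>] ren_eq_subst[of "\<lambda>n. \<rho> (\<rho>' n)"] subst_ren)

lemma up_ren_comp: "up (\<lambda>n. ren \<rho> (\<sigma> n)) = (\<lambda>n. ren (up_ren \<rho>) (up \<sigma> n))"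
  by (rule nat_fun_eqI) (simp_all add: shift_def ren_ren)

lemma ren_subst: "ren \<rho> (subst \<sigma> t) = subst (\<lambda>n. ren \<rho> (\<sigma> n)) t"
  by (induction t arbitrary: \<sigma> \<rho>) (simp_all add: up_ren_comp)

lemma up_subst_comp: "up (\<lambda>n. subst \<sigma> (\<tau> n)) = (\<lambda>n. subst (up \<sigma>) (up \<tau> n))"
  by (rule nat_fun_eqI) (simp_all add: shift_def ren_subst subst_ren)

lemma subst_subst: "subst \<sigma> (subst \<tau> t) = subst (\<lambda>n. subst \<sigma> (\<tau> n)) t"
  by (induction t arbitrary: \<sigma> \<tau>) (simp_all add: up_subst_comp)

lemma subst_shift: "subst \<sigma> (\<up> k t) = subst (\<lambda>n. \<sigma> (n + k)) t"
  by (simp add: shift_eq_subst subst_subst)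

lemma shift_subst: "\<up> k (subst \<sigma> t) = subst (\<lambda>n. \<up> k (\<sigma> n)) t"
  by (simp add: shift_eq_subst subst_subst)

lemma shift_shift [simp]: "\<up> j (\<up> k t) = \<up> (j + k) t"
  by (simp add: shift_eq_subst subst_subst wk_def[abs_def] add.commute add.left_commute)

lemma shift_Var [simp]: "\<up> k (Var n) = Var (n + k)"
  by (simp add: shift_def)

lemma shift_0 [simp]: "\<up> 0 t = t"
  by (simp add: shift_eq_subst wk_def[abs_def])

lemma subst_up_shift:
  "subst (up \<sigma>) (\<up> 1 t) = \<up> 1 (subst \<sigma> t)"
  "subst (up (up \<sigma>)) (\<up> 2 t) = \<up> 2 (subst \<sigma> t)"
  by (simp_all add: subst_shift shift_subst numeral_2_eq_2)

lemma comp_scons: "(\<lambda>n. subst \<sigma> ((t \<bullet> \<tau>) n)) = subst \<sigma> t \<bullet> (\<lambda>n. subst \<sigma> (\<tau> n))"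
  by (rule nat_fun_eqI) simp_all

lemma scons_comp_up: "(\<lambda>n. subst (t \<bullet> \<tau>) (up \<sigma> n)) = t \<bullet> (\<lambda>n. subst \<tau> (\<sigma> n))"
  by (rule nat_fun_eqI) (simp_all add: subst_shift)

lemmas subst_comp_simps = subst_subst comp_scons scons_comp_up

lemma subst_inst: "subst \<sigma> (B\<lblot>a\<rblot>) = (subst (up \<sigma>) B)\<lblot>subst \<sigma> a\<rblot>"
  by (simp add: inst_def subst_comp_simps)

text \<open>These are the shapes in which motives occur in the branch premises of the eliminators.
  With them a substituted premise has again the literal form that the rule expects.\<close>

lemma subst_up_scons_wk:
  "subst (up (up \<sigma>)) (subst (Tup (Var 1) (Var 0) \<bullet> wk 2) C) =
     subst (Tup (Var 1) (Var 0) \<bullet> wk 2) (subst (up \<sigma>) C)"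
  "subst (up \<sigma>) (subst (Inj1 (Var 0) \<bullet> wk 1) C) = subst (Inj1 (Var 0) \<bullet> wk 1) (subst (up \<sigma>) C)"
  "subst (up \<sigma>) (subst (Inj2 (Var 0) \<bullet> wk 1) C) = subst (Inj2 (Var 0) \<bullet> wk 1) (subst (up \<sigma>) C)"
  "subst (up (up \<sigma>)) (subst (Succ (Var 1) \<bullet> wk 2) C) =
     subst (Succ (Var 1) \<bullet> wk 2) (subst (up \<sigma>) C)"
  "subst (up \<sigma>) (subst (Refl (Var 0) \<bullet> Var 0 \<bullet> Var 0 \<bullet> wk 1) D) =
     subst (Refl (Var 0) \<bullet> Var 0 \<bullet> Var 0 \<bullet> wk 1) (subst (up (up (up \<sigma>))) D)"
  by (simp_all add: subst_comp_simps shift_eq_subst[symmetric] numeral_2_eq_2)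

lemma subst_subst_scons:
  "subst \<sigma> (subst (b \<bullet> a \<bullet> Var) c) = subst (subst \<sigma> b \<bullet> subst \<sigma> a \<bullet> Var) (subst (up (up \<sigma>)) c)"
  "subst \<sigma> (subst (p \<bullet> b \<bullet> a \<bullet> Var) C) =
     subst (subst \<sigma> p \<bullet> subst \<sigma> b \<bullet> subst \<sigma> a \<bullet> Var) (subst (up (up (up \<sigma>))) C)"
  by (simp_all add: subst_comp_simps)

lemma up_up_1: "up (up \<sigma>) 1 = Var 1"
  by simp

lemmas subst_simps = subst.simps up_0 up_up_1 subst_inst subst_up_shift subst_up_scons_wk subst_subst_scons

text \<open>
  One induction serves both renamings and substitutions: it is carried out for an arbitrary class of
  context morphisms with the closure properties \<open>kit\<close>.  Weakening, the instance for renamings, is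
  what makes the well-typed substitutions a kit.  A premise such as \<open>A # \<Gamma> \<turnstile> b \<^bold>: B\<close> of \<open>pi_intro\<close> contains
  the well-formedness of \<open>A\<close> only implicitly; \<open>kit_ctx\<close> carries it through the induction.
\<close>

definition kit :: "((nat \<Rightarrow> tm) \<Rightarrow> tm list \<Rightarrow> tm list \<Rightarrow> bool) \<Rightarrow> bool" where
  "kit G \<longleftrightarrow> (\<forall>\<sigma> \<Gamma> \<Delta>. G \<sigma> \<Gamma> \<Delta> \<longrightarrow> (\<turnstile> \<Delta> ctx) \<and>
     (\<forall>n < length \<Gamma>. \<Delta> \<turnstile> \<sigma> n \<^bold>: subst \<sigma> (\<up> (Suc n) (\<Gamma> ! n))) \<and>
     (\<forall>A i. (\<Delta> \<turnstile> subst \<sigma> A \<^bold>: Univ i) \<longrightarrow> G (up \<sigma>) (A # \<Gamma>) (subst \<sigma> A # \<Delta>)))"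

primrec kit_ctx :: "((nat \<Rightarrow> tm) \<Rightarrow> tm list \<Rightarrow> tm list \<Rightarrow> bool) \<Rightarrow> tm list \<Rightarrow> bool" where
  "kit_ctx G [] = True"
| "kit_ctx G (A # \<Gamma>) = (kit_ctx G \<Gamma> \<and> (\<exists>i. \<forall>\<sigma> \<Delta>. G \<sigma> \<Gamma> \<Delta> \<longrightarrow> (\<Delta> \<turnstile> subst \<sigma> A \<^bold>: Univ i)))"

definition kit_stable where
  "kit_stable G \<Gamma> K \<longleftrightarrow> kit_ctx G \<Gamma> \<and> (\<forall>\<sigma> \<Delta>. G \<sigma> \<Gamma> \<Delta> \<longrightarrow> K \<sigma> \<Delta>)"

lemma kit_stableI: "kit_ctx G \<Gamma> \<Longrightarrow> (\<And>\<sigma> \<Delta>. G \<sigma> \<Gamma> \<Delta> \<Longrightarrow> K \<sigma> \<Delta>) \<Longrightarrow> kit_stable G \<Gamma> K"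
  by (simp add: kit_stable_def)

lemma kit_stable_ctx: "kit_stable G \<Gamma> K \<Longrightarrow> kit_ctx G \<Gamma>"
  by (simp add: kit_stable_def)

lemma kit_stableD: "kit_stable G \<Gamma> K \<Longrightarrow> G \<sigma> \<Gamma> \<Delta> \<Longrightarrow> K \<sigma> \<Delta>"
  by (simp add: kit_stable_def)

lemma kit_up: "kit G \<Longrightarrow> kit_ctx G (A # \<Gamma>) \<Longrightarrow> G \<sigma> \<Gamma> \<Delta> \<Longrightarrow> G (up \<sigma>) (A # \<Gamma>) (subst \<sigma> A # \<Delta>)"
  unfolding kit_def by (metis kit_ctx.simps(2))

lemma kit_stableD1:
  assumes "kit_stable G (A # \<Gamma>) K" "kit G" "G \<sigma> \<Gamma> \<Delta>"
  shows "K (up \<sigma>) (subst \<sigma> A # \<Delta>)"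
  by (rule kit_stableD[OF assms(1) kit_up[OF assms(2) kit_stable_ctx[OF assms(1)] assms(3)]])

lemma kit_stableD2:
  assumes "kit_stable G (B # A # \<Gamma>) K" "kit G" "G \<sigma> \<Gamma> \<Delta>"
  shows "K (up (up \<sigma>)) (subst (up \<sigma>) B # subst \<sigma> A # \<Delta>)"
proof -
  have "kit_ctx G (A # \<Gamma>)" using kit_stable_ctx[OF assms(1)] by (simp del: kit_ctx.simps add: kit_ctx.simps(2)[of _ B])
  from kit_stableD1[OF assms(1,2) kit_up[OF assms(2) this assms(3)]] show ?thesis .
qed

lemma kit_stableD3:
  assumes "kit_stable G (C # B # A # \<Gamma>) K" "kit G" "G \<sigma> \<Gamma> \<Delta>"
  shows "K (up (up (up \<sigma>))) (subst (up (up \<sigma>)) C # subst (up \<sigma>) B # subst \<sigma> A # \<Delta>)"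
proof -
  have "kit_ctx G (A # \<Gamma>)"
    using kit_stable_ctx[OF assms(1)] by (simp del: kit_ctx.simps add: kit_ctx.simps(2)[of _ B] kit_ctx.simps(2)[of _ C])
  from kit_stableD2[OF assms(1,2) kit_up[OF assms(2) this assms(3)]] show ?thesis .
qed

lemmas syntax_directed_rules =
  cumul eq_cumul pi_form pi_intro pi_elim pi_beta pi_eta pi_form_cong pi_intro_cong
  pi_elim_cong sg_form sg_intro sg_elim sg_beta sg_form_cong sg_intro_cong sg_elim_cong
  plus_form plus_intro1 plus_intro2 plus_elim plus_beta1 plus_beta2 plus_form_cong
  plus_intro1_cong plus_intro2_cong plus_elim_cong empty_elim empty_elim_cong unit_elim
  unit_beta unit_elim_cong nat_succ nat_elim nat_beta_zero nat_beta_succ nat_succ_cong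
  nat_elim_cong id_form id_intro id_elim id_beta id_form_cong id_intro_cong id_elim_cong

lemma kit_subst:
  assumes G: "kit G"
  shows "\<turnstile> \<Gamma> ctx \<Longrightarrow> kit_ctx G \<Gamma>"
    and "\<Gamma> \<turnstile> t \<^bold>: A \<Longrightarrow> kit_stable G \<Gamma> (\<lambda>\<sigma> \<Delta>. \<Delta> \<turnstile> subst \<sigma> t \<^bold>: subst \<sigma> A)"
    and "\<Gamma> \<turnstile> t \<doteq> u \<^bold>: A \<Longrightarrow> kit_stable G \<Gamma> (\<lambda>\<sigma> \<Delta>. \<Delta> \<turnstile> subst \<sigma> t \<doteq> subst \<sigma> u \<^bold>: subst \<sigma> A)"
proof (induction rule: ctx_typing_jdeq.inducts)
  case (ctx_ext \<Gamma> A i)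
  then show ?case by (auto simp: kit_stable_def)
next
  case (var \<Gamma> n)
  then show ?case using G by (auto simp: kit_stable_def kit_def)
next
  case (univ \<Gamma> i)
  then show ?case using G by (auto simp: kit_stable_def kit_def intro: ctx_typing_jdeq.univ)
next
  case (empty_form \<Gamma> i)
  then show ?case using G by (auto simp: kit_stable_def kit_def intro: ctx_typing_jdeq.empty_form)
next
  case (unit_form \<Gamma> i)
  then show ?case using G by (auto simp: kit_stable_def kit_def intro: ctx_typing_jdeq.unit_form)
next
  case (unit_intro \<Gamma>)
  then show ?case using G by (auto simp: kit_stable_def kit_def intro: ctx_typing_jdeq.unit_intro)
next
  case (nat_form \<Gamma> i)
  then show ?case using G by (auto simp: kit_stable_def kit_def intro: ctx_typing_jdeq.nat_form)
next
  case (nat_zero \<Gamma>)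
  then show ?case using G by (auto simp: kit_stable_def kit_def intro: ctx_typing_jdeq.nat_zero)
next
  case (conv \<Gamma> a A B i)
  then show ?case by (simp add: kit_stable_def) (metis ctx_typing_jdeq.conv)
next
  case (eq_refl \<Gamma> a A)
  then show ?case by (auto simp: kit_stable_def intro: ctx_typing_jdeq.eq_refl)
next
  case (eq_sym \<Gamma> a b A)
  then show ?case by (auto simp: kit_stable_def intro: ctx_typing_jdeq.eq_sym)
next
  case (eq_trans \<Gamma> a b A c)
  then show ?case by (simp add: kit_stable_def) (metis ctx_typing_jdeq.eq_trans)
next
  case (eq_conv \<Gamma> a b A B i)
  then show ?case by (simp add: kit_stable_def) (metis ctx_typing_jdeq.eq_conv)
\<comment> \<open>All remaining rules are alike: the number of binders of each premise selects
  \<open>kit_stableD\<close> or one of its variants, the substitution is pushed to the leaves, and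
  the same rule is applied again.\<close>
qed (simp, ((rule kit_stableI, ((drule kit_stable_ctx)+, simp; fail),
      ((drule kit_stableD, assumption) | (drule kit_stableD1[OF _ G], assumption)
        | (drule kit_stableD2[OF _ G], assumption) | (drule kit_stableD3[OF _ G], assumption))+,
      simp only: subst_simps, (rule syntax_directed_rules; assumption))[1])+)

section \<open>Weakening and substitution as instances of the kit\<close>

definition renaming :: "(nat \<Rightarrow> tm) \<Rightarrow> tm list \<Rightarrow> tm list \<Rightarrow> bool" where
  "renaming \<sigma> \<Gamma> \<Delta> \<longleftrightarrow> (\<turnstile> \<Delta> ctx) \<and> (\<exists>\<rho>. \<sigma> = (\<lambda>n. Var (\<rho> n)) \<and>
     (\<forall>n < length \<Gamma>. \<rho> n < length \<Delta> \<and> \<up> (Suc (\<rho> n)) (\<Delta> ! \<rho> n) = subst \<sigma> (\<up> (Suc n) (\<Gamma> ! n))))"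

definition subst_ok :: "(nat \<Rightarrow> tm) \<Rightarrow> tm list \<Rightarrow> tm list \<Rightarrow> bool" where
  "subst_ok \<sigma> \<Gamma> \<Delta> \<longleftrightarrow> (\<turnstile> \<Delta> ctx) \<and> (\<forall>n < length \<Gamma>. \<Delta> \<turnstile> \<sigma> n \<^bold>: subst \<sigma> (\<up> (Suc n) (\<Gamma> ! n)))"

lemma subst_up_shift_Suc: "subst (up \<sigma>) (\<up> (Suc k) t) = \<up> 1 (subst \<sigma> (\<up> k t))"
  by (simp add: subst_shift shift_subst)

text \<open>\<open>renaming\<close> compares the types of variables as terms, not by a typing
  judgement, so passing under a binder is a computation with shifts and does not presuppose
  weakening.\<close>

lemma kit_renaming: "kit renaming"
  unfolding kit_def
proof (intro allI impI conjI)
  fix \<sigma> \<Gamma> \<Delta> assume "renaming \<sigma> \<Gamma> \<Delta>"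
  then obtain \<rho> where ctx: "\<turnstile> \<Delta> ctx" and \<sigma>: "\<sigma> = (\<lambda>n. Var (\<rho> n))"
    and \<rho>: "\<And>n. n < length \<Gamma> \<Longrightarrow> \<rho> n < length \<Delta> \<and> \<up> (Suc (\<rho> n)) (\<Delta> ! \<rho> n) = subst \<sigma> (\<up> (Suc n) (\<Gamma> ! n))"
    unfolding renaming_def by blast
  show "\<turnstile> \<Delta> ctx" by fact
  show "\<Delta> \<turnstile> \<sigma> n \<^bold>: subst \<sigma> (\<up> (Suc n) (\<Gamma> ! n))" if "n < length \<Gamma>" for n
    using var[OF ctx, of "\<rho> n"] \<rho>[OF that] \<sigma> by metis
  show "renaming (up \<sigma>) (A # \<Gamma>) (subst \<sigma> A # \<Delta>)" if A: "\<Delta> \<turnstile> subst \<sigma> A \<^bold>: Univ i" for A i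
    unfolding renaming_def
  proof (intro conjI exI[of _ "up_ren \<rho>"] allI impI)
    show "\<turnstile> subst \<sigma> A # \<Delta> ctx" using A by (rule ctx_ext)
    show "up \<sigma> = (\<lambda>n. Var (up_ren \<rho> n))" by (simp add: \<sigma> up_Var_comp)
    fix n assume "n < length (A # \<Gamma>)"
    then show "up_ren \<rho> n < length (subst \<sigma> A # \<Delta>)" using \<rho> by (cases n) auto
    show "\<up> (Suc (up_ren \<rho> n)) ((subst \<sigma> A # \<Delta>) ! up_ren \<rho> n) = subst (up \<sigma>) (\<up> (Suc n) ((A # \<Gamma>) ! n))"
    proof (cases n)
      case 0
      then show ?thesis by (simp add: subst_up_shift_Suc)
    next
      case (Suc m)
      with \<open>n < length (A # \<Gamma>)\<close> have "\<up> (Suc (\<rho> m)) (\<Delta> ! \<rho> m) = subst \<sigma> (\<up> (Suc m) (\<Gamma> ! m))"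
        using \<rho> by simp
      then have "\<up> 1 (\<up> (Suc (\<rho> m)) (\<Delta> ! \<rho> m)) = \<up> 1 (subst \<sigma> (\<up> (Suc m) (\<Gamma> ! m)))" by simp
      then show ?thesis using Suc by (simp add: subst_up_shift_Suc)
    qed
  qed
qed

text \<open>Quantifying over all suffixes makes the induction work: for \<open>pi_intro\<close>,
  whose only premise lives in \<open>A # \<Gamma>\<close>, the hypothesis is used with one more
  entry dropped.\<close>

lemma ctx_drop:
  "\<turnstile> \<Gamma> ctx \<Longrightarrow> \<turnstile> drop n \<Gamma> ctx"
  "\<Gamma> \<turnstile> t \<^bold>: A \<Longrightarrow> \<turnstile> drop n \<Gamma> ctx"
  "\<Gamma> \<turnstile> t \<doteq> u \<^bold>: A \<Longrightarrow> \<turnstile> drop n \<Gamma> ctx"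
proof (induction arbitrary: n and n and n rule: ctx_typing_jdeq.inducts)
  case (ctx_ext \<Gamma> A i n)
  then show ?case by (cases n) (auto intro: ctx_typing_jdeq.ctx_ext)
qed (simp_all add: ctx_empty, metis drop_Suc_Cons)

lemma typing_ctx: "\<Gamma> \<turnstile> t \<^bold>: A \<Longrightarrow> \<turnstile> \<Gamma> ctx"
  using ctx_drop(2)[of \<Gamma> t A 0] by simp

lemma ctx_ConsD:
  assumes "\<turnstile> A # \<Gamma> ctx"
  shows "\<turnstile> \<Gamma> ctx" "\<exists>i. \<Gamma> \<turnstile> A \<^bold>: Univ i"
proof -
  show "\<exists>i. \<Gamma> \<turnstile> A \<^bold>: Univ i" using assms by (cases rule: ctx.cases) auto
  then show "\<turnstile> \<Gamma> ctx" using typing_ctx by blast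
qed

lemma renaming_wk: "\<Gamma> \<turnstile> A \<^bold>: Univ i \<Longrightarrow> renaming (wk 1) \<Gamma> (A # \<Gamma>)"
  unfolding renaming_def
  by (intro conjI exI[of _ Suc]) (auto simp: ctx_ext simp flip: shift_eq_subst)

lemma weakening: "\<lbrakk>\<Gamma> \<turnstile> t \<^bold>: T; \<Gamma> \<turnstile> A \<^bold>: Univ i\<rbrakk> \<Longrightarrow> A # \<Gamma> \<turnstile> \<up> 1 t \<^bold>: \<up> 1 T"
  unfolding shift_eq_subst by (rule kit_stableD[OF kit_subst(2)[OF kit_renaming] renaming_wk])

lemma subst_ok_ctx: "subst_ok \<sigma> \<Gamma> \<Delta> \<Longrightarrow> \<turnstile> \<Delta> ctx"
  by (simp add: subst_ok_def)

lemma kit_subst_ok: "kit subst_ok"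
  unfolding kit_def
proof (intro allI impI conjI)
  fix \<sigma> \<Gamma> \<Delta> assume ok: "subst_ok \<sigma> \<Gamma> \<Delta>"
  then show "\<turnstile> \<Delta> ctx" by (rule subst_ok_ctx)
  show "\<Delta> \<turnstile> \<sigma> n \<^bold>: subst \<sigma> (\<up> (Suc n) (\<Gamma> ! n))" if "n < length \<Gamma>" for n
    using ok that by (simp add: subst_ok_def)
  fix A i assume A: "\<Delta> \<turnstile> subst \<sigma> A \<^bold>: Univ i"
  show "subst_ok (up \<sigma>) (A # \<Gamma>) (subst \<sigma> A # \<Delta>)"
    unfolding subst_ok_def
  proof (intro conjI allI impI)
    show ctx: "\<turnstile> subst \<sigma> A # \<Delta> ctx" using A by (rule ctx_ext)
    fix n assume n: "n < length (A # \<Gamma>)"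
    show "subst \<sigma> A # \<Delta> \<turnstile> up \<sigma> n \<^bold>: subst (up \<sigma>) (\<up> (Suc n) ((A # \<Gamma>) ! n))"
    proof (cases n)
      case 0
      then show ?thesis using var[OF ctx, of 0] by (simp add: subst_up_shift_Suc)
    next
      case (Suc m)
      then have "\<Delta> \<turnstile> \<sigma> m \<^bold>: subst \<sigma> (\<up> (Suc m) (\<Gamma> ! m))" using n ok by (simp add: subst_ok_def)
      from weakening[OF this A] show ?thesis using Suc by (simp add: subst_up_shift_Suc)
    qed
  qed
qed

lemma typing_subst: "\<lbrakk>\<Gamma> \<turnstile> t \<^bold>: A; subst_ok \<sigma> \<Gamma> \<Delta>\<rbrakk> \<Longrightarrow> \<Delta> \<turnstile> subst \<sigma> t \<^bold>: subst \<sigma> A"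
  by (rule kit_stableD[OF kit_subst(2)[OF kit_subst_ok]])

lemma jdeq_subst: "\<lbrakk>\<Gamma> \<turnstile> t \<doteq> u \<^bold>: A; subst_ok \<sigma> \<Gamma> \<Delta>\<rbrakk> \<Longrightarrow> \<Delta> \<turnstile> subst \<sigma> t \<doteq> subst \<sigma> u \<^bold>: subst \<sigma> A"
  by (rule kit_stableD[OF kit_subst(3)[OF kit_subst_ok]])

lemma subst_ok_Nil: "\<turnstile> \<Delta> ctx \<Longrightarrow> subst_ok \<sigma> [] \<Delta>"
  by (simp add: subst_ok_def)

lemma subst_ok_Var: "\<turnstile> \<Gamma> ctx \<Longrightarrow> subst_ok Var \<Gamma> \<Gamma>"
  by (simp add: subst_ok_def var)

lemma subst_ok_scons:
  assumes "subst_ok \<sigma> \<Gamma> \<Delta>" "\<Delta> \<turnstile> a \<^bold>: subst \<sigma> A"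
  shows "subst_ok (a \<bullet> \<sigma>) (A # \<Gamma>) \<Delta>"
  unfolding subst_ok_def
proof (intro conjI allI impI)
  show "\<turnstile> \<Delta> ctx" using assms(1) by (rule subst_ok_ctx)
  show "\<Delta> \<turnstile> (a \<bullet> \<sigma>) n \<^bold>: subst (a \<bullet> \<sigma>) (\<up> (Suc n) ((A # \<Gamma>) ! n))" if "n < length (A # \<Gamma>)" for n
    using that assms by (cases n) (auto simp: subst_ok_def subst_shift)
qed

lemma subst_ok_wk:
  assumes "subst_ok (wk k) \<Gamma> \<Delta>" "\<Delta> \<turnstile> A \<^bold>: Univ i"
  shows "subst_ok (wk (Suc k)) \<Gamma> (A # \<Delta>)"
  unfolding subst_ok_def
proof (intro conjI allI impI)
  show "\<turnstile> A # \<Delta> ctx" using assms(2) by (rule ctx_ext)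
  fix n assume "n < length \<Gamma>"
  then have "\<Delta> \<turnstile> wk k n \<^bold>: \<up> k (\<up> (Suc n) (\<Gamma> ! n))" using assms(1) by (simp add: subst_ok_def shift_eq_subst)
  from weakening[OF this assms(2)] show "A # \<Delta> \<turnstile> wk (Suc k) n \<^bold>: subst (wk (Suc k)) (\<up> (Suc n) (\<Gamma> ! n))"
    by (simp flip: shift_eq_subst)
qed

lemma wk_0 [simp]: "wk 0 = Var"
  by (rule ext) simp

lemma subst_ok_wk1: "\<Gamma> \<turnstile> A \<^bold>: Univ i \<Longrightarrow> subst_ok (wk 1) \<Gamma> (A # \<Gamma>)"
  using subst_ok_wk[of 0 \<Gamma> \<Gamma>] subst_ok_Var typing_ctx by auto

lemma subst_ok_wk2: "A # \<Gamma> \<turnstile> B \<^bold>: Univ i \<Longrightarrow> subst_ok (wk 2) \<Gamma> (B # A # \<Gamma>)"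
  using subst_ok_wk[of 1 \<Gamma> "A # \<Gamma>"] subst_ok_wk1 typing_ctx ctx_ConsD by (metis Suc_1)

lemma subst_ok_inst: "\<Gamma> \<turnstile> a \<^bold>: A \<Longrightarrow> subst_ok (a \<bullet> Var) (A # \<Gamma>) \<Gamma>"
  by (rule subst_ok_scons) (auto intro: subst_ok_Var typing_ctx)

lemma typing_inst: "\<lbrakk>A # \<Gamma> \<turnstile> t \<^bold>: B; \<Gamma> \<turnstile> a \<^bold>: A\<rbrakk> \<Longrightarrow> \<Gamma> \<turnstile> t\<lblot>a\<rblot> \<^bold>: B\<lblot>a\<rblot>"
  unfolding inst_def by (rule typing_subst[OF _ subst_ok_inst])

lemma jdeq_inst: "\<lbrakk>A # \<Gamma> \<turnstile> t \<doteq> u \<^bold>: B; \<Gamma> \<turnstile> a \<^bold>: A\<rbrakk> \<Longrightarrow> \<Gamma> \<turnstile> t\<lblot>a\<rblot> \<doteq> u\<lblot>a\<rblot> \<^bold>: B\<lblot>a\<rblot>"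
  unfolding inst_def by (rule jdeq_subst[OF _ subst_ok_inst])

section \<open>Cumulativity, context conversion, congruence of substitution\<close>

lemma cumul_le: "\<Gamma> \<turnstile> A \<^bold>: Univ i \<Longrightarrow> i \<le> j \<Longrightarrow> \<Gamma> \<turnstile> A \<^bold>: Univ j"
  by (rotate_tac, induction rule: dec_induct) (auto intro: cumul)

lemma eq_cumul_le: "\<Gamma> \<turnstile> A \<doteq> B \<^bold>: Univ i \<Longrightarrow> i \<le> j \<Longrightarrow> \<Gamma> \<turnstile> A \<doteq> B \<^bold>: Univ j"
  by (rotate_tac, induction rule: dec_induct) (auto intro: eq_cumul)

text \<open>Context conversion is the identity substitution, well-typed because variable 0 can be
  converted from A' to A. It therefore needs no induction of its own.\<close>

lemma ctx_conversion:
  assumes "\<Gamma> \<turnstile> A \<doteq> A' \<^bold>: Univ i" "\<Gamma> \<turnstile> A' \<^bold>: Univ i"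
  shows "subst_ok Var (A # \<Gamma>) (A' # \<Gamma>)"
proof -
  have "A' # \<Gamma> \<turnstile> Var 0 \<^bold>: \<up> 1 A'" using var[OF ctx_ext[OF assms(2)], of 0] by simp
  moreover have "A' # \<Gamma> \<turnstile> \<up> 1 A' \<doteq> \<up> 1 A \<^bold>: Univ i"
    using jdeq_subst[OF eq_sym[OF assms(1)] subst_ok_wk1[OF assms(2)]] by (simp add: shift_eq_subst)
  ultimately have "A' # \<Gamma> \<turnstile> Var 0 \<^bold>: \<up> 1 A" by (rule conv)
  then have "subst_ok (Var 0 \<bullet> wk 1) (A # \<Gamma>) (A' # \<Gamma>)"
    using subst_ok_scons[OF subst_ok_wk1[OF assms(2)]] by (simp add: shift_eq_subst)
  moreover have "Var 0 \<bullet> wk 1 = Var" by (rule nat_fun_eqI) simp_all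
  ultimately show ?thesis by simp
qed

text \<open>Substitution respects judgemental equality because the corresponding \<open>\<beta>\<close>-redexes do.\<close>

lemma inst_cong:
  assumes C: "A # \<Gamma> \<turnstile> C \<^bold>: Univ i" and eq: "\<Gamma> \<turnstile> a \<doteq> a' \<^bold>: A" and a: "\<Gamma> \<turnstile> a \<^bold>: A" "\<Gamma> \<turnstile> a' \<^bold>: A"
  shows "\<Gamma> \<turnstile> C\<lblot>a\<rblot> \<doteq> C\<lblot>a'\<rblot> \<^bold>: Univ i"
proof -
  have "\<Gamma> \<turnstile> Lam A C \<cdot> a \<doteq> Lam A C \<cdot> a' \<^bold>: (Univ i)\<lblot>a\<rblot>"
    by (rule pi_elim_cong[OF eq_refl[OF pi_intro[OF C]] eq])
  with pi_beta[OF C a(1)] pi_beta[OF C a(2)] show ?thesis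
    by (simp add: inst_def) (metis eq_sym eq_trans)
qed

text \<open>The three-variable version is needed for the motive of \<open>EqInd\<close>. Typings of
  both sides are assumed separately because the lemma serves to prove regularity and cannot appeal
  to it.\<close>

lemma subst3_cong:
  assumes C: "P # B # A # \<Gamma> \<turnstile> C \<^bold>: Univ i"
    and eq: "\<Gamma> \<turnstile> a \<doteq> a' \<^bold>: A" "\<Gamma> \<turnstile> b \<doteq> b' \<^bold>: B\<lblot>a\<rblot>" "\<Gamma> \<turnstile> p \<doteq> p' \<^bold>: subst (b \<bullet> a \<bullet> Var) P"
    and l: "\<Gamma> \<turnstile> a \<^bold>: A" "\<Gamma> \<turnstile> b \<^bold>: B\<lblot>a\<rblot>" "\<Gamma> \<turnstile> p \<^bold>: subst (b \<bullet> a \<bullet> Var) P"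
    and r: "\<Gamma> \<turnstile> a' \<^bold>: A" "\<Gamma> \<turnstile> b' \<^bold>: B\<lblot>a'\<rblot>" "\<Gamma> \<turnstile> p' \<^bold>: subst (b' \<bullet> a' \<bullet> Var) P"
  shows "\<Gamma> \<turnstile> subst (p \<bullet> b \<bullet> a \<bullet> Var) C \<doteq> subst (p' \<bullet> b' \<bullet> a' \<bullet> Var) C \<^bold>: Univ i"
proof -
  let ?F = "Lam A (Lam B (Lam P C))"
  let ?P = "\<lambda>a. subst (up (a \<bullet> Var)) P" and ?C = "\<lambda>a. subst (up (up (a \<bullet> Var))) C"
  have F: "\<Gamma> \<turnstile> ?F \<^bold>: Pi A (Pi B (Pi P (Univ i)))" by (intro pi_intro C)
  have comp: "(subst (up (a \<bullet> Var)) P)\<lblot>b\<rblot> = subst (b \<bullet> a \<bullet> Var) P"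
    "subst (p \<bullet> Var) (subst (up (b \<bullet> Var)) (subst (up (up (a \<bullet> Var))) C)) = subst (p \<bullet> b \<bullet> a \<bullet> Var) C" for a b p
    by (simp_all add: inst_def subst_comp_simps)
  have beta: "\<Gamma> \<turnstile> ?F \<cdot> a \<cdot> b \<cdot> p \<doteq> subst (p \<bullet> b \<bullet> a \<bullet> Var) C \<^bold>: Univ i"
    if t: "\<Gamma> \<turnstile> a \<^bold>: A" "\<Gamma> \<turnstile> b \<^bold>: B\<lblot>a\<rblot>" "\<Gamma> \<turnstile> p \<^bold>: subst (b \<bullet> a \<bullet> Var) P" for a b p
  proof -
    have ok1: "subst_ok (a \<bullet> Var) (A # \<Gamma>) \<Gamma>" using t(1) by (rule subst_ok_inst)
    have B: "\<exists>j. A # \<Gamma> \<turnstile> B \<^bold>: Univ j" and P: "\<exists>j. B # A # \<Gamma> \<turnstile> P \<^bold>: Univ j"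
      using typing_ctx[OF C] ctx_ConsD by blast+
    then have ok2: "subst_ok (up (a \<bullet> Var)) (B # A # \<Gamma>) (B\<lblot>a\<rblot> # \<Gamma>)"
      using kit_subst_ok ok1 typing_inst[OF _ t(1)] unfolding kit_def inst_def by (metis subst.simps(2))
    then have ok3: "subst_ok (up (up (a \<bullet> Var))) (P # B # A # \<Gamma>) (subst (up (a \<bullet> Var)) P # B\<lblot>a\<rblot> # \<Gamma>)"
      using kit_subst_ok P typing_subst[OF _ ok2] unfolding kit_def by (metis subst.simps(2))
    have "\<Gamma> \<turnstile> ?F \<cdot> a \<doteq> (Lam B (Lam P C))\<lblot>a\<rblot> \<^bold>: (Pi B (Pi P (Univ i)))\<lblot>a\<rblot>"
      by (rule pi_beta[OF _ t(1)]) (intro pi_intro C)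
    then have "\<Gamma> \<turnstile> ?F \<cdot> a \<doteq> Lam (B\<lblot>a\<rblot>) (Lam (?P a) (?C a)) \<^bold>: Pi (B\<lblot>a\<rblot>) (Pi (?P a) (Univ i))"
      by (simp add: inst_def)
    from pi_elim_cong[OF this eq_refl[OF t(2)]]
    have "\<Gamma> \<turnstile> ?F \<cdot> a \<cdot> b \<doteq> Lam (B\<lblot>a\<rblot>) (Lam (?P a) (?C a)) \<cdot> b \<^bold>: Pi (subst (b \<bullet> a \<bullet> Var) P) (Univ i)"
      by (simp add: inst_def subst_comp_simps)
    from pi_elim_cong[OF this eq_refl[OF t(3)]]
    have 1: "\<Gamma> \<turnstile> ?F \<cdot> a \<cdot> b \<cdot> p \<doteq> Lam (B\<lblot>a\<rblot>) (Lam (?P a) (?C a)) \<cdot> b \<cdot> p \<^bold>: Univ i"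
      by (simp add: inst_def)
    have C': "subst (up (a \<bullet> Var)) P # B\<lblot>a\<rblot> # \<Gamma> \<turnstile> subst (up (up (a \<bullet> Var))) C \<^bold>: Univ i"
      using typing_subst[OF C ok3] by simp
    have "\<Gamma> \<turnstile> Lam (B\<lblot>a\<rblot>) (Lam (?P a) (?C a)) \<cdot> b \<doteq> (Lam (?P a) (?C a))\<lblot>b\<rblot> \<^bold>: (Pi (?P a) (Univ i))\<lblot>b\<rblot>"
      by (rule pi_beta[OF pi_intro[OF C'] t(2)])
    then have "\<Gamma> \<turnstile> Lam (B\<lblot>a\<rblot>) (Lam (?P a) (?C a)) \<cdot> b \<doteq>
        Lam (subst (b \<bullet> a \<bullet> Var) P) (subst (up (b \<bullet> Var)) (?C a)) \<^bold>: Pi (subst (b \<bullet> a \<bullet> Var) P) (Univ i)"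
      by (simp add: inst_def subst_comp_simps)
    from pi_elim_cong[OF this eq_refl[OF t(3)]]
    have 2: "\<Gamma> \<turnstile> Lam (B\<lblot>a\<rblot>) (Lam (?P a) (?C a)) \<cdot> b \<cdot> p \<doteq>
        Lam (subst (b \<bullet> a \<bullet> Var) P) (subst (up (b \<bullet> Var)) (?C a)) \<cdot> p \<^bold>: Univ i"
      by (simp add: inst_def)
    have "subst (b \<bullet> a \<bullet> Var) P # \<Gamma> \<turnstile> subst (up (b \<bullet> Var)) (subst (up (up (a \<bullet> Var))) C) \<^bold>: Univ i"
      using kit_stableD1[OF kit_subst(2)[OF kit_subst_ok C'] kit_subst_ok subst_ok_inst[OF t(2)]] comp(1)
      by (simp add: inst_def)
    from pi_beta[OF this t(3)] 1 2 comp(2) show ?thesis by (simp add: inst_def) (metis eq_trans)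
  qed
  have "\<Gamma> \<turnstile> ?F \<cdot> a \<doteq> ?F \<cdot> a' \<^bold>: Pi (B\<lblot>a\<rblot>) (Pi (?P a) (Univ i))"
    using pi_elim_cong[OF eq_refl[OF F] eq(1)] by (simp add: inst_def)
  from pi_elim_cong[OF this eq(2)]
  have "\<Gamma> \<turnstile> ?F \<cdot> a \<cdot> b \<doteq> ?F \<cdot> a' \<cdot> b' \<^bold>: Pi (subst (b \<bullet> a \<bullet> Var) P) (Univ i)"
    by (simp add: inst_def subst_comp_simps)
  from pi_elim_cong[OF this eq(3)]
  have "\<Gamma> \<turnstile> ?F \<cdot> a \<cdot> b \<cdot> p \<doteq> ?F \<cdot> a' \<cdot> b' \<cdot> p' \<^bold>: Univ i"
    by (simp add: inst_def)
  then show ?thesis using beta[OF l] beta[OF r] by (meson eq_sym eq_trans)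
qed

section \<open>Regularity\<close>

text \<open>The conversion and cumulativity rules change the type and keep the term, so the
  formation premises survive them. This kind of inversion, unlike one for \<open>Lam\<close> or
  \<open>Tup\<close>, never has to compare two \<Pi>- or \<Sigma>-types.\<close>

lemma type_former_inversion:
  "\<turnstile> \<Gamma> ctx \<Longrightarrow> True"
  "\<Gamma> \<turnstile> t \<^bold>: T \<Longrightarrow> (case t of
      Pi A B \<Rightarrow> \<exists>i. (\<Gamma> \<turnstile> A \<^bold>: Univ i) \<and> (A # \<Gamma> \<turnstile> B \<^bold>: Univ i)
    | Sg A B \<Rightarrow> \<exists>i. (\<Gamma> \<turnstile> A \<^bold>: Univ i) \<and> (A # \<Gamma> \<turnstile> B \<^bold>: Univ i)
    | Succ n \<Rightarrow> \<Gamma> \<turnstile> n \<^bold>: Nat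
    | Plus A B \<Rightarrow> \<exists>i. (\<Gamma> \<turnstile> A \<^bold>: Univ i) \<and> (\<Gamma> \<turnstile> B \<^bold>: Univ i)
    | _ \<Rightarrow> True)"
  "\<Gamma> \<turnstile> t \<doteq> u \<^bold>: T \<Longrightarrow> True"
  by (induction rule: ctx_typing_jdeq.inducts) auto

lemma Pi_inversion: "\<Gamma> \<turnstile> Pi A B \<^bold>: T \<Longrightarrow> \<exists>i. (\<Gamma> \<turnstile> A \<^bold>: Univ i) \<and> (A # \<Gamma> \<turnstile> B \<^bold>: Univ i)"
  and Sg_inversion: "\<Gamma> \<turnstile> Sg A B \<^bold>: T \<Longrightarrow> \<exists>i. (\<Gamma> \<turnstile> A \<^bold>: Univ i) \<and> (A # \<Gamma> \<turnstile> B \<^bold>: Univ i)"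
  and Plus_inversion: "\<Gamma> \<turnstile> Plus A B \<^bold>: T \<Longrightarrow> \<exists>i. (\<Gamma> \<turnstile> A \<^bold>: Univ i) \<and> (\<Gamma> \<turnstile> B \<^bold>: Univ i)"
  and Succ_inversion: "\<Gamma> \<turnstile> Succ n \<^bold>: T \<Longrightarrow> \<Gamma> \<turnstile> n \<^bold>: Nat"
  using type_former_inversion(2) by fastforce+

definition is_type :: "tm list \<Rightarrow> tm \<Rightarrow> bool" where
  "is_type \<Gamma> A \<longleftrightarrow> (\<exists>i. \<Gamma> \<turnstile> A \<^bold>: Univ i)"

lemma is_typeI: "\<Gamma> \<turnstile> A \<^bold>: Univ i \<Longrightarrow> is_type \<Gamma> A"
  by (auto simp: is_type_def)

lemma is_type_head: "A # \<Gamma> \<turnstile> t \<^bold>: T \<Longrightarrow> is_type \<Gamma> A"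
  unfolding is_type_def using ctx_ConsD typing_ctx by blast

lemma is_type_Univ: "\<turnstile> \<Gamma> ctx \<Longrightarrow> is_type \<Gamma> (Univ i)"
  using univ is_typeI by blast

lemma is_type_inst: "is_type (A # \<Gamma>) B \<Longrightarrow> \<Gamma> \<turnstile> a \<^bold>: A \<Longrightarrow> is_type \<Gamma> B\<lblot>a\<rblot>"
  unfolding is_type_def using typing_inst by (fastforce simp: inst_def)

lemma is_type_subst: "is_type \<Gamma> A \<Longrightarrow> subst_ok \<sigma> \<Gamma> \<Delta> \<Longrightarrow> is_type \<Delta> (subst \<sigma> A)"
  unfolding is_type_def using typing_subst by fastforce

lemma is_type_Pi: "is_type (A # \<Gamma>) B \<Longrightarrow> is_type \<Gamma> (Pi A B)"
  unfolding is_type_def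
  by (metis is_type_def is_type_head cumul_le max.cobounded1 max.cobounded2 pi_form)

lemma is_type_Sg: "is_type (A # \<Gamma>) B \<Longrightarrow> is_type \<Gamma> (Sg A B)"
  unfolding is_type_def
  by (metis is_type_def is_type_head cumul_le max.cobounded1 max.cobounded2 sg_form)

lemma is_type_ctx: "\<turnstile> \<Gamma> ctx \<Longrightarrow> n < length \<Gamma> \<Longrightarrow> is_type \<Gamma> (\<up> (Suc n) (\<Gamma> ! n))"
proof (induction \<Gamma> arbitrary: n)
  case (Cons A \<Gamma>)
  obtain i where A: "\<Gamma> \<turnstile> A \<^bold>: Univ i" using ctx_ConsD[OF Cons.prems(1)] by blast
  show ?case
  proof (cases n)
    case 0
    then show ?thesis using weakening[OF A A] by (auto simp: is_type_def shift_def)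
  next
    case (Suc m)
    then have "is_type \<Gamma> (\<up> (Suc m) (\<Gamma> ! m))" using Cons ctx_ConsD by auto
    then obtain j where "\<Gamma> \<turnstile> \<up> (Suc m) (\<Gamma> ! m) \<^bold>: Univ j" by (auto simp: is_type_def)
    from weakening[OF this A] show ?thesis using Suc by (auto simp: is_type_def shift_def ren_ren)
  qed
qed simp

lemma is_type_PiD: "is_type \<Gamma> (Pi A B) \<Longrightarrow> is_type (A # \<Gamma>) B"
  and is_type_SgD: "is_type \<Gamma> (Sg A B) \<Longrightarrow> is_type (A # \<Gamma>) B"
  using Pi_inversion Sg_inversion unfolding is_type_def by blast+

lemma conv_type: "\<Gamma> \<turnstile> a \<^bold>: A \<Longrightarrow> \<Gamma> \<turnstile> B \<doteq> A \<^bold>: Univ i \<Longrightarrow> \<Gamma> \<turnstile> a \<^bold>: B"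
  by (meson conv eq_sym)

section \<open>Context morphisms that specialize a motive to constructors\<close>

lemma subst_ok_Tup: "is_type \<Gamma> (Sg A B) \<Longrightarrow> subst_ok (Tup (Var 1) (Var 0) \<bullet> wk 2) (Sg A B # \<Gamma>) (B # A # \<Gamma>)"
proof -
  assume "is_type \<Gamma> (Sg A B)"
  then obtain i where A: "\<Gamma> \<turnstile> A \<^bold>: Univ i" and B: "A # \<Gamma> \<turnstile> B \<^bold>: Univ i"
    using Sg_inversion unfolding is_type_def by blast
  have wk: "subst_ok (wk 2) \<Gamma> (B # A # \<Gamma>)" using B by (rule subst_ok_wk2)
  have ctx: "\<turnstile> B # A # \<Gamma> ctx" using B by (rule ctx_ext)
  have 0: "B # A # \<Gamma> \<turnstile> Var 0 \<^bold>: \<up> 1 B" and 1: "B # A # \<Gamma> \<turnstile> Var 1 \<^bold>: \<up> 2 A"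
    using var[OF ctx, of 0] var[OF ctx, of 1] by (simp_all add: numeral_2_eq_2)
  have up2: "up (wk 2) n = (Var 0 \<bullet> wk 3) n" for n by (cases n) simp_all
  have B': "subst (wk 2) A # B # A # \<Gamma> \<turnstile> subst (up (wk 2)) B \<^bold>: Univ i"
    using kit_stableD1[OF kit_subst(2)[OF kit_subst_ok B] kit_subst_ok wk] by (simp only: subst.simps)
  have "(subst (up (wk 2)) B)\<lblot>Var 1\<rblot> = \<up> 1 B"
    by (simp add: inst_def shift_eq_subst subst_comp_simps)
      (rule arg_cong[where f = "\<lambda>s. subst s B"], rule nat_fun_eqI, simp_all)
  then have "B # A # \<Gamma> \<turnstile> Tup (Var 1) (Var 0) \<^bold>: Sg (subst (wk 2) A) (subst (up (wk 2)) B)"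
    using sg_intro[OF B'] 0 1 by (simp add: shift_eq_subst)
  then show ?thesis using subst_ok_scons[OF wk] by simp
qed

lemma subst_ok_Inj1: "\<Gamma> \<turnstile> A \<^bold>: Univ i \<Longrightarrow> \<Gamma> \<turnstile> B \<^bold>: Univ i \<Longrightarrow> subst_ok (Inj1 (Var 0) \<bullet> wk 1) (Plus A B # \<Gamma>) (A # \<Gamma>)"
  using weakening[of \<Gamma> A "Univ i" A i] weakening[of \<Gamma> B "Univ i" A i] var[OF ctx_ext, of \<Gamma> A i 0]
  by (intro subst_ok_scons subst_ok_wk1) (auto intro!: plus_intro1[of _ _ i] simp: shift_eq_subst)

lemma subst_ok_Inj2: "\<Gamma> \<turnstile> A \<^bold>: Univ i \<Longrightarrow> \<Gamma> \<turnstile> B \<^bold>: Univ i \<Longrightarrow> subst_ok (Inj2 (Var 0) \<bullet> wk 1) (Plus A B # \<Gamma>) (B # \<Gamma>)"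
  using weakening[of \<Gamma> A "Univ i" B i] weakening[of \<Gamma> B "Univ i" B i] var[OF ctx_ext, of \<Gamma> B i 0]
  by (intro subst_ok_scons subst_ok_wk1) (auto intro!: plus_intro2[of _ _ i] simp: shift_eq_subst)

lemma subst_ok_Succ: "Nat # \<Gamma> \<turnstile> C \<^bold>: Univ i \<Longrightarrow> subst_ok (Succ (Var 1) \<bullet> wk 2) (Nat # \<Gamma>) (C # Nat # \<Gamma>)"
  using var[OF ctx_ext, of "Nat # \<Gamma>" C i 1]
  by (intro subst_ok_scons subst_ok_wk2) (auto intro!: nat_succ simp: shift_eq_subst)

lemma subst_ok_Refl:
  assumes "is_type \<Gamma> A"
  shows "subst_ok (Refl (Var 0) \<bullet> Var 0 \<bullet> Var 0 \<bullet> wk 1) (Eq (\<up> 2 A) (Var 1) (Var 0) # \<up> 1 A # A # \<Gamma>) (A # \<Gamma>)"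
proof -
  obtain i where A: "\<Gamma> \<turnstile> A \<^bold>: Univ i" using assms by (auto simp: is_type_def)
  have v: "A # \<Gamma> \<turnstile> Var 0 \<^bold>: \<up> 1 A" using var[OF ctx_ext[OF A], of 0] by simp
  have A': "A # \<Gamma> \<turnstile> \<up> 1 A \<^bold>: Univ i" using weakening[OF A A] by (simp add: shift_def)
  show ?thesis
    using v id_intro[OF A' v] by (intro subst_ok_scons subst_ok_wk1[OF A]) (simp_all add: shift_eq_subst subst_subst wk_def[abs_def])
qed

lemma subst_ok_path:
  assumes "\<Gamma> \<turnstile> a \<^bold>: A" "\<Gamma> \<turnstile> b \<^bold>: A" "\<Gamma> \<turnstile> p \<^bold>: Eq A a b"
  shows "subst_ok (p \<bullet> b \<bullet> a \<bullet> Var) (Eq (\<up> 2 A) (Var 1) (Var 0) # \<up> 1 A # A # \<Gamma>) \<Gamma>"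
  using assms by (intro subst_ok_scons subst_ok_Var) (auto simp: shift_eq_subst subst_subst dest: typing_ctx)


lemma subst_Univ [simp]: "(Univ i)\<lblot>a\<rblot> = Univ i" "Nat\<lblot>a\<rblot> = Nat"
  by (simp_all add: inst_def)

lemma conv_endpoints:
  assumes "\<Gamma> \<turnstile> A \<^bold>: Univ i" "\<Gamma> \<turnstile> a \<doteq> a' \<^bold>: A" "\<Gamma> \<turnstile> b \<doteq> b' \<^bold>: A" "\<Gamma> \<turnstile> p \<^bold>: Eq A a b"
  shows "\<Gamma> \<turnstile> p \<^bold>: Eq A a' b'"
  using conv[OF assms(4) id_form_cong[OF eq_refl[OF assms(1)] assms(2,3)]] .

text \<open>The work lies in the right-hand sides of the congruence rules: there the motive, the
  domain or an argument has changed, so the term first receives a type built from the new parts.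
  That type is then converted back by \<open>inst_cong\<close> or \<open>subst3_cong\<close>, by
  substitution into the equality of motives, and by context conversion.\<close>

theorem regularity:
  "\<turnstile> \<Gamma> ctx \<Longrightarrow> True"
  "\<Gamma> \<turnstile> t \<^bold>: A \<Longrightarrow> is_type \<Gamma> A"
  "\<Gamma> \<turnstile> t \<doteq> u \<^bold>: A \<Longrightarrow> (\<Gamma> \<turnstile> t \<^bold>: A) \<and> (\<Gamma> \<turnstile> u \<^bold>: A) \<and> is_type \<Gamma> A"
proof (induction rule: ctx_typing_jdeq.inducts)
  case (var \<Gamma> n)
  then show ?case by (simp add: is_type_ctx)
next
  case (conv \<Gamma> a A B i)
  then show ?case by (auto intro: is_typeI)
next
  case (eq_conv \<Gamma> a b A B i)
  then show ?case by (meson ctx_typing_jdeq.conv is_typeI)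
next
  case (pi_intro A \<Gamma> b B)
  then show ?case by (simp add: is_type_Pi)
next
  case (pi_elim \<Gamma> f A B a)
  then show ?case using is_type_PiD is_type_inst by blast
next
  case (pi_beta A \<Gamma> b B a)
  then show ?case by (auto intro: is_type_inst typing_inst ctx_typing_jdeq.pi_elim ctx_typing_jdeq.pi_intro)
next
  case (pi_eta \<Gamma> f A B)
  then obtain i where A: "\<Gamma> \<turnstile> A \<^bold>: Univ i" using is_type_PiD is_type_def Pi_inversion by metis
  have "A # \<Gamma> \<turnstile> \<up> 1 f \<^bold>: Pi (\<up> 1 A) (subst (up (wk 1)) B)"
    using weakening[OF pi_eta.hyps A] by (simp only: shift_eq_subst subst.simps)
  moreover have "A # \<Gamma> \<turnstile> Var 0 \<^bold>: \<up> 1 A" using ctx_typing_jdeq.var[OF ctx_ext[OF A], of 0] by simp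
  moreover have "(subst (up (wk 1)) B)\<lblot>Var 0\<rblot> = subst Var B"
    by (simp only: inst_def subst_comp_simps) (rule arg_cong[where f = "\<lambda>s. subst s B"], rule nat_fun_eqI, simp_all)
  ultimately have "A # \<Gamma> \<turnstile> \<up> 1 f \<cdot> Var 0 \<^bold>: B" using ctx_typing_jdeq.pi_elim by fastforce
  then show ?case using pi_eta ctx_typing_jdeq.pi_intro by blast
next
  case (pi_form_cong \<Gamma> A A' i B B')
  then have "A' # \<Gamma> \<turnstile> B' \<^bold>: Univ i" using typing_subst[OF _ ctx_conversion, of A \<Gamma> B'] by fastforce
  then show ?case using pi_form_cong by (auto intro: ctx_typing_jdeq.pi_form)
next
  case (pi_intro_cong \<Gamma> A A' i b b' B)
  then have "A' # \<Gamma> \<turnstile> b' \<^bold>: B" using typing_subst[OF _ ctx_conversion, of A \<Gamma> b'] by fastforce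
  then have l: "\<Gamma> \<turnstile> Lam A' b' \<^bold>: Pi A' B" by (rule ctx_typing_jdeq.pi_intro)
  obtain j where "A # \<Gamma> \<turnstile> B \<^bold>: Univ j" using pi_intro_cong by (auto simp: is_type_def)
  then have "\<Gamma> \<turnstile> Pi A B \<doteq> Pi A' B \<^bold>: Univ (max i j)"
    using pi_intro_cong by (intro ctx_typing_jdeq.pi_form_cong eq_refl) (auto intro: eq_cumul_le cumul_le)
  from conv_type[OF l this] show ?case using pi_intro_cong by (auto intro: ctx_typing_jdeq.pi_intro is_type_Pi)
next
  case (pi_elim_cong \<Gamma> f f' A B a a')
  then obtain i where "A # \<Gamma> \<turnstile> B \<^bold>: Univ i" using is_type_PiD is_type_def by metis
  then have "\<Gamma> \<turnstile> B\<lblot>a\<rblot> \<doteq> B\<lblot>a'\<rblot> \<^bold>: Univ i" using pi_elim_cong by (auto intro: inst_cong)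
  moreover have "\<Gamma> \<turnstile> f' \<cdot> a' \<^bold>: B\<lblot>a'\<rblot>" using pi_elim_cong by (auto intro: ctx_typing_jdeq.pi_elim)
  ultimately have "\<Gamma> \<turnstile> f' \<cdot> a' \<^bold>: B\<lblot>a\<rblot>" by (meson conv_type)
  then show ?case using pi_elim_cong is_type_PiD is_type_inst by (meson ctx_typing_jdeq.pi_elim)
next
  case (sg_intro A \<Gamma> B i a b)
  then show ?case using is_type_Sg is_typeI by blast
next
  case (sg_elim A B \<Gamma> C i c p)
  then show ?case using is_type_inst is_typeI by blast
next
  case (sg_beta A B \<Gamma> C i c a b)
  obtain j where B: "A # \<Gamma> \<turnstile> B \<^bold>: Univ j"
    using is_type_SgD[OF is_type_head[OF sg_beta.hyps(1)]] by (auto simp: is_type_def)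
  have tup: "\<Gamma> \<turnstile> Tup a b \<^bold>: Sg A B" using sg_beta by (intro ctx_typing_jdeq.sg_intro[OF B])
  have "subst_ok (b \<bullet> a \<bullet> Var) (B # A # \<Gamma>) \<Gamma>"
    using sg_beta by (auto intro!: subst_ok_scons subst_ok_Var typing_ctx simp: inst_def)
  from typing_subst[OF sg_beta.hyps(2) this] have "\<Gamma> \<turnstile> subst (b \<bullet> a \<bullet> Var) c \<^bold>: C\<lblot>Tup a b\<rblot>"
    by (simp add: inst_def subst_subst comp_scons)
  then show ?case using sg_beta tup is_type_inst is_typeI ctx_typing_jdeq.sg_elim by blast
next
  case (sg_form_cong \<Gamma> A A' i B B')
  then have "A' # \<Gamma> \<turnstile> B' \<^bold>: Univ i" using typing_subst[OF _ ctx_conversion, of A \<Gamma> B'] by fastforce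
  then show ?case using sg_form_cong by (auto intro: ctx_typing_jdeq.sg_form)
next
  case (sg_intro_cong A \<Gamma> B i a a' b b')
  then have "\<Gamma> \<turnstile> B\<lblot>a\<rblot> \<doteq> B\<lblot>a'\<rblot> \<^bold>: Univ i" by (auto intro: inst_cong)
  then have "\<Gamma> \<turnstile> b' \<^bold>: B\<lblot>a'\<rblot>" using sg_intro_cong by (auto intro: ctx_typing_jdeq.conv)
  then show ?case using sg_intro_cong is_type_Sg is_typeI by (meson ctx_typing_jdeq.sg_intro)
next
  case (sg_elim_cong A B \<Gamma> C C' i c c' p p')
  have "B # A # \<Gamma> \<turnstile> subst (Tup (Var 1) (Var 0) \<bullet> wk 2) C \<doteq> subst (Tup (Var 1) (Var 0) \<bullet> wk 2) C' \<^bold>: Univ i"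
    using jdeq_subst[OF sg_elim_cong.hyps(1) subst_ok_Tup] sg_elim_cong by simp
  then have "\<Gamma> \<turnstile> SgInd C' c' p' \<^bold>: C'\<lblot>p'\<rblot>"
    using sg_elim_cong by (meson ctx_typing_jdeq.sg_elim ctx_typing_jdeq.conv)
  moreover have "\<Gamma> \<turnstile> C\<lblot>p\<rblot> \<doteq> C'\<lblot>p'\<rblot> \<^bold>: Univ i"
    using sg_elim_cong inst_cong[of "Sg A B" \<Gamma> C i p p'] jdeq_inst[OF sg_elim_cong.hyps(1), of p'] by (auto intro: eq_trans)
  ultimately have "\<Gamma> \<turnstile> SgInd C' c' p' \<^bold>: C\<lblot>p\<rblot>" by (rule conv_type)
  then show ?case using sg_elim_cong is_type_inst is_typeI by (meson ctx_typing_jdeq.sg_elim)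
next
  case (plus_elim A B \<Gamma> C i c d e)
  then show ?case using is_type_inst is_typeI by blast
next
  case (plus_beta1 A B \<Gamma> C i c d a)
  obtain j where AB: "\<Gamma> \<turnstile> A \<^bold>: Univ j" "\<Gamma> \<turnstile> B \<^bold>: Univ j"
    using is_type_head[OF plus_beta1.hyps(1)] Plus_inversion unfolding is_type_def by blast
  then have inj: "\<Gamma> \<turnstile> Inj1 a \<^bold>: Plus A B" using plus_beta1 by (auto intro: ctx_typing_jdeq.plus_intro1)
  have "\<Gamma> \<turnstile> c\<lblot>a\<rblot> \<^bold>: C\<lblot>Inj1 a\<rblot>"
    using typing_inst[OF plus_beta1.hyps(2,4)] by (simp add: inst_def subst_subst comp_scons)
  then show ?case using plus_beta1 inj is_type_inst is_typeI ctx_typing_jdeq.plus_elim by meson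
next
  case (plus_beta2 A B \<Gamma> C i c d b)
  obtain j where AB: "\<Gamma> \<turnstile> A \<^bold>: Univ j" "\<Gamma> \<turnstile> B \<^bold>: Univ j"
    using is_type_head[OF plus_beta2.hyps(1)] Plus_inversion unfolding is_type_def by blast
  then have inj: "\<Gamma> \<turnstile> Inj2 b \<^bold>: Plus A B" using plus_beta2 by (auto intro: ctx_typing_jdeq.plus_intro2)
  have "\<Gamma> \<turnstile> d\<lblot>b\<rblot> \<^bold>: C\<lblot>Inj2 b\<rblot>"
    using typing_inst[OF plus_beta2.hyps(3,4)] by (simp add: inst_def subst_subst comp_scons)
  then show ?case using plus_beta2 inj is_type_inst is_typeI ctx_typing_jdeq.plus_elim by meson
next
  case (plus_elim_cong A B \<Gamma> C C' i c c' d d' e e')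
  let ?i = "Inj1 (Var 0) \<bullet> wk 1" and ?j = "Inj2 (Var 0) \<bullet> wk 1"
  obtain j where AB: "\<Gamma> \<turnstile> A \<^bold>: Univ j" "\<Gamma> \<turnstile> B \<^bold>: Univ j"
    using plus_elim_cong Plus_inversion unfolding is_type_def by blast
  have "A # \<Gamma> \<turnstile> subst ?i C \<doteq> subst ?i C' \<^bold>: Univ i" "B # \<Gamma> \<turnstile> subst ?j C \<doteq> subst ?j C' \<^bold>: Univ i"
    using jdeq_subst[OF plus_elim_cong.hyps(1)] subst_ok_Inj1[OF AB] subst_ok_Inj2[OF AB] by fastforce+
  then have "\<Gamma> \<turnstile> PlusInd C' c' d' e' \<^bold>: C'\<lblot>e'\<rblot>"
    using plus_elim_cong by (meson ctx_typing_jdeq.plus_elim ctx_typing_jdeq.conv)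
  moreover have "\<Gamma> \<turnstile> C\<lblot>e\<rblot> \<doteq> C'\<lblot>e'\<rblot> \<^bold>: Univ i"
    using plus_elim_cong inst_cong[of "Plus A B" \<Gamma> C i e e'] jdeq_inst[OF plus_elim_cong.hyps(1), of e'] by (auto intro: eq_trans)
  ultimately have "\<Gamma> \<turnstile> PlusInd C' c' d' e' \<^bold>: C\<lblot>e\<rblot>" by (rule conv_type)
  then show ?case using plus_elim_cong is_type_inst is_typeI by (meson ctx_typing_jdeq.plus_elim)
next
  case (empty_elim \<Gamma> C i a)
  then show ?case using is_type_inst is_typeI by blast
next
  case (empty_elim_cong \<Gamma> C C' i a a')
  then have "\<Gamma> \<turnstile> C\<lblot>a\<rblot> \<doteq> C'\<lblot>a'\<rblot> \<^bold>: Univ i"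
    using inst_cong[of Empty \<Gamma> C i a a'] jdeq_inst[OF empty_elim_cong.hyps(1), of a'] by (auto intro: eq_trans)
  then have "\<Gamma> \<turnstile> EmptyInd C' a' \<^bold>: C\<lblot>a\<rblot>"
    using empty_elim_cong by (auto intro: conv_type ctx_typing_jdeq.empty_elim)
  then show ?case using empty_elim_cong is_type_inst is_typeI by (meson ctx_typing_jdeq.empty_elim)
next
  case (unit_elim \<Gamma> C i c a)
  then show ?case using is_type_inst is_typeI by blast
next
  case (unit_beta \<Gamma> C i c)
  then show ?case using ctx_typing_jdeq.unit_elim unit_intro typing_ctx by meson
next
  case (unit_elim_cong \<Gamma> C C' i c c' a a')
  have "\<Gamma> \<turnstile> c' \<^bold>: C'\<lblot>Star\<rblot>"
    using unit_elim_cong jdeq_inst[OF unit_elim_cong.hyps(1) unit_intro] typing_ctx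
    by (simp, meson ctx_typing_jdeq.conv)
  then have "\<Gamma> \<turnstile> UnitInd C' c' a' \<^bold>: C'\<lblot>a'\<rblot>"
    using unit_elim_cong by (auto intro: ctx_typing_jdeq.unit_elim)
  moreover have "\<Gamma> \<turnstile> C\<lblot>a\<rblot> \<doteq> C'\<lblot>a'\<rblot> \<^bold>: Univ i"
    using unit_elim_cong inst_cong[of Unit \<Gamma> C i a a'] jdeq_inst[OF unit_elim_cong.hyps(1), of a'] by (auto intro: eq_trans)
  ultimately have "\<Gamma> \<turnstile> UnitInd C' c' a' \<^bold>: C\<lblot>a\<rblot>" by (rule conv_type)
  then show ?case using unit_elim_cong is_type_inst is_typeI by (meson ctx_typing_jdeq.unit_elim)
next
  case (nat_elim \<Gamma> C i c d n)
  then show ?case using is_type_inst is_typeI by blast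
next
  case (nat_beta_zero \<Gamma> C i c d)
  then show ?case using ctx_typing_jdeq.nat_elim nat_zero typing_ctx by meson
next
  case (nat_beta_succ \<Gamma> C i c d n)
  have ind: "\<Gamma> \<turnstile> NatInd C c d n \<^bold>: C\<lblot>n\<rblot>" using nat_beta_succ by (auto intro: ctx_typing_jdeq.nat_elim)
  have "subst_ok (NatInd C c d n \<bullet> n \<bullet> Var) (C # Nat # \<Gamma>) \<Gamma>"
    using nat_beta_succ ind by (auto intro!: subst_ok_scons subst_ok_Var typing_ctx simp: inst_def)
  from typing_subst[OF nat_beta_succ.hyps(3) this] have "\<Gamma> \<turnstile> subst (NatInd C c d n \<bullet> n \<bullet> Var) d \<^bold>: C\<lblot>Succ n\<rblot>"
    by (simp add: inst_def subst_subst comp_scons)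
  moreover have "\<Gamma> \<turnstile> NatInd C c d (Succ n) \<^bold>: C\<lblot>Succ n\<rblot>"
    using nat_beta_succ by (auto intro: ctx_typing_jdeq.nat_elim nat_succ)
  ultimately show ?case using nat_beta_succ is_type_inst is_typeI nat_succ by blast
next
  case (nat_elim_cong \<Gamma> C C' i c c' d d' n n')
  have c: "\<Gamma> \<turnstile> c' \<^bold>: C'\<lblot>Zero\<rblot>"
    using nat_elim_cong jdeq_inst[OF nat_elim_cong.hyps(1) nat_zero] typing_ctx by (simp, meson ctx_typing_jdeq.conv)
  have "C # Nat # \<Gamma> \<turnstile> subst (Succ (Var 1) \<bullet> wk 2) C \<doteq> subst (Succ (Var 1) \<bullet> wk 2) C' \<^bold>: Univ i"
    using jdeq_subst[OF nat_elim_cong.hyps(1) subst_ok_Succ[of \<Gamma> C i]] nat_elim_cong by simp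
  then have "C # Nat # \<Gamma> \<turnstile> d' \<^bold>: subst (Succ (Var 1) \<bullet> wk 2) C'"
    using nat_elim_cong by (meson ctx_typing_jdeq.conv)
  \<comment> \<open>The context of the successor branch contains the motive itself, so besides its
    type the context has to be converted too.\<close>
  then have "C' # Nat # \<Gamma> \<turnstile> d' \<^bold>: subst (Succ (Var 1) \<bullet> wk 2) C'"
    using typing_subst[OF _ ctx_conversion, of C "Nat # \<Gamma>" d'] nat_elim_cong by fastforce
  then have "\<Gamma> \<turnstile> NatInd C' c' d' n' \<^bold>: C'\<lblot>n'\<rblot>"
    using nat_elim_cong c by (auto intro: ctx_typing_jdeq.nat_elim)
  moreover have "\<Gamma> \<turnstile> C\<lblot>n\<rblot> \<doteq> C'\<lblot>n'\<rblot> \<^bold>: Univ i"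
    using nat_elim_cong inst_cong[of Nat \<Gamma> C i n n'] jdeq_inst[OF nat_elim_cong.hyps(1), of n'] by (auto intro: eq_trans)
  ultimately have "\<Gamma> \<turnstile> NatInd C' c' d' n' \<^bold>: C\<lblot>n\<rblot>" by (rule conv_type)
  then show ?case using nat_elim_cong is_type_inst is_typeI by (meson ctx_typing_jdeq.nat_elim)
next
  case (id_intro \<Gamma> A i a)
  then show ?case using id_form is_typeI by blast
next
  case (id_elim A \<Gamma> C i c a b p)
  then show ?case using is_type_subst[OF is_typeI subst_ok_path] by blast
next
  case (id_beta A \<Gamma> C i c a)
  obtain j where A: "\<Gamma> \<turnstile> A \<^bold>: Univ j" using id_beta by (auto simp: is_type_def)
  have r: "\<Gamma> \<turnstile> Refl a \<^bold>: Eq A a a" by (rule ctx_typing_jdeq.id_intro[OF A id_beta.hyps(3)])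
  have "\<Gamma> \<turnstile> c\<lblot>a\<rblot> \<^bold>: subst (Refl a \<bullet> a \<bullet> a \<bullet> Var) C"
    using typing_inst[OF id_beta.hyps(2,3)] by (simp add: inst_def subst_subst comp_scons)
  then show ?case using id_beta r is_type_subst[OF is_typeI subst_ok_path] ctx_typing_jdeq.id_elim by blast
next
  case (id_form_cong \<Gamma> A A' i a a' b b')
  then show ?case using id_form ctx_typing_jdeq.conv by meson
next
  case (id_intro_cong \<Gamma> A i a a')
  then have "\<Gamma> \<turnstile> Refl a' \<^bold>: Eq A a a" by (meson conv_endpoints eq_sym ctx_typing_jdeq.id_intro)
  then show ?case using id_intro_cong id_form is_typeI ctx_typing_jdeq.id_intro by meson
next
  case (id_elim_cong A \<Gamma> C C' i c c' a a' b b' p p')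
  let ?E = "Eq (\<up> 2 A) (Var 1) (Var 0) # \<up> 1 A # A # \<Gamma>"
  let ?r = "Refl (Var 0) \<bullet> Var 0 \<bullet> Var 0 \<bullet> wk 1"
  obtain j where A: "\<Gamma> \<turnstile> A \<^bold>: Univ j" using id_elim_cong by (auto simp: is_type_def)
  have "A # \<Gamma> \<turnstile> subst ?r C \<doteq> subst ?r C' \<^bold>: Univ i"
    using jdeq_subst[OF id_elim_cong.hyps(1) subst_ok_Refl] is_typeI[OF A] by simp
  then have c: "A # \<Gamma> \<turnstile> c' \<^bold>: subst ?r C'" using id_elim_cong by (auto intro: ctx_typing_jdeq.conv)
  have p': "\<Gamma> \<turnstile> p' \<^bold>: Eq A a' b'" using id_elim_cong conv_endpoints[OF A] by blast
  have "\<Gamma> \<turnstile> EqInd C' c' a' b' p' \<^bold>: subst (p' \<bullet> b' \<bullet> a' \<bullet> Var) C'"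
    using id_elim_cong c p' by (auto intro: ctx_typing_jdeq.id_elim)
  moreover have "\<Gamma> \<turnstile> subst (p \<bullet> b \<bullet> a \<bullet> Var) C \<doteq> subst (p' \<bullet> b' \<bullet> a' \<bullet> Var) C \<^bold>: Univ i"
    by (rule subst3_cong[of _ _ A]) (use id_elim_cong p' in \<open>auto simp: inst_def shift_eq_subst subst_subst\<close>)
  moreover have "\<Gamma> \<turnstile> subst (p' \<bullet> b' \<bullet> a' \<bullet> Var) C \<doteq> subst (p' \<bullet> b' \<bullet> a' \<bullet> Var) C' \<^bold>: Univ i"
    using jdeq_subst[OF id_elim_cong.hyps(1) subst_ok_path] id_elim_cong p' by fastforce
  ultimately have "\<Gamma> \<turnstile> EqInd C' c' a' b' p' \<^bold>: subst (p \<bullet> b \<bullet> a \<bullet> Var) C" by (meson conv_type eq_trans)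
  then show ?case using id_elim_cong is_type_subst[OF is_typeI subst_ok_path] ctx_typing_jdeq.id_elim by meson
qed (auto intro: is_type_Univ typing_ctx univ is_typeI ctx_typing_jdeq.intros)

section \<open>A normalizing type checker\<close>

text \<open>
  \<open>lift k m\<close> adds \<open>m\<close> to the variables from \<open>k\<close> on, and \<open>msubst k ts m\<close> replaces those of them that have
  an entry in \<open>ts\<close> and adds \<open>m\<close> to the others.  Both work without function closures, which suits
  evaluation by rewriting.
\<close>

fun lift_var :: "nat \<Rightarrow> nat \<Rightarrow> nat \<Rightarrow> nat" where
  "lift_var 0 m n = n + m"
| "lift_var (Suc k) m 0 = 0"
| "lift_var (Suc k) m (Suc n) = Suc (lift_var k m n)"

primrec lift :: "nat \<Rightarrow> nat \<Rightarrow> tm \<Rightarrow> tm" where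
  "lift k m (Var n) = Var (lift_var k m n)"
| "lift k m (Univ i) = Univ i"
| "lift k m (Pi A B) = Pi (lift k m A) (lift (Suc k) m B)"
| "lift k m (Lam A b) = Lam (lift k m A) (lift (Suc k) m b)"
| "lift k m (f \<cdot> a) = lift k m f \<cdot> lift k m a"
| "lift k m (Sg A B) = Sg (lift k m A) (lift (Suc k) m B)"
| "lift k m (Tup a b) = Tup (lift k m a) (lift k m b)"
| "lift k m (SgInd C c p) = SgInd (lift (Suc k) m C) (lift (Suc (Suc k)) m c) (lift k m p)"
| "lift k m (Plus A B) = Plus (lift k m A) (lift k m B)"
| "lift k m (Inj1 a) = Inj1 (lift k m a)"
| "lift k m (Inj2 a) = Inj2 (lift k m a)"
| "lift k m (PlusInd C c d e) =
    PlusInd (lift (Suc k) m C) (lift (Suc k) m c) (lift (Suc k) m d) (lift k m e)"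
| "lift k m Empty = Empty"
| "lift k m (EmptyInd C a) = EmptyInd (lift (Suc k) m C) (lift k m a)"
| "lift k m Unit = Unit"
| "lift k m Star = Star"
| "lift k m (UnitInd C c a) = UnitInd (lift (Suc k) m C) (lift k m c) (lift k m a)"
| "lift k m Nat = Nat"
| "lift k m Zero = Zero"
| "lift k m (Succ n) = Succ (lift k m n)"
| "lift k m (NatInd C c d n) =
    NatInd (lift (Suc k) m C) (lift k m c) (lift (Suc (Suc k)) m d) (lift k m n)"
| "lift k m (Eq A a b) = Eq (lift k m A) (lift k m a) (lift k m b)"
| "lift k m (Refl a) = Refl (lift k m a)"
| "lift k m (EqInd C c a b p) =
    EqInd (lift (Suc (Suc (Suc k))) m C) (lift (Suc k) m c) (lift k m a) (lift k m b) (lift k m p)"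

text \<open>\<open>j\<close> and \<open>i\<close> keep the binder depth and the original index while
  \<open>k\<close> and the last argument count down: a bound variable is returned as
  \<open>Var i\<close>, and an inserted term is lifted by \<open>j\<close>. The case distinction on
  \<open>j\<close> saves a useless traversal at depth 0.\<close>

fun subst_var :: "nat \<Rightarrow> nat \<Rightarrow> nat \<Rightarrow> tm list \<Rightarrow> nat \<Rightarrow> nat \<Rightarrow> tm" where
  "subst_var j i (Suc k) ts m 0 = Var i"
| "subst_var j i (Suc k) ts m (Suc n) = subst_var j i k ts m n"
| "subst_var j i 0 (t # ts) m 0 = (case j of 0 \<Rightarrow> t | Suc _ \<Rightarrow> lift 0 j t)"
| "subst_var j i 0 (t # ts) m (Suc n) = subst_var j i 0 ts m n"
| "subst_var j i 0 [] m n = Var (n + m + j)"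

primrec msubst :: "nat \<Rightarrow> tm list \<Rightarrow> nat \<Rightarrow> tm \<Rightarrow> tm" where
  "msubst k ts m (Var n) = subst_var k n k ts m n"
| "msubst k ts m (Univ i) = Univ i"
| "msubst k ts m (Pi A B) = Pi (msubst k ts m A) (msubst (Suc k) ts m B)"
| "msubst k ts m (Lam A b) = Lam (msubst k ts m A) (msubst (Suc k) ts m b)"
| "msubst k ts m (f \<cdot> a) = msubst k ts m f \<cdot> msubst k ts m a"
| "msubst k ts m (Sg A B) = Sg (msubst k ts m A) (msubst (Suc k) ts m B)"
| "msubst k ts m (Tup a b) = Tup (msubst k ts m a) (msubst k ts m b)"
| "msubst k ts m (SgInd C c p) = SgInd (msubst (Suc k) ts m C) (msubst (Suc (Suc k)) ts m c) (msubst k ts m p)"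
| "msubst k ts m (Plus A B) = Plus (msubst k ts m A) (msubst k ts m B)"
| "msubst k ts m (Inj1 a) = Inj1 (msubst k ts m a)"
| "msubst k ts m (Inj2 a) = Inj2 (msubst k ts m a)"
| "msubst k ts m (PlusInd C c d e) =
    PlusInd (msubst (Suc k) ts m C) (msubst (Suc k) ts m c) (msubst (Suc k) ts m d) (msubst k ts m e)"
| "msubst k ts m Empty = Empty"
| "msubst k ts m (EmptyInd C a) = EmptyInd (msubst (Suc k) ts m C) (msubst k ts m a)"
| "msubst k ts m Unit = Unit"
| "msubst k ts m Star = Star"
| "msubst k ts m (UnitInd C c a) = UnitInd (msubst (Suc k) ts m C) (msubst k ts m c) (msubst k ts m a)"
| "msubst k ts m Nat = Nat"
| "msubst k ts m Zero = Zero"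
| "msubst k ts m (Succ n) = Succ (msubst k ts m n)"
| "msubst k ts m (NatInd C c d n) =
    NatInd (msubst (Suc k) ts m C) (msubst k ts m c) (msubst (Suc (Suc k)) ts m d) (msubst k ts m n)"
| "msubst k ts m (Eq A a b) = Eq (msubst k ts m A) (msubst k ts m a) (msubst k ts m b)"
| "msubst k ts m (Refl a) = Refl (msubst k ts m a)"
| "msubst k ts m (EqInd C c a b p) =
    EqInd (msubst (Suc (Suc (Suc k))) ts m C) (msubst (Suc k) ts m c) (msubst k ts m a)
      (msubst k ts m b) (msubst k ts m p)"

type_synonym result = "(tm \<times> tm) option"
type_synonym normalizer = "tm list \<Rightarrow> tm \<Rightarrow> result"

text \<open>The type of a raw \<open>Tup\<close> cannot be inferred, so pairs are annotated by an identity function.\<close>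

definition ann_pair :: "tm \<Rightarrow> tm \<Rightarrow> tm \<Rightarrow> tm" where
  "ann_pair S a b = Lam S (Var 0) \<cdot> Tup a b"

fun lookup :: "tm list \<Rightarrow> nat \<Rightarrow> tm option" where
  "lookup [] n = None"
| "lookup (A # \<Gamma>) 0 = Some A"
| "lookup (A # \<Gamma>) (Suc n) = lookup \<Gamma> n"

text \<open>
  A result \<open>Some (u, T)\<close> for \<open>t\<close> means \<open>u \<doteq> t \<^bold>: T\<close>.  The functions are cut into stages at every
  recursive call: each stage receives the results of the calls as arguments, so that \<open>norm_eval\<close> below
  consists of first-order rewrite rules (non-linear where types are compared).
\<close>

fun dest_Univ :: "tm \<Rightarrow> nat option" where
  "dest_Univ (Univ i) = Some i"
| "dest_Univ _ = None"

fun dest_Pi :: "tm \<Rightarrow> (tm \<times> tm) option" where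
  "dest_Pi (Pi A B) = Some (A, B)"
| "dest_Pi _ = None"

fun dest_Lam :: "tm \<Rightarrow> (tm \<times> tm) option" where
  "dest_Lam (Lam A b) = Some (A, b)"
| "dest_Lam _ = None"

fun dest_Sg :: "tm \<Rightarrow> (tm \<times> tm) option" where
  "dest_Sg (Sg A B) = Some (A, B)"
| "dest_Sg _ = None"

fun dest_Tup :: "tm \<Rightarrow> (tm \<times> tm) option" where
  "dest_Tup (Tup a b) = Some (a, b)"
| "dest_Tup _ = None"

fun dest_App :: "tm \<Rightarrow> (tm \<times> tm) option" where
  "dest_App (f \<cdot> a) = Some (f, a)"
| "dest_App _ = None"

fun dest_Succ :: "tm \<Rightarrow> tm option" where
  "dest_Succ (Succ n) = Some n"
| "dest_Succ _ = None"

fun dest_Eq :: "tm \<Rightarrow> (tm \<times> tm \<times> tm) option" where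
  "dest_Eq (Eq A a b) = Some (A, a, b)"
| "dest_Eq _ = None"

fun dest_Refl :: "tm \<Rightarrow> tm option" where
  "dest_Refl (Refl a) = Some a"
| "dest_Refl _ = None"

definition dest_pair :: "tm \<Rightarrow> (tm \<times> tm \<times> tm) option" where
  "dest_pair p = do {(f, a) \<leftarrow> dest_App p; (x, y) \<leftarrow> dest_Tup a; (S, v) \<leftarrow> dest_Lam f;
     if v = Var 0 then Some (S, x, y) else None}"

lemma dest_eq_Some:
  "dest_Univ t = Some i \<longleftrightarrow> t = Univ i"
  "dest_Pi t = Some AB \<longleftrightarrow> t = Pi (fst AB) (snd AB)"
  "dest_Lam t = Some AB \<longleftrightarrow> t = Lam (fst AB) (snd AB)"
  "dest_Sg t = Some AB \<longleftrightarrow> t = Sg (fst AB) (snd AB)"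
  "dest_Tup t = Some AB \<longleftrightarrow> t = Tup (fst AB) (snd AB)"
  "dest_App t = Some AB \<longleftrightarrow> t = fst AB \<cdot> snd AB"
  "dest_Succ t = Some n \<longleftrightarrow> t = Succ n"
  "dest_Eq t = Some Aab \<longleftrightarrow> t = Eq (fst Aab) (fst (snd Aab)) (snd (snd Aab))"
  "dest_Refl t = Some n \<longleftrightarrow> t = Refl n"
  by (cases t; force)+

definition norm_var :: "nat \<Rightarrow> tm option \<Rightarrow> result" where
  "norm_var n x = do {A \<leftarrow> x; Some (Var n, lift 0 (Suc n) A)}"

definition norm_binder2 :: "(tm \<Rightarrow> tm \<Rightarrow> tm) \<Rightarrow> tm \<Rightarrow> nat \<Rightarrow> result \<Rightarrow> result" where
  "norm_binder2 F A i y = do {(B, U) \<leftarrow> y; j \<leftarrow> dest_Univ U; Some (F A B, Univ (max i j))}"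

definition norm_binder :: "(tm \<Rightarrow> tm \<Rightarrow> tm) \<Rightarrow> normalizer \<Rightarrow> tm list \<Rightarrow> result \<Rightarrow> tm \<Rightarrow> result" where
  "norm_binder F N \<Gamma> x B = do {(A, U) \<leftarrow> x; i \<leftarrow> dest_Univ U; norm_binder2 F A i (N (A # \<Gamma>) B)}"

definition norm_Lam2 :: "tm \<Rightarrow> result \<Rightarrow> result" where
  "norm_Lam2 A y = do {(b, B) \<leftarrow> y; Some (Lam A b, Pi A B)}"

definition norm_Lam :: "normalizer \<Rightarrow> tm list \<Rightarrow> result \<Rightarrow> tm \<Rightarrow> result" where
  "norm_Lam N \<Gamma> x b = do {(A, U) \<leftarrow> x; _ \<leftarrow> dest_Univ U; norm_Lam2 A (N (A # \<Gamma>) b)}"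

definition norm_pair2 :: "tm \<Rightarrow> tm \<Rightarrow> result \<Rightarrow> result \<Rightarrow> result" where
  "norm_pair2 S x y z = do {(b, Y) \<leftarrow> y; (Y', U) \<leftarrow> z; _ \<leftarrow> dest_Univ U;
     if Y' = Y then Some (ann_pair S x b, S) else None}"

definition norm_pair :: "normalizer \<Rightarrow> tm list \<Rightarrow> result \<Rightarrow> result \<Rightarrow> tm \<Rightarrow> result" where
  "norm_pair N \<Gamma> s x y = do {(S, U) \<leftarrow> s; (A, B) \<leftarrow> dest_Sg S; _ \<leftarrow> dest_Univ U; (a, A') \<leftarrow> x;
     if A' = A then norm_pair2 (Sg A B) a (N \<Gamma> y) (N \<Gamma> (msubst 0 [a] 0 B)) else None}"

definition norm_beta :: "tm \<Rightarrow> result \<Rightarrow> tm \<Rightarrow> result \<Rightarrow> result" where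
  "norm_beta B x T y = do {(b, B') \<leftarrow> x; (r, T') \<leftarrow> y; if B' = B \<and> T' = T then Some (r, T) else None}"

definition norm_App2 :: "normalizer \<Rightarrow> tm list \<Rightarrow> tm \<Rightarrow> tm \<Rightarrow> tm \<Rightarrow> tm \<Rightarrow> result \<Rightarrow> result" where
  "norm_App2 N \<Gamma> f A B a t = do {(T, U) \<leftarrow> t; _ \<leftarrow> dest_Univ U;
     case dest_Lam f of None \<Rightarrow> Some (f \<cdot> a, T)
     | Some (A', b) \<Rightarrow>
        if A' = A then norm_beta B (N (A # \<Gamma>) b) T (N \<Gamma> (msubst 0 [a] 0 b)) else None}"

definition norm_App :: "normalizer \<Rightarrow> tm list \<Rightarrow> result \<Rightarrow> result \<Rightarrow> result" where
  "norm_App N \<Gamma> x y = do {(f, F) \<leftarrow> x; (A, B) \<leftarrow> dest_Pi F; (a, A') \<leftarrow> y;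
     if A' = A then norm_App2 N \<Gamma> f A B a (N \<Gamma> (msubst 0 [a] 0 B)) else None}"

definition norm_SgInd4 :: "tm \<Rightarrow> result \<Rightarrow> result \<Rightarrow> result \<Rightarrow> tm \<Rightarrow> result \<Rightarrow> result" where
  "norm_SgInd4 A x y z T r = do {(_, A') \<leftarrow> x; (_, Y) \<leftarrow> y; (Y', U) \<leftarrow> z; _ \<leftarrow> dest_Univ U; (u, T') \<leftarrow> r;
     if A' = A \<and> Y' = Y \<and> T' = T then Some (u, T) else None}"

definition norm_SgInd3 :: "normalizer \<Rightarrow> tm list \<Rightarrow> tm \<Rightarrow> tm \<Rightarrow> tm \<Rightarrow> tm \<Rightarrow> tm \<Rightarrow> result \<Rightarrow> result" where
  "norm_SgInd3 N \<Gamma> A B C c p t = do {(T, U) \<leftarrow> t; _ \<leftarrow> dest_Univ U;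
     case dest_pair p of None \<Rightarrow> Some (SgInd C c p, T)
     | Some (S, x, y) \<Rightarrow> if S = Sg A B
        then norm_SgInd4 A (N \<Gamma> x) (N \<Gamma> y) (N \<Gamma> (msubst 0 [x] 0 B)) T (N \<Gamma> (msubst 0 [y, x] 0 c)) else None}"

definition norm_SgInd2 :: "normalizer \<Rightarrow> tm list \<Rightarrow> tm \<Rightarrow> tm \<Rightarrow> tm \<Rightarrow> tm \<Rightarrow> result \<Rightarrow> result \<Rightarrow> result" where
  "norm_SgInd2 N \<Gamma> A B C p x d = do {(c, D) \<leftarrow> x; (D', U) \<leftarrow> d; _ \<leftarrow> dest_Univ U;
     if D' = D then norm_SgInd3 N \<Gamma> A B C c p (N \<Gamma> (msubst 0 [p] 0 C)) else None}"

definition norm_SgInd1 :: "normalizer \<Rightarrow> tm list \<Rightarrow> tm \<Rightarrow> tm \<Rightarrow> tm \<Rightarrow> result \<Rightarrow> tm \<Rightarrow> result" where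
  "norm_SgInd1 N \<Gamma> A B p x c = do {(C, U) \<leftarrow> x; _ \<leftarrow> dest_Univ U;
     norm_SgInd2 N \<Gamma> A B C p (N (B # A # \<Gamma>) c)
       (N (B # A # \<Gamma>) (msubst 0 [ann_pair (lift 0 2 (Sg A B)) (Var 1) (Var 0)] 2 C))}"

definition norm_SgInd :: "normalizer \<Rightarrow> tm list \<Rightarrow> result \<Rightarrow> tm \<Rightarrow> tm \<Rightarrow> result" where
  "norm_SgInd N \<Gamma> x C c = do {(p, S) \<leftarrow> x; (A, B) \<leftarrow> dest_Sg S; norm_SgInd1 N \<Gamma> A B p (N (Sg A B # \<Gamma>) C) c}"

definition norm_Succ :: "result \<Rightarrow> result" where
  "norm_Succ x = do {(n, T) \<leftarrow> x; if T = Nat then Some (Succ n, Nat) else None}"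

definition norm_same :: "tm \<Rightarrow> result \<Rightarrow> result" where
  "norm_same T x = do {(u, T') \<leftarrow> x; if T' = T then Some (u, T) else None}"

definition norm_NatInd3 :: "normalizer \<Rightarrow> tm list \<Rightarrow> tm \<Rightarrow> tm \<Rightarrow> tm \<Rightarrow> tm \<Rightarrow> result \<Rightarrow> result" where
  "norm_NatInd3 N \<Gamma> C c d n t = do {(T, U) \<leftarrow> t; _ \<leftarrow> dest_Univ U;
     if n = Zero then Some (c, T)
     else case dest_Succ n of None \<Rightarrow> Some (NatInd C c d n, T)
     | Some m \<Rightarrow> norm_same T (N \<Gamma> (msubst 0 [NatInd C c d m, m] 0 d))}"

definition norm_NatInd2 :: "normalizer \<Rightarrow> tm list \<Rightarrow> tm \<Rightarrow> tm \<Rightarrow> result \<Rightarrow> result \<Rightarrow> result \<Rightarrow> result \<Rightarrow> result" where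
  "norm_NatInd2 N \<Gamma> C n z z' s s' = do {(c, Z) \<leftarrow> z; (Z', U) \<leftarrow> z'; _ \<leftarrow> dest_Univ U;
     (d, D) \<leftarrow> s; (D', U') \<leftarrow> s'; _ \<leftarrow> dest_Univ U';
     if Z' = Z \<and> D' = D then norm_NatInd3 N \<Gamma> C c d n (N \<Gamma> (msubst 0 [n] 0 C)) else None}"

definition norm_NatInd :: "normalizer \<Rightarrow> tm list \<Rightarrow> result \<Rightarrow> result \<Rightarrow> tm \<Rightarrow> tm \<Rightarrow> result" where
  "norm_NatInd N \<Gamma> x y c d = do {(n, T) \<leftarrow> x; (C, U) \<leftarrow> y; _ \<leftarrow> dest_Univ U;
     if T = Nat then norm_NatInd2 N \<Gamma> C n (N \<Gamma> c) (N \<Gamma> (msubst 0 [Zero] 0 C)) (N (C # Nat # \<Gamma>) d)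
       (N (C # Nat # \<Gamma>) (msubst 0 [Succ (Var 1)] 2 C)) else None}"

definition norm_Eq :: "result \<Rightarrow> result \<Rightarrow> result \<Rightarrow> result" where
  "norm_Eq x y z = do {(A, U) \<leftarrow> x; i \<leftarrow> dest_Univ U; (a, A1) \<leftarrow> y; (b, A2) \<leftarrow> z;
     if A1 = A \<and> A2 = A then Some (Eq A a b, Univ i) else None}"

definition norm_Refl :: "result \<Rightarrow> result" where
  "norm_Refl x = do {(a, A) \<leftarrow> x; Some (Refl a, Eq A a a)}"

definition norm_EqInd4 :: "normalizer \<Rightarrow> tm list \<Rightarrow> tm \<Rightarrow> tm \<Rightarrow> tm \<Rightarrow> tm \<Rightarrow> tm \<Rightarrow> result \<Rightarrow> result" where
  "norm_EqInd4 N \<Gamma> C c a b p t = do {(T, U) \<leftarrow> t; _ \<leftarrow> dest_Univ U;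
     case dest_Refl p of None \<Rightarrow> Some (EqInd C c a b p, T)
     | Some a' \<Rightarrow> if a' = a \<and> b = a then norm_same T (N \<Gamma> (msubst 0 [a] 0 c)) else None}"

definition norm_EqInd3 :: "normalizer \<Rightarrow> tm list \<Rightarrow> tm \<Rightarrow> tm \<Rightarrow> tm \<Rightarrow> tm \<Rightarrow> result \<Rightarrow> result \<Rightarrow> result" where
  "norm_EqInd3 N \<Gamma> C a b p x y = do {(c, D) \<leftarrow> x; (D', U) \<leftarrow> y; _ \<leftarrow> dest_Univ U;
     if D' = D then norm_EqInd4 N \<Gamma> C c a b p (N \<Gamma> (msubst 0 [p, b, a] 0 C)) else None}"

definition norm_EqInd2 :: "normalizer \<Rightarrow> tm list \<Rightarrow> tm \<Rightarrow> tm \<Rightarrow> tm \<Rightarrow> tm \<Rightarrow> result \<Rightarrow> tm \<Rightarrow> result" where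
  "norm_EqInd2 N \<Gamma> A a b p x c = do {(C, U) \<leftarrow> x; _ \<leftarrow> dest_Univ U;
     norm_EqInd3 N \<Gamma> C a b p (N (A # \<Gamma>) c)
       (N (A # \<Gamma>) (msubst 0 [Refl (Var 0), Var 0, Var 0] 1 C))}"

definition norm_EqInd :: "normalizer \<Rightarrow> tm list \<Rightarrow> result \<Rightarrow> result \<Rightarrow> result \<Rightarrow> tm \<Rightarrow> tm \<Rightarrow> result" where
  "norm_EqInd N \<Gamma> x y z C c = do {(p, E) \<leftarrow> x; (A, a, b) \<leftarrow> dest_Eq E; (a', A1) \<leftarrow> y; (b', A2) \<leftarrow> z;
     if A1 = A \<and> A2 = A \<and> a' = a \<and> b' = b
     then norm_EqInd2 N \<Gamma> A a b p (N (Eq (lift 0 2 A) (Var 1) (Var 0) # lift 0 1 A # A # \<Gamma>) C) c else None}"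

text \<open>A pair as argument is accepted only under an annotating identity function, and that
  application is deliberately not contracted: annotated pairs are the normal forms of pairs. The
  test \<open>dest_Tup\<close> is passed in as a result so that rewriting can dispatch on
  it.\<close>

definition norm_app :: "(tm \<times> tm) option \<Rightarrow> normalizer \<Rightarrow> tm list \<Rightarrow> tm \<Rightarrow> tm \<Rightarrow> result" where
  "norm_app d N \<Gamma> f a = (case d of None \<Rightarrow> norm_App N \<Gamma> (N \<Gamma> f) (N \<Gamma> a)
     | Some (x, y) \<Rightarrow> do {(S, v) \<leftarrow> dest_Lam f;
         if v = Var 0 then norm_pair N \<Gamma> (N \<Gamma> S) (N \<Gamma> x) y else None})"

text \<open>\<open>Nat\<close> belongs to every universe but only one type can be inferred. The
  parameter \<open>l\<close> fixes the level, which must agree literally with the universe over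
  which a lemma applied to \<open>Nat\<close> quantifies. Only the term formers that occur in the
  proof terms are accepted.\<close>

fun norm_step :: "nat \<Rightarrow> normalizer \<Rightarrow> normalizer" where
  "norm_step l N \<Gamma> (Var n) = norm_var n (lookup \<Gamma> n)"
| "norm_step l N \<Gamma> (Univ i) = Some (Univ i, Univ (Suc i))"
| "norm_step l N \<Gamma> (Pi A B) = norm_binder Pi N \<Gamma> (N \<Gamma> A) B"
| "norm_step l N \<Gamma> (Sg A B) = norm_binder Sg N \<Gamma> (N \<Gamma> A) B"
| "norm_step l N \<Gamma> (Lam A b) = norm_Lam N \<Gamma> (N \<Gamma> A) b"
| "norm_step l N \<Gamma> (f \<cdot> a) = norm_app (dest_Tup a) N \<Gamma> f a"
| "norm_step l N \<Gamma> (SgInd C c p) = norm_SgInd N \<Gamma> (N \<Gamma> p) C c"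
| "norm_step l N \<Gamma> Nat = Some (Nat, Univ l)"
| "norm_step l N \<Gamma> Zero = Some (Zero, Nat)"
| "norm_step l N \<Gamma> (Succ n) = norm_Succ (N \<Gamma> n)"
| "norm_step l N \<Gamma> (NatInd C c d n) = norm_NatInd N \<Gamma> (N \<Gamma> n) (N (Nat # \<Gamma>) C) c d"
| "norm_step l N \<Gamma> (Eq A a b) = norm_Eq (N \<Gamma> A) (N \<Gamma> a) (N \<Gamma> b)"
| "norm_step l N \<Gamma> (Refl a) = norm_Refl (N \<Gamma> a)"
| "norm_step l N \<Gamma> (EqInd C c a b p) = norm_EqInd N \<Gamma> (N \<Gamma> p) (N \<Gamma> a) (N \<Gamma> b) C c"
| "norm_step l N \<Gamma> _ = None"

text \<open>The second argument bounds the nesting depth of recursive calls and so makes the checker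
  total.\<close>

primrec norm :: "nat \<Rightarrow> nat \<Rightarrow> normalizer" where
  "norm l 0 = (\<lambda>_ _. None)"
| "norm l (Suc n) = norm_step l (norm l n)"

text \<open>Only successful checks have an equation: a repeated variable is a test for syntactic
  equality, and a failing test leaves the term stuck. Indices are written with \<open>Suc\<close>
  because numerals are unfolded during evaluation.\<close>

lemma norm_eval:
  "norm_var k' (Some A) = Some (Var k', lift 0 (Suc k') A)"
  "norm_binder F N \<Gamma> (Some (A, Univ i)) B' = norm_binder2 F A i (N (A # \<Gamma>) B')"
  "norm_binder2 F A i (Some (B, Univ j)) = Some (F A B, Univ (max i j))"
  "norm_Lam N \<Gamma> (Some (A, Univ i)) b' = norm_Lam2 A (N (A # \<Gamma>) b')"
  "norm_Lam2 A (Some (b, B)) = Some (Lam A b, Pi A B)"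
  "norm_pair2 S x (Some (y, Y)) (Some (Y, Univ j)) = Some (Lam S (Var 0) \<cdot> Tup x y, S)"
  "norm_pair N \<Gamma> (Some (Sg A B, Univ i)) (Some (x, A)) y' =
     norm_pair2 (Sg A B) x (N \<Gamma> y') (N \<Gamma> (msubst 0 [x] 0 B))"
  "norm_beta B (Some (b, B)) T (Some (r, T)) = Some (r, T)"
  "norm_App2 N \<Gamma> (Lam A b) A B a (Some (T, Univ j)) = norm_beta B (N (A # \<Gamma>) b) T (N \<Gamma> (msubst 0 [a] 0 b))"
  "norm_App2 N \<Gamma> (Var v) A B a (Some (T, Univ j)) = Some (Var v \<cdot> a, T)"
  "norm_App2 N \<Gamma> (f \<cdot> g) A B a (Some (T, Univ j)) = Some (f \<cdot> g \<cdot> a, T)"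
  "norm_App2 N \<Gamma> (SgInd C c p) A B a (Some (T, Univ j)) = Some (SgInd C c p \<cdot> a, T)"
  "norm_App2 N \<Gamma> (NatInd C c d n) A B a (Some (T, Univ j)) = Some (NatInd C c d n \<cdot> a, T)"
  "norm_App2 N \<Gamma> (EqInd C c d e p) A B a (Some (T, Univ j)) = Some (EqInd C c d e p \<cdot> a, T)"
  "norm_App N \<Gamma> (Some (f, Pi A B)) (Some (a, A)) = norm_App2 N \<Gamma> f A B a (N \<Gamma> (msubst 0 [a] 0 B))"
  "norm_SgInd4 A (Some (x, A)) (Some (y, Y)) (Some (Y, Univ j)) T (Some (u, T)) = Some (u, T)"
  "norm_SgInd3 N \<Gamma> A B C c (Lam (Sg A B) (Var 0) \<cdot> Tup x y) (Some (T, Univ j)) =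
     norm_SgInd4 A (N \<Gamma> x) (N \<Gamma> y) (N \<Gamma> (msubst 0 [x] 0 B)) T (N \<Gamma> (msubst 0 [y, x] 0 c))"
  "norm_SgInd3 N \<Gamma> A B C c (Var v) (Some (T, Univ j)) = Some (SgInd C c (Var v), T)"
  "norm_SgInd3 N \<Gamma> A B C c (f \<cdot> Var v) (Some (T, Univ j)) = Some (SgInd C c (f \<cdot> Var v), T)"
  "norm_SgInd2 N \<Gamma> A B C p (Some (c, D)) (Some (D, Univ j)) = norm_SgInd3 N \<Gamma> A B C c p (N \<Gamma> (msubst 0 [p] 0 C))"
  "norm_SgInd1 N \<Gamma> A B p (Some (C, Univ i)) c' =
     norm_SgInd2 N \<Gamma> A B C p (N (B # A # \<Gamma>) c')
       (N (B # A # \<Gamma>) (msubst 0 [Lam (lift 0 (Suc (Suc 0)) (Sg A B)) (Var 0) \<cdot> Tup (Var (Suc 0)) (Var 0)] (Suc (Suc 0)) C))"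
  "norm_SgInd N \<Gamma> (Some (p, Sg A B)) C' c' = norm_SgInd1 N \<Gamma> A B p (N (Sg A B # \<Gamma>) C') c'"
  "norm_Succ (Some (n, Nat)) = Some (Succ n, Nat)"
  "norm_same T (Some (u, T)) = Some (u, T)"
  "norm_NatInd3 N \<Gamma> C c d Zero (Some (T, Univ j)) = Some (c, T)"
  "norm_NatInd3 N \<Gamma> C c d (Succ m) (Some (T, Univ j)) = norm_same T (N \<Gamma> (msubst 0 [NatInd C c d m, m] 0 d))"
  "norm_NatInd3 N \<Gamma> C c d (Var v) (Some (T, Univ j)) = Some (NatInd C c d (Var v), T)"
  "norm_NatInd2 N \<Gamma> C n (Some (c, Z)) (Some (Z, Univ j)) (Some (d, D)) (Some (D, Univ k)) =
     norm_NatInd3 N \<Gamma> C c d n (N \<Gamma> (msubst 0 [n] 0 C))"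
  "norm_NatInd N \<Gamma> (Some (n, Nat)) (Some (C, Univ i)) c' d' =
     norm_NatInd2 N \<Gamma> C n (N \<Gamma> c') (N \<Gamma> (msubst 0 [Zero] 0 C)) (N (C # Nat # \<Gamma>) d')
       (N (C # Nat # \<Gamma>) (msubst 0 [Succ (Var (Suc 0))] (Suc (Suc 0)) C))"
  "norm_Eq (Some (A, Univ i)) (Some (a, A)) (Some (b, A)) = Some (Eq A a b, Univ i)"
  "norm_Refl (Some (a, A)) = Some (Refl a, Eq A a a)"
  "norm_EqInd4 N \<Gamma> C c a a (Refl a) (Some (T, Univ j)) = norm_same T (N \<Gamma> (msubst 0 [a] 0 c))"
  "norm_EqInd4 N \<Gamma> C c a b (Var v) (Some (T, Univ j)) = Some (EqInd C c a b (Var v), T)"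
  "norm_EqInd4 N \<Gamma> C c a b (f \<cdot> g) (Some (T, Univ j)) = Some (EqInd C c a b (f \<cdot> g), T)"
  "norm_EqInd4 N \<Gamma> C c a b (NatInd C' c' d' n) (Some (T, Univ j)) = Some (EqInd C c a b (NatInd C' c' d' n), T)"
  "norm_EqInd3 N \<Gamma> C a b p (Some (c, D)) (Some (D, Univ j)) = norm_EqInd4 N \<Gamma> C c a b p (N \<Gamma> (msubst 0 [p, b, a] 0 C))"
  "norm_EqInd2 N \<Gamma> A a b p (Some (C, Univ i)) c' =
     norm_EqInd3 N \<Gamma> C a b p (N (A # \<Gamma>) c') (N (A # \<Gamma>) (msubst 0 [Refl (Var 0), Var 0, Var 0] (Suc 0) C))"
  "norm_EqInd N \<Gamma> (Some (p, Eq A a b)) (Some (a, A)) (Some (b, A)) C' c' =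
     norm_EqInd2 N \<Gamma> A a b p
       (N (Eq (lift 0 (Suc (Suc 0)) A) (Var (Suc 0)) (Var 0) # lift 0 (Suc 0) A # A # \<Gamma>) C') c'"
  by (simp_all add: norm_var_def norm_binder_def norm_binder2_def norm_Lam_def norm_Lam2_def norm_pair_def
      norm_pair2_def norm_beta_def norm_App_def norm_App2_def norm_SgInd_def norm_SgInd1_def norm_SgInd2_def
      norm_SgInd3_def norm_SgInd4_def norm_Succ_def norm_same_def norm_NatInd_def norm_NatInd2_def
      norm_NatInd3_def norm_Eq_def norm_Refl_def norm_EqInd_def norm_EqInd2_def norm_EqInd3_def norm_EqInd4_def
      dest_pair_def ann_pair_def numeral_2_eq_2)

lemma norm_app_eval:
  "norm_app None N \<Gamma> f a = norm_App N \<Gamma> (N \<Gamma> f) (N \<Gamma> a)"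
  "norm_app (Some (x, y)) N \<Gamma> (Lam S (Var 0)) a = norm_pair N \<Gamma> (N \<Gamma> S) (N \<Gamma> x) y"
  by (simp_all add: norm_app_def)

lemma norm_Suc: "norm l (Suc n) \<Gamma> t = norm_step l (norm l n) \<Gamma> t"
  by simp

text \<open>Universe levels are successors of a variable \<open>i\<close>; together with
  \<open>max.idem\<close> and \<open>max_Suc_Suc\<close> the first two equations compute their
  maxima.\<close>

lemma nat_eval:
  "max i (Suc i) = Suc i"
  "max (Suc i) i = Suc i"
  "n + Suc m = Suc (n + m)"
  "n + 0 = (n :: nat)"
  "Suc m - Suc n = m - n"
  "m - 0 = (m :: nat)"
  by simp_all

lemma subst_var_eval:
  "subst_var j i (Suc k) ts m 0 = Var i"
  "subst_var j i (Suc k) ts m (Suc n) = subst_var j i k ts m n"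
  "subst_var 0 i 0 (t # ts) m 0 = t"
  "subst_var (Suc j) i 0 (t # ts) m 0 = lift 0 (Suc j) t"
  "subst_var j i 0 (t # ts) m (Suc n) = subst_var j i 0 ts m n"
  "subst_var j i 0 [] m n = Var (n + m + j)"
  by simp_all

lemmas norm_rules = norm_eval norm_Suc norm_step.simps(1-14) dest_Tup.simps norm_app_eval
  lift.simps msubst.simps lift_var.simps subst_var_eval lookup.simps(2,3)
  max.idem max_Suc_Suc nat_eval

section \<open>First-order lifting and substitution agree with \<open>subst\<close>\<close>

lemma lift_var_eq: "((up ^^ k) (wk m)) n = Var (lift_var k m n)"
  by (induction k m n rule: lift_var.induct) simp_all

lemma lift_eq_subst: "lift k m t = subst ((up ^^ k) (wk m)) t"
  by (induction t arbitrary: k) (simp_all add: lift_var_eq)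

lemma lift_eq_shift [simp]: "lift 0 m t = \<up> m t"
  by (simp add: lift_eq_subst shift_eq_subst)

text \<open>The offset \<open>d\<close> counts the binders already passed: in the recursion the
  first two arguments stay fixed while the third decreases.\<close>

lemma subst_var_eq: "subst_var (k + d) (n + d) k ts m n = \<up> d (((up ^^ k) (foldr (\<bullet>) ts (wk m))) n)"
proof (induction k arbitrary: d n)
  case 0
  have "subst_var d i 0 ts m n = \<up> d (foldr (\<bullet>) ts (wk m) n)" for i
  proof (induction ts arbitrary: n)
    case (Cons t ts)
    then show ?case by (cases n) (auto split: nat.split)
  qed simp
  then show ?case by (simp del: wk_app)
next
  case (Suc k)
  show ?case using Suc[of "Suc d"] by (cases n) simp_all
qed

lemma msubst_eq_subst: "msubst k ts m t = subst ((up ^^ k) (foldr (\<bullet>) ts (wk m))) t"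
  by (induction t arbitrary: k)
    (simp_all add: subst_var_eq[where d = 0, simplified])

declare lift.simps [simp del] msubst.simps [simp del]

section \<open>Soundness of the checker\<close>

definition sound :: "normalizer \<Rightarrow> bool" where
  "sound N \<longleftrightarrow> (\<forall>\<Gamma> t u T. N \<Gamma> t = Some (u, T) \<longrightarrow> (\<turnstile> \<Gamma> ctx) \<longrightarrow> (\<Gamma> \<turnstile> u \<doteq> t \<^bold>: T))"

lemma soundD: "\<lbrakk>sound N; N \<Gamma> t = Some (u, T); \<turnstile> \<Gamma> ctx\<rbrakk> \<Longrightarrow> \<Gamma> \<turnstile> u \<doteq> t \<^bold>: T"
  by (auto simp: sound_def)

lemma jdeq_left: "\<Gamma> \<turnstile> t \<doteq> u \<^bold>: A \<Longrightarrow> \<Gamma> \<turnstile> t \<^bold>: A"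
  and jdeq_right: "\<Gamma> \<turnstile> t \<doteq> u \<^bold>: A \<Longrightarrow> \<Gamma> \<turnstile> u \<^bold>: A"
  and jdeq_type: "\<Gamma> \<turnstile> t \<doteq> u \<^bold>: A \<Longrightarrow> is_type \<Gamma> A"
  using regularity(3) by blast+

lemma msubst_simps [simp]:
  "msubst 0 [a] 0 B = B\<lblot>a\<rblot>"
  "msubst 0 [b, a] 0 B = subst (b \<bullet> a \<bullet> Var) B"
  "msubst 0 [p, b, a] 0 B = subst (p \<bullet> b \<bullet> a \<bullet> Var) B"
  "msubst 0 [t] 2 B = subst (t \<bullet> wk 2) B"
  "msubst 0 [r, b, a] 1 B = subst (r \<bullet> b \<bullet> a \<bullet> wk 1) B"
  by (simp_all add: msubst_eq_subst inst_def)

lemma lookup_eq_Some: "lookup \<Gamma> n = Some A \<Longrightarrow> n < length \<Gamma> \<and> \<Gamma> ! n = A"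
  by (induction \<Gamma> n rule: lookup.induct) auto

lemma eq_conv_sym: "\<lbrakk>\<Gamma> \<turnstile> a \<doteq> b \<^bold>: A; \<Gamma> \<turnstile> T \<doteq> A \<^bold>: Univ j\<rbrakk> \<Longrightarrow> \<Gamma> \<turnstile> a \<doteq> b \<^bold>: T"
  by (meson eq_conv eq_sym)

lemma norm_binder_sound:
  assumes N: "sound N" and ctx: "\<turnstile> \<Gamma> ctx" and F: "F = Pi \<or> F = Sg"
    and r: "norm_binder F N \<Gamma> (N \<Gamma> A) B = Some (u, T)"
  shows "\<Gamma> \<turnstile> u \<doteq> F A B \<^bold>: T"
proof -
  obtain A' i B' j where A: "N \<Gamma> A = Some (A', Univ i)" and B: "N (A' # \<Gamma>) B = Some (B', Univ j)"
    and u: "u = F A' B'" "T = Univ (max i j)"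
    using r by (auto simp: norm_binder_def norm_binder2_def bind_eq_Some_conv dest_eq_Some)
  have A': "\<Gamma> \<turnstile> A' \<doteq> A \<^bold>: Univ i" by (rule soundD[OF N A ctx])
  have "A' # \<Gamma> \<turnstile> B' \<doteq> B \<^bold>: Univ j" by (rule soundD[OF N B ctx_ext[OF jdeq_left[OF A']]])
  then show ?thesis
    using A' F unfolding u by (auto intro!: pi_form_cong sg_form_cong intro: eq_cumul_le)
qed

lemma norm_Lam_sound:
  assumes N: "sound N" and ctx: "\<turnstile> \<Gamma> ctx" and r: "norm_Lam N \<Gamma> (N \<Gamma> A) b = Some (u, T)"
  shows "\<Gamma> \<turnstile> u \<doteq> Lam A b \<^bold>: T"
proof -
  obtain A' i b' B where A: "N \<Gamma> A = Some (A', Univ i)" and b: "N (A' # \<Gamma>) b = Some (b', B)"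
    and u: "u = Lam A' b'" "T = Pi A' B"
    using r by (auto simp: norm_Lam_def norm_Lam2_def bind_eq_Some_conv dest_eq_Some)
  have A': "\<Gamma> \<turnstile> A' \<doteq> A \<^bold>: Univ i" by (rule soundD[OF N A ctx])
  have "A' # \<Gamma> \<turnstile> b' \<doteq> b \<^bold>: B" by (rule soundD[OF N b ctx_ext[OF jdeq_left[OF A']]])
  with A' show ?thesis unfolding u by (rule pi_intro_cong)
qed

lemma ann_type: "\<Gamma> \<turnstile> S \<^bold>: Univ i \<Longrightarrow> S # \<Gamma> \<turnstile> Var 0 \<^bold>: \<up> 1 S"
  using var[OF ctx_ext, of \<Gamma> S i 0] by simp

lemma shift_inst [simp]: "(\<up> (Suc 0) t)\<lblot>a\<rblot> = t"
  by (simp add: inst_def subst_shift)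

lemma ann_pair_eq_Tup:
  assumes "\<Gamma> \<turnstile> Tup x y \<^bold>: S"
  shows "\<Gamma> \<turnstile> ann_pair S x y \<doteq> Tup x y \<^bold>: S"
proof -
  obtain i where "\<Gamma> \<turnstile> S \<^bold>: Univ i" using regularity(2)[OF assms] by (auto simp: is_type_def)
  from pi_beta[OF ann_type[OF this] assms] show ?thesis by (simp add: ann_pair_def) (simp add: inst_def)
qed

lemma ann_pair_cong:
  assumes "\<Gamma> \<turnstile> S \<doteq> S' \<^bold>: Univ i" "\<Gamma> \<turnstile> Tup x y \<doteq> Tup x' y' \<^bold>: S"
  shows "\<Gamma> \<turnstile> ann_pair S x y \<doteq> ann_pair S' x' y' \<^bold>: S"
  using pi_elim_cong[OF pi_intro_cong[OF assms(1) eq_refl[OF ann_type[OF jdeq_left[OF assms(1)]]]] assms(2)]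
  by (simp add: ann_pair_def)

lemma norm_pair_sound:
  assumes N: "sound N" and ctx: "\<turnstile> \<Gamma> ctx" and r: "norm_pair N \<Gamma> (N \<Gamma> S) (N \<Gamma> x) y = Some (u, T)"
  shows "\<Gamma> \<turnstile> u \<doteq> ann_pair S x y \<^bold>: T"
proof -
  obtain A B i x' y' Y j where S: "N \<Gamma> S = Some (Sg A B, Univ i)" and x: "N \<Gamma> x = Some (x', A)"
    and y: "N \<Gamma> y = Some (y', Y)" and Y: "N \<Gamma> B\<lblot>x'\<rblot> = Some (Y, Univ j)"
    and u: "u = ann_pair (Sg A B) x' y'" "T = Sg A B"
    using r by (auto simp: norm_pair_def norm_pair2_def simp: bind_eq_Some_conv dest_eq_Some split: option.splits if_splits)
  note S' = soundD[OF N S ctx] and x' = soundD[OF N x ctx] and y' = soundD[OF N y ctx] and Y' = soundD[OF N Y ctx]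
  obtain k where "A # \<Gamma> \<turnstile> B \<^bold>: Univ k" using Sg_inversion[OF jdeq_left[OF S']] by blast
  then have "\<Gamma> \<turnstile> Tup x' y' \<doteq> Tup x y \<^bold>: Sg A B" using x' eq_conv[OF y' Y'] by (rule sg_intro_cong)
  with S' show ?thesis unfolding u by (rule ann_pair_cong)
qed

lemma norm_App_sound:
  assumes N: "sound N" and ctx: "\<turnstile> \<Gamma> ctx" and r: "norm_App N \<Gamma> (N \<Gamma> f) (N \<Gamma> a) = Some (u, T)"
  shows "\<Gamma> \<turnstile> u \<doteq> f \<cdot> a \<^bold>: T"
proof -
  obtain f' A B a' where f: "N \<Gamma> f = Some (f', Pi A B)" and a: "N \<Gamma> a = Some (a', A)"
    and r1: "norm_App2 N \<Gamma> f' A B a' (N \<Gamma> B\<lblot>a'\<rblot>) = Some (u, T)"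
    using r by (auto simp: norm_App_def bind_eq_Some_conv dest_eq_Some split: if_splits)
  then obtain j T' where t: "N \<Gamma> B\<lblot>a'\<rblot> = Some (T', Univ j)"
    by (auto simp: norm_App2_def bind_eq_Some_conv dest_eq_Some)
  note r2 = r1[unfolded t]
  note f' = soundD[OF N f ctx] and a' = soundD[OF N a ctx] and t' = soundD[OF N t ctx]
  have app: "\<Gamma> \<turnstile> f' \<cdot> a' \<doteq> f \<cdot> a \<^bold>: T'" by (rule eq_conv_sym[OF pi_elim_cong[OF f' a'] t'])
  consider "u = f' \<cdot> a'" "T = T'" | b b' where "f' = Lam A b" "T = T'" "N (A # \<Gamma>) b = Some (b', B)"
      "N \<Gamma> b\<lblot>a'\<rblot> = Some (u, T')"
    using r2 by (auto simp: norm_App2_def norm_beta_def simp: bind_eq_Some_conv dest_eq_Some split: option.splits if_splits)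
  then show ?thesis
  proof cases
    case 1
    then show ?thesis using app by simp
  next
    case 2
    obtain i where "\<Gamma> \<turnstile> A \<^bold>: Univ i" using regularity(2)[OF jdeq_left[OF a']] by (auto simp: is_type_def)
    \<comment> \<open>The body is typed by the repeated check under the domain \<open>A\<close>;
      inverting the typing of the \<lambda>-term would give it only some type whose \<Pi>-type
      equals \<open>Pi A B\<close>.\<close>
    from soundD[OF N 2(3) ctx_ext[OF this]] have b: "A # \<Gamma> \<turnstile> b \<^bold>: B" by (rule jdeq_right)
    have "\<Gamma> \<turnstile> Lam A b \<cdot> a' \<doteq> b\<lblot>a'\<rblot> \<^bold>: T'" by (rule eq_conv_sym[OF pi_beta[OF b jdeq_left[OF a']] t'])
    with soundD[OF N 2(4) ctx] app show ?thesis unfolding 2(1,2) by (meson eq_sym eq_trans)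
  qed
qed

lemma norm_SgInd_sound:
  assumes N: "sound N" and ctx: "\<turnstile> \<Gamma> ctx" and r: "norm_SgInd N \<Gamma> (N \<Gamma> p) C c = Some (u, T)"
  shows "\<Gamma> \<turnstile> u \<doteq> SgInd C c p \<^bold>: T"
proof -
  obtain p' A B C' i c' D j where p: "N \<Gamma> p = Some (p', Sg A B)" and C: "N (Sg A B # \<Gamma>) C = Some (C', Univ i)"
    and c: "N (B # A # \<Gamma>) c = Some (c', D)"
    and D: "N (B # A # \<Gamma>) (subst (ann_pair (\<up> 2 (Sg A B)) (Var 1) (Var 0) \<bullet> wk 2) C') = Some (D, Univ j)"
    and r2: "norm_SgInd3 N \<Gamma> A B C' c' p' (N \<Gamma> C'\<lblot>p'\<rblot>) = Some (u, T)"
    using r by (auto simp: norm_SgInd_def norm_SgInd1_def norm_SgInd2_def bind_eq_Some_conv dest_eq_Some split: if_splits)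
  then obtain k T' where t: "N \<Gamma> C'\<lblot>p'\<rblot> = Some (T', Univ k)"
    by (auto simp: norm_SgInd3_def bind_eq_Some_conv dest_eq_Some)
  note r3 = r2[unfolded t]
  let ?tup = "Tup (Var 1) (Var 0)"
  note p' = soundD[OF N p ctx]
  have S: "is_type \<Gamma> (Sg A B)" by (rule jdeq_type[OF p'])
  then obtain l where A: "\<Gamma> \<turnstile> A \<^bold>: Univ l" and B: "A # \<Gamma> \<turnstile> B \<^bold>: Univ l"
    using Sg_inversion unfolding is_type_def by blast
  have ctxS: "\<turnstile> Sg A B # \<Gamma> ctx" using sg_form[OF A B] by (rule ctx_ext)
  have ctxB: "\<turnstile> B # A # \<Gamma> ctx" using B by (rule ctx_ext)
  note C' = soundD[OF N C ctxS] and c' = soundD[OF N c ctxB] and D' = soundD[OF N D ctxB] and t' = soundD[OF N t ctx]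
  have wk: "subst_ok (wk 2) \<Gamma> (B # A # \<Gamma>)" using B by (rule subst_ok_wk2)
  have tup: "B # A # \<Gamma> \<turnstile> ?tup \<^bold>: \<up> 2 (Sg A B)"
    using subst_ok_Tup[OF S, unfolded subst_ok_def, THEN conjunct2, rule_format, of 0]
    by (simp del: subst.simps add: subst_shift) (simp del: subst.simps add: shift_eq_subst wk_def[abs_def])
  have C2: "\<up> 2 (Sg A B) # B # A # \<Gamma> \<turnstile> subst (up (wk 2)) C' \<^bold>: Univ i"
    using kit_stableD1[OF kit_subst(2)[OF kit_subst_ok jdeq_left[OF C']] kit_subst_ok wk]
    by (simp only: subst.simps shift_eq_subst)
  have comp: "(subst (up (wk 2)) C')\<lblot>t\<rblot> = subst (t \<bullet> wk 2) C'" for t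
    by (simp only: inst_def subst_comp_simps subst_Var)
  \<comment> \<open>The rule wants the motive at the raw pair, whose type the checker cannot infer;
    it has normalized the motive at the annotated pair, which is \<beta>-equal.\<close>
  have "B # A # \<Gamma> \<turnstile> subst (ann_pair (\<up> 2 (Sg A B)) (Var 1) (Var 0) \<bullet> wk 2) C' \<doteq> subst (?tup \<bullet> wk 2) C' \<^bold>: Univ i"
    using inst_cong[OF C2 ann_pair_eq_Tup[OF tup] jdeq_left[OF ann_pair_eq_Tup[OF tup]] tup] unfolding comp .
  then have "B # A # \<Gamma> \<turnstile> c' \<doteq> c \<^bold>: subst (?tup \<bullet> wk 2) C'"
    using eq_conv[OF eq_conv[OF c' D']] by blast
  note ind = sg_elim_cong[OF C' this p'] and c'' = jdeq_left[OF this]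
  have ind: "\<Gamma> \<turnstile> SgInd C' c' p' \<doteq> SgInd C c p \<^bold>: T'" by (rule eq_conv_sym[OF ind t'])
  consider "u = SgInd C' c' p'" "T = T'" | x y x' y' Y j where "p' = ann_pair (Sg A B) x y" "T = T'"
      "N \<Gamma> x = Some (x', A)" "N \<Gamma> y = Some (y', Y)" "N \<Gamma> B\<lblot>x\<rblot> = Some (Y, Univ j)"
      "N \<Gamma> (subst (y \<bullet> x \<bullet> Var) c') = Some (u, T')"
    using r3 by (auto simp: norm_SgInd3_def norm_SgInd4_def ann_pair_def dest_pair_def simp: bind_eq_Some_conv dest_eq_Some split: option.splits if_splits)
  then show ?thesis
  proof cases
    case 1
    then show ?thesis using ind by simp
  next
    case 2
    \<comment> \<open>The components were checked again for the same reason as the body of a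
      \<lambda>-term: inverting the typing of the pair would require injectivity of
      \<Sigma>.\<close>
    have x: "\<Gamma> \<turnstile> x \<^bold>: A" by (rule jdeq_right[OF soundD[OF N 2(3) ctx]])
    have y: "\<Gamma> \<turnstile> y \<^bold>: B\<lblot>x\<rblot>"
      by (rule conv[OF jdeq_right[OF soundD[OF N 2(4) ctx]] soundD[OF N 2(5) ctx]])
    have tup: "\<Gamma> \<turnstile> Tup x y \<^bold>: Sg A B" by (rule sg_intro[OF B x y])
    have eq: "\<Gamma> \<turnstile> p' \<doteq> Tup x y \<^bold>: Sg A B" using ann_pair_eq_Tup[OF tup] 2(1) by simp
    have "\<Gamma> \<turnstile> SgInd C' c' p' \<doteq> SgInd C' c' (Tup x y) \<^bold>: T'"
      by (rule eq_conv_sym[OF sg_elim_cong[OF eq_refl eq_refl eq] t']) (fact jdeq_left[OF C'], fact c'')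
    moreover have "\<Gamma> \<turnstile> T' \<doteq> C'\<lblot>Tup x y\<rblot> \<^bold>: Univ (max i k)"
      using inst_cong[OF jdeq_left[OF C'] eq jdeq_left[OF eq] tup] t'
      by (meson eq_trans eq_cumul_le max.cobounded1 max.cobounded2)
    then have "\<Gamma> \<turnstile> SgInd C' c' (Tup x y) \<doteq> subst (y \<bullet> x \<bullet> Var) c' \<^bold>: T'"
      using eq_conv_sym[OF sg_beta[OF jdeq_left[OF C'] c'' x y]] by blast
    ultimately show ?thesis using soundD[OF N 2(6) ctx] ind unfolding 2(2) by (meson eq_sym eq_trans)
  qed
qed

lemma norm_NatInd_sound:
  assumes N: "sound N" and ctx: "\<turnstile> \<Gamma> ctx"
    and r: "norm_NatInd N \<Gamma> (N \<Gamma> n) (N (Nat # \<Gamma>) C) c d = Some (u, T)"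
  shows "\<Gamma> \<turnstile> u \<doteq> NatInd C c d n \<^bold>: T"
proof -
  obtain n' C' i c' Z j d' D k where n: "N \<Gamma> n = Some (n', Nat)" and C: "N (Nat # \<Gamma>) C = Some (C', Univ i)"
    and c: "N \<Gamma> c = Some (c', Z)" and Z: "N \<Gamma> C'\<lblot>Zero\<rblot> = Some (Z, Univ j)"
    and d: "N (C' # Nat # \<Gamma>) d = Some (d', D)"
    and D: "N (C' # Nat # \<Gamma>) (subst (Succ (Var 1) \<bullet> wk 2) C') = Some (D, Univ k)"
    and r2: "norm_NatInd3 N \<Gamma> C' c' d' n' (N \<Gamma> C'\<lblot>n'\<rblot>) = Some (u, T)"
    using r by (auto simp: norm_NatInd_def norm_NatInd2_def bind_eq_Some_conv dest_eq_Some split: if_splits)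
  then obtain l T' where t: "N \<Gamma> C'\<lblot>n'\<rblot> = Some (T', Univ l)"
    by (auto simp: norm_NatInd3_def bind_eq_Some_conv dest_eq_Some)
  note r3 = r2[unfolded t]
  have ctxN: "\<turnstile> Nat # \<Gamma> ctx" using nat_form[OF ctx] by (rule ctx_ext)
  note C' = soundD[OF N C ctxN] and n' = soundD[OF N n ctx] and t' = soundD[OF N t ctx]
  have ctxC: "\<turnstile> C' # Nat # \<Gamma> ctx" using jdeq_left[OF C'] by (rule ctx_ext)
  have c': "\<Gamma> \<turnstile> c' \<doteq> c \<^bold>: C'\<lblot>Zero\<rblot>" by (rule eq_conv[OF soundD[OF N c ctx] soundD[OF N Z ctx]])
  have d': "C' # Nat # \<Gamma> \<turnstile> d' \<doteq> d \<^bold>: subst (Succ (Var 1) \<bullet> wk 2) C'"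
    by (rule eq_conv[OF soundD[OF N d ctxC] soundD[OF N D ctxC]])
  note typed = jdeq_left[OF C'] jdeq_left[OF c'] jdeq_left[OF d']
  have ind: "\<Gamma> \<turnstile> NatInd C' c' d' n' \<doteq> NatInd C c d n \<^bold>: T'" by (rule eq_conv_sym[OF nat_elim_cong[OF C' c' d' n'] t'])
  consider "u = NatInd C' c' d' n'" "T = T'" | "n' = Zero" "u = c'" "T = T'"
    | m where "n' = Succ m" "T = T'" "N \<Gamma> (subst (NatInd C' c' d' m \<bullet> m \<bullet> Var) d') = Some (u, T')"
    using r3 by (auto simp: norm_NatInd3_def norm_same_def simp: bind_eq_Some_conv dest_eq_Some split: option.splits if_splits)
  then show ?thesis
  proof cases
    case 1
    then show ?thesis using ind by simp
  next
    case 2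
    have "\<Gamma> \<turnstile> NatInd C' c' d' n' \<doteq> c' \<^bold>: T'"
      using eq_conv_sym[OF nat_beta_zero[OF typed]] t' unfolding 2 by blast
    then show ?thesis using ind unfolding 2 by (meson eq_sym eq_trans)
  next
    case 3
    have "\<Gamma> \<turnstile> m \<^bold>: Nat" using jdeq_left[OF n'] Succ_inversion unfolding 3 by blast
    then have "\<Gamma> \<turnstile> NatInd C' c' d' n' \<doteq> subst (NatInd C' c' d' m \<bullet> m \<bullet> Var) d' \<^bold>: T'"
      using eq_conv_sym[OF nat_beta_succ[OF typed]] t' unfolding 3 by blast
    then show ?thesis using ind soundD[OF N 3(3) ctx] unfolding 3(2) by (meson eq_sym eq_trans)
  qed
qed

lemma norm_EqInd_sound:
  assumes N: "sound N" and ctx: "\<turnstile> \<Gamma> ctx"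
    and r: "norm_EqInd N \<Gamma> (N \<Gamma> p) (N \<Gamma> a) (N \<Gamma> b) C c = Some (u, T)"
  shows "\<Gamma> \<turnstile> u \<doteq> EqInd C c a b p \<^bold>: T"
proof -
  let ?E = "\<lambda>A. Eq (\<up> 2 A) (Var 1) (Var 0) # \<up> 1 A # A # \<Gamma>"
  obtain p' A a' b' C' i c' D j where p: "N \<Gamma> p = Some (p', Eq A a' b')"
    and a: "N \<Gamma> a = Some (a', A)" and b: "N \<Gamma> b = Some (b', A)"
    and C: "N (?E A) C = Some (C', Univ i)" and c: "N (A # \<Gamma>) c = Some (c', D)"
    and D: "N (A # \<Gamma>) (subst (Refl (Var 0) \<bullet> Var 0 \<bullet> Var 0 \<bullet> wk 1) C') = Some (D, Univ j)"
    and r3: "norm_EqInd4 N \<Gamma> C' c' a' b' p' (N \<Gamma> (subst (p' \<bullet> b' \<bullet> a' \<bullet> Var) C')) = Some (u, T)"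
    using r by (auto simp: norm_EqInd_def norm_EqInd2_def norm_EqInd3_def msubst_simps(5)[simplified]
        bind_eq_Some_conv dest_eq_Some split: if_splits)
  then obtain k T' where t: "N \<Gamma> (subst (p' \<bullet> b' \<bullet> a' \<bullet> Var) C') = Some (T', Univ k)"
    by (auto simp: norm_EqInd4_def bind_eq_Some_conv dest_eq_Some)
  note r4 = r3[unfolded t]
  note p' = soundD[OF N p ctx] and a' = soundD[OF N a ctx] and b' = soundD[OF N b ctx] and t' = soundD[OF N t ctx]
  obtain l where A: "\<Gamma> \<turnstile> A \<^bold>: Univ l" using jdeq_type[OF a'] by (auto simp: is_type_def)
  have ctxA: "\<turnstile> A # \<Gamma> ctx" using A by (rule ctx_ext)
  have A1: "A # \<Gamma> \<turnstile> \<up> 1 A \<^bold>: Univ l" using weakening[OF A A] by (simp add: shift_def)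
  have ctxA1: "\<turnstile> \<up> 1 A # A # \<Gamma> ctx" using A1 by (rule ctx_ext)
  have A2: "\<up> 1 A # A # \<Gamma> \<turnstile> \<up> 2 A \<^bold>: Univ l" using weakening[OF A1 A1] by (simp add: shift_def ren_ren numeral_2_eq_2)
  have ctxE: "\<turnstile> ?E A ctx"
    using var[OF ctxA1, of 0] var[OF ctxA1, of 1] by (intro ctx_ext[OF id_form[OF A2]]) (simp_all add: numeral_2_eq_2)
  note C' = soundD[OF N C ctxE]
  have c': "A # \<Gamma> \<turnstile> c' \<doteq> c \<^bold>: subst (Refl (Var 0) \<bullet> Var 0 \<bullet> Var 0 \<bullet> wk 1) C'"
    by (rule eq_conv[OF soundD[OF N c ctxA] soundD[OF N D ctxA]])
  have ind: "\<Gamma> \<turnstile> EqInd C' c' a' b' p' \<doteq> EqInd C c a b p \<^bold>: T'"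
    by (rule eq_conv_sym[OF id_elim_cong[OF C' c' a' b' p'] t'])
  consider "u = EqInd C' c' a' b' p'" "T = T'" | "b' = a'" "p' = Refl a'" "T = T'" "N \<Gamma> c'\<lblot>a'\<rblot> = Some (u, T')"
    using r4 by (auto simp: norm_EqInd4_def norm_same_def simp: bind_eq_Some_conv dest_eq_Some split: option.splits if_splits)
  then show ?thesis
  proof cases
    case 1
    then show ?thesis using ind by simp
  next
    case 2
    have "\<Gamma> \<turnstile> EqInd C' c' a' b' p' \<doteq> c'\<lblot>a'\<rblot> \<^bold>: T'"
      using eq_conv_sym[OF id_beta[OF jdeq_left[OF C'] jdeq_left[OF c'] jdeq_left[OF a']]] t' unfolding 2 by blast
    then show ?thesis using ind soundD[OF N 2(4) ctx] unfolding 2(3) by (meson eq_sym eq_trans)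
  qed
qed

lemma norm_step_sound:
  assumes N: "sound N"
  shows "sound (norm_step l N)"
  unfolding sound_def
proof (intro allI impI)
  fix \<Gamma> t u T assume r: "norm_step l N \<Gamma> t = Some (u, T)" and ctx: "\<turnstile> \<Gamma> ctx"
  show "\<Gamma> \<turnstile> u \<doteq> t \<^bold>: T"
  proof (cases t)
    case (Var n)
    then show ?thesis using r ctx
      by (auto simp: norm_var_def bind_eq_Some_conv intro!: eq_refl dest!: lookup_eq_Some intro: var)
  next
    case (Univ i)
    then show ?thesis using r ctx by (auto intro: eq_refl univ)
  next
    case (Pi A B)
    then show ?thesis using r norm_binder_sound[OF N ctx, of Pi] by simp
  next
    case (Lam A b)
    then show ?thesis using r norm_Lam_sound[OF N ctx] by simp
  next
    case (App f a)
    then show ?thesis using r norm_App_sound[OF N ctx, of f a] norm_pair_sound[OF N ctx]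
      by (auto simp: norm_app_def ann_pair_def bind_eq_Some_conv dest_eq_Some split: option.splits if_splits)
  next
    case (Sg A B)
    then show ?thesis using r norm_binder_sound[OF N ctx, of Sg] by simp
  next
    case (SgInd C c p)
    then show ?thesis using r norm_SgInd_sound[OF N ctx] by simp
  next
    case Nat
    then show ?thesis using r ctx by (auto intro: eq_refl nat_form)
  next
    case Zero
    then show ?thesis using r ctx by (auto intro: eq_refl nat_zero)
  next
    case (Succ n)
    then show ?thesis using r ctx soundD[OF N]
      by (auto simp: norm_Succ_def bind_eq_Some_conv intro: nat_succ_cong split: if_splits)
  next
    case (NatInd C c d n)
    then show ?thesis using r norm_NatInd_sound[OF N ctx] by simp
  next
    case (Eq A a b)
    then show ?thesis using r ctx
      by (auto simp: norm_Eq_def bind_eq_Some_conv dest_eq_Some intro!: id_form_cong dest: soundD[OF N] split: if_splits)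
  next
    case (Refl a)
    then obtain a' A where a: "N \<Gamma> a = Some (a', A)" and u: "u = Refl a'" "T = Eq A a' a'"
      using r by (auto simp: norm_Refl_def bind_eq_Some_conv)
    obtain i where "\<Gamma> \<turnstile> A \<^bold>: Univ i" using jdeq_type[OF soundD[OF N a ctx]] by (auto simp: is_type_def)
    from id_intro_cong[OF this soundD[OF N a ctx]] show ?thesis unfolding u Refl .
  next
    case (EqInd C c a b p)
    then show ?thesis using r norm_EqInd_sound[OF N ctx] by simp
  qed (use r in simp_all)
qed

lemma norm_sound: "sound (norm l n)"
proof (induction n)
  case 0
  then show ?case by (simp add: sound_def)
next
  case (Suc n)
  then show ?case by (simp add: norm_step_sound)
qed

theorem typing_by_norm:
  assumes "\<turnstile> \<Gamma> ctx" "norm l n \<Gamma> t = Some (u, T)" "norm l n \<Gamma> A = Some (T, Univ i)"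
  shows "\<Gamma> \<turnstile> t \<^bold>: A"
  using soundD[OF norm_sound assms(2,1)] soundD[OF norm_sound assms(3,1)] jdeq_right conv by blast

section \<open>The splitting\<close>

text \<open>
  Higher-order syntax for the proof terms: an open term maps the length of the context to a de Bruijn
  term, and a bound variable is given by its level, the length of the context in front of it.
\<close>

type_synonym open_tm = "nat \<Rightarrow> tm"

definition bvar :: "nat \<Rightarrow> open_tm" where
  "bvar l d = Var (d - Suc l)"

definition hUniv :: "nat \<Rightarrow> open_tm" where
  "hUniv i d = Univ i"

definition hPi :: "open_tm \<Rightarrow> (open_tm \<Rightarrow> open_tm) \<Rightarrow> open_tm" where
  "hPi A B d = Pi (A d) (B (bvar d) (Suc d))"

text \<open>Evaluating an open term at a larger context length renumbers its variables, so weakening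
  of \<open>B\<close> is implicit here and everywhere below.\<close>

definition hArr :: "open_tm \<Rightarrow> open_tm \<Rightarrow> open_tm"  (infixr \<open>\<rightarrow>\<^sub>h\<close> 60) where
  "(A \<rightarrow>\<^sub>h B) d = Pi (A d) (B (Suc d))"

definition hLam :: "open_tm \<Rightarrow> (open_tm \<Rightarrow> open_tm) \<Rightarrow> open_tm" where
  "hLam A b d = Lam (A d) (b (bvar d) (Suc d))"

definition hApp :: "open_tm \<Rightarrow> open_tm \<Rightarrow> open_tm"  (infixl \<open>\<diamondop>\<close> 75) where
  "(f \<diamondop> a) d = f d \<cdot> a d"

definition hSg :: "open_tm \<Rightarrow> (open_tm \<Rightarrow> open_tm) \<Rightarrow> open_tm" where
  "hSg A B d = Sg (A d) (B (bvar d) (Suc d))"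

definition hPair :: "open_tm \<Rightarrow> open_tm \<Rightarrow> open_tm \<Rightarrow> open_tm" where
  "hPair S a b d = ann_pair (S d) (a d) (b d)"

definition hSgInd :: "(open_tm \<Rightarrow> open_tm) \<Rightarrow> (open_tm \<Rightarrow> open_tm \<Rightarrow> open_tm) \<Rightarrow> open_tm \<Rightarrow> open_tm" where
  "hSgInd C c p d = SgInd (C (bvar d) (Suc d)) (c (bvar d) (bvar (Suc d)) (Suc (Suc d))) (p d)"

definition hNat :: open_tm where
  "hNat d = Nat"

definition hZero :: open_tm where
  "hZero d = Zero"

definition hSucc :: "open_tm \<Rightarrow> open_tm" where
  "hSucc n d = Succ (n d)"

definition hNatInd ::
    "(open_tm \<Rightarrow> open_tm) \<Rightarrow> open_tm \<Rightarrow> (open_tm \<Rightarrow> open_tm \<Rightarrow> open_tm) \<Rightarrow> open_tm \<Rightarrow> open_tm" where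
  "hNatInd C z s n d =
    NatInd (C (bvar d) (Suc d)) (z d) (s (bvar d) (bvar (Suc d)) (Suc (Suc d))) (n d)"

definition hEq :: "open_tm \<Rightarrow> open_tm \<Rightarrow> open_tm \<Rightarrow> open_tm" where
  "hEq A a b d = Eq (A d) (a d) (b d)"

definition hRefl :: "open_tm \<Rightarrow> open_tm" where
  "hRefl a d = Refl (a d)"

definition hEqInd :: "(open_tm \<Rightarrow> open_tm \<Rightarrow> open_tm \<Rightarrow> open_tm) \<Rightarrow> (open_tm \<Rightarrow> open_tm) \<Rightarrow>
    open_tm \<Rightarrow> open_tm \<Rightarrow> open_tm \<Rightarrow> open_tm" where
  "hEqInd C c a b p d =
    EqInd (C (bvar d) (bvar (Suc d)) (bvar (Suc (Suc d))) (Suc (Suc (Suc d)))) (c (bvar d) (Suc d)) (a d) (b d) (p d)"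

lemmas hoas_defs = bvar_def hUniv_def hPi_def hArr_def hLam_def hApp_def hSg_def hPair_def ann_pair_def hSgInd_def
  hNat_def hZero_def hSucc_def hNatInd_def hEq_def hRefl_def hEqInd_def

text \<open>The variables of \<open>base_ctx\<close>, which consists of the hypotheses of the theorem.\<close>

abbreviation "hfunext \<equiv> bvar 0"
abbreviation "hX \<equiv> bvar 1"
abbreviation "hf x \<equiv> bvar 2 \<diamondop> x"
abbreviation "hI x \<equiv> bvar 3 \<diamondop> x"
abbreviation "hJ x \<equiv> bvar 4 \<diamondop> x"
abbreviation "path \<equiv> hEq hX"

text \<open>This copies \<open>ap\<close> for the variable f; the two have to unfold to the same
  term when the hypothesis J is substituted into the context.\<close>

definition ap_F :: "open_tm \<Rightarrow> open_tm \<Rightarrow> open_tm \<Rightarrow> open_tm" where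
  "ap_F x y p = hEqInd (\<lambda>x y p. path (hf x) (hf y)) (\<lambda>x. hRefl (hf x)) x y p"

text \<open>Each type is evaluated at the number of entries that follow it in the list, the length
  of its own context.\<close>

definition base_ctx :: "nat \<Rightarrow> tm list" where
  "base_ctx i =
    [hPi hX (\<lambda>x. hEq (path (hf (hf (hf x))) (hf (hf x))) (ap_F (hf (hf x)) (hf x) (hI x)) (hI (hf x))) 4,
     hPi hX (\<lambda>x. path (hf (hf x)) (hf x)) 3,
     (hX \<rightarrow>\<^sub>h hX) 2,
     Univ i,
     FunExt i]"

text \<open>
  In what follows the variables from level 5 on stand for lemmas that are discharged by \<open>cut\<close> or
  \<open>cut3\<close>: their proof terms are opaque to the checker.  Induction on paths with one endpoint fixed comes from the
  rule for two free endpoints by quantifying over the motive, which is why the motive of the latter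
  lives one universe higher.  In \<open>based_J\<close> the source is fixed, in \<open>based_J'\<close> the target.
\<close>

definition based_J :: "nat \<Rightarrow> open_tm" where
  "based_J i = hPi (hUniv i) (\<lambda>T. hPi T (\<lambda>x. hPi (hPi T (\<lambda>y. hEq T x y \<rightarrow>\<^sub>h hUniv i)) (\<lambda>C.
     hPi (C \<diamondop> x \<diamondop> hRefl x) (\<lambda>c. hPi T (\<lambda>y. hPi (hEq T x y) (\<lambda>p. C \<diamondop> y \<diamondop> p))))))"

definition based_J_tm :: "nat \<Rightarrow> open_tm" where
  "based_J_tm i = hLam (hUniv i) (\<lambda>T. hLam T (\<lambda>x. hLam (hPi T (\<lambda>y. hEq T x y \<rightarrow>\<^sub>h hUniv i)) (\<lambda>C.
     hLam (C \<diamondop> x \<diamondop> hRefl x) (\<lambda>c. hLam T (\<lambda>y. hLam (hEq T x y) (\<lambda>p.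
       hEqInd (\<lambda>x y p. hPi (hPi T (\<lambda>y. hEq T x y \<rightarrow>\<^sub>h hUniv i)) (\<lambda>C. C \<diamondop> x \<diamondop> hRefl x \<rightarrow>\<^sub>h C \<diamondop> y \<diamondop> p))
         (\<lambda>x. hLam (hPi T (\<lambda>y. hEq T x y \<rightarrow>\<^sub>h hUniv i)) (\<lambda>C. hLam (C \<diamondop> x \<diamondop> hRefl x) (\<lambda>c. c)))
         x y p \<diamondop> C \<diamondop> c))))))"

definition based_J' :: "nat \<Rightarrow> open_tm" where
  "based_J' i = hPi (hUniv i) (\<lambda>T. hPi T (\<lambda>y. hPi (hPi T (\<lambda>x. hEq T x y \<rightarrow>\<^sub>h hUniv i)) (\<lambda>C.
     hPi (C \<diamondop> y \<diamondop> hRefl y) (\<lambda>c. hPi T (\<lambda>x. hPi (hEq T x y) (\<lambda>p. C \<diamondop> x \<diamondop> p))))))"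

definition based_J'_tm :: "nat \<Rightarrow> open_tm" where
  "based_J'_tm i = hLam (hUniv i) (\<lambda>T. hLam T (\<lambda>y. hLam (hPi T (\<lambda>x. hEq T x y \<rightarrow>\<^sub>h hUniv i)) (\<lambda>C.
     hLam (C \<diamondop> y \<diamondop> hRefl y) (\<lambda>c. hLam T (\<lambda>x. hLam (hEq T x y) (\<lambda>p.
       hEqInd (\<lambda>x y p. hPi (hPi T (\<lambda>x. hEq T x y \<rightarrow>\<^sub>h hUniv i)) (\<lambda>C. C \<diamondop> y \<diamondop> hRefl y \<rightarrow>\<^sub>h C \<diamondop> x \<diamondop> p))
         (\<lambda>y. hLam (hPi T (\<lambda>x. hEq T x y \<rightarrow>\<^sub>h hUniv i)) (\<lambda>C. hLam (C \<diamondop> y \<diamondop> hRefl y) (\<lambda>c. c)))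
         x y p \<diamondop> C \<diamondop> c))))))"

definition by_J :: "open_tm \<Rightarrow> open_tm \<Rightarrow> open_tm \<Rightarrow> (open_tm \<Rightarrow> open_tm \<Rightarrow> open_tm) \<Rightarrow>
    open_tm \<Rightarrow> open_tm \<Rightarrow> open_tm \<Rightarrow> open_tm" where
  "by_J L T x C c y p = L \<diamondop> T \<diamondop> x \<diamondop> hLam T (\<lambda>y. hLam (hEq T x y) (\<lambda>p. C y p)) \<diamondop> c \<diamondop> y \<diamondop> p"

definition by_J' :: "open_tm \<Rightarrow> open_tm \<Rightarrow> open_tm \<Rightarrow> (open_tm \<Rightarrow> open_tm \<Rightarrow> open_tm) \<Rightarrow>
    open_tm \<Rightarrow> open_tm \<Rightarrow> open_tm \<Rightarrow> open_tm" where
  "by_J' L T y C c x p = L \<diamondop> T \<diamondop> y \<diamondop> hLam T (\<lambda>x. hLam (hEq T x y) (\<lambda>p. C x p)) \<diamondop> c \<diamondop> x \<diamondop> p"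

definition hPi_fam :: "open_tm \<Rightarrow> open_tm \<Rightarrow> open_tm" where
  "hPi_fam T B = hPi T (\<lambda>x. B \<diamondop> x)"

definition hhtpy :: "open_tm \<Rightarrow> open_tm \<Rightarrow> open_tm \<Rightarrow> open_tm \<Rightarrow> open_tm" where
  "hhtpy T B g h = hPi T (\<lambda>x. hEq (B \<diamondop> x) (g \<diamondop> x) (h \<diamondop> x))"

text \<open>The same motive and branch as in \<open>happly\<close>, so that its normal form matches
  the one inside \<open>FunExt\<close>.\<close>

definition hhapply :: "open_tm \<Rightarrow> open_tm \<Rightarrow> open_tm \<Rightarrow> open_tm \<Rightarrow> open_tm" where
  "hhapply T B g h = hLam (hEq (hPi_fam T B) g h) (\<lambda>p. hEqInd (\<lambda>h k p. hhtpy T B h k)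
     (\<lambda>h. hLam T (\<lambda>x. hRefl (h \<diamondop> x))) g h p)"

text \<open>Homotopies \<open>\<Pi>x. g x = h x\<close> satisfy the induction principle of paths, by function extensionality.\<close>

definition htpy_ind :: "nat \<Rightarrow> open_tm" where
  "htpy_ind i = hPi (hUniv i) (\<lambda>T. hPi (T \<rightarrow>\<^sub>h hUniv i) (\<lambda>B. hPi (hPi_fam T B) (\<lambda>g.
     hPi (hPi (hPi_fam T B) (\<lambda>h. hhtpy T B g h \<rightarrow>\<^sub>h hUniv i)) (\<lambda>C.
     hPi (C \<diamondop> g \<diamondop> hLam T (\<lambda>x. hRefl (g \<diamondop> x))) (\<lambda>c.
     hPi (hPi_fam T B) (\<lambda>h. hPi (hhtpy T B g h) (\<lambda>b. C \<diamondop> h \<diamondop> b)))))))"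

text \<open>With \<open>bvar 5\<close> for \<open>based_J\<close>: k is the right inverse of
  \<open>happly\<close> and e b shows that \<open>happly\<close> sends k b to b. Path induction on k
  b proves C at the homotopy induced by k b, since \<open>happly\<close> of refl reduces to the
  constant refl homotopy; transport along e b then gives C at b.\<close>

definition htpy_ind_tm :: "nat \<Rightarrow> open_tm" where
  "htpy_ind_tm i = hLam (hUniv i) (\<lambda>T. hLam (T \<rightarrow>\<^sub>h hUniv i) (\<lambda>B. hLam (hPi_fam T B) (\<lambda>g.
     hLam (hPi (hPi_fam T B) (\<lambda>h. hhtpy T B g h \<rightarrow>\<^sub>h hUniv i)) (\<lambda>C.
     hLam (C \<diamondop> g \<diamondop> hLam T (\<lambda>x. hRefl (g \<diamondop> x))) (\<lambda>c.
     hLam (hPi_fam T B) (\<lambda>h. hLam (hhtpy T B g h) (\<lambda>b.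
       hSgInd (\<lambda>_. C \<diamondop> h \<diamondop> b) (\<lambda>e _. hSgInd (\<lambda>_. C \<diamondop> h \<diamondop> b) (\<lambda>k e.
         by_J (bvar 5) (hhtpy T B g h) (hhapply T B g h \<diamondop> (k \<diamondop> b)) (\<lambda>b _. C \<diamondop> h \<diamondop> b)
           (by_J (bvar 5) (hPi_fam T B) g (\<lambda>h p. C \<diamondop> h \<diamondop> (hhapply T B g h \<diamondop> p)) c h (k \<diamondop> b))
           b (e \<diamondop> b)) e) (hfunext \<diamondop> T \<diamondop> B \<diamondop> g \<diamondop> h))))))))"

section \<open>Transport in identity types and the coherence conditions\<close>

definition tr_target :: "open_tm \<Rightarrow> open_tm \<Rightarrow> open_tm \<Rightarrow> open_tm \<Rightarrow> open_tm \<Rightarrow> open_tm" where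
  "tr_target t w w' q v =
    hEqInd (\<lambda>w w' q. path t w \<rightarrow>\<^sub>h path t w') (\<lambda>w. hLam (path t w) (\<lambda>v. v)) w w' q \<diamondop> v"

text \<open>In groupoid terms \<open>tr_target\<close> is v followed by q, and
  \<open>tr_source\<close> is the inverse of ap_f p followed by v. Both reduce judgementally to v on
  a refl path.\<close>

definition tr_source :: "open_tm \<Rightarrow> open_tm \<Rightarrow> open_tm \<Rightarrow> open_tm \<Rightarrow> open_tm \<Rightarrow> open_tm" where
  "tr_source u u' w p v =
    hEqInd (\<lambda>u u' p. path (hf u) w \<rightarrow>\<^sub>h path (hf u') w) (\<lambda>u. hLam (path (hf u) w) (\<lambda>v. v)) u u' p \<diamondop> v"

text \<open>For \<open>p : u = u'\<close> and \<open>q : w = w'\<close> the transport from \<open>f u = w\<close> to \<open>f u' = w'\<close>.\<close>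

definition tr_square ::
    "open_tm \<Rightarrow> open_tm \<Rightarrow> open_tm \<Rightarrow> open_tm \<Rightarrow> open_tm \<Rightarrow> open_tm \<Rightarrow> open_tm \<Rightarrow> open_tm" where
  "tr_square u u' w w' p q v = tr_target (hf u') w w' q (tr_source u u' w p v)"

text \<open>For \<open>\<alpha> : f y = x\<close> and \<open>\<gamma> : u = f x\<close> the path \<open>u = f x = f (f y) = f y\<close>, whose last part is \<open>I y\<close>.\<close>

definition step_path :: "open_tm \<Rightarrow> open_tm \<Rightarrow> open_tm \<Rightarrow> open_tm \<Rightarrow> open_tm \<Rightarrow> open_tm" where
  "step_path u x y \<alpha> \<gamma> = tr_target u (hf (hf y)) (hf y) (hI y)
     (hEqInd (\<lambda>t x \<alpha>. path u (hf x) \<rightarrow>\<^sub>h path u (hf t)) (\<lambda>t. hLam (path u (hf t)) (\<lambda>\<gamma>. \<gamma>)) (hf y) x \<alpha> \<diamondop> \<gamma>)"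

text \<open>This is the groupoid law that q equals the inverse of ap_f p, followed by ap_f p,
  followed by q. The extra compositions with refl reproduce the shape that \<open>step_path\<close>
  leaves behind when \<alpha> and \<gamma> are refl.\<close>

definition tr_ap_goal :: "open_tm \<Rightarrow> open_tm \<Rightarrow> open_tm \<Rightarrow> open_tm \<Rightarrow> open_tm \<Rightarrow> open_tm" where
  "tr_ap_goal u u' p w q = hEq (path (hf u') w) q
     (tr_square u u' (hf u') w (tr_target u u u' p (hRefl u)) (tr_target (hf u') (hf u') w q (hRefl (hf u'))) (ap_F u u' p))"

definition tr_ap :: open_tm where
  "tr_ap = hPi hX (\<lambda>u. hPi hX (\<lambda>u'. hPi (path u u') (\<lambda>p. hPi hX (\<lambda>w. hPi (path (hf u') w) (\<lambda>q.
     tr_ap_goal u u' p w q)))))"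

text \<open>The variables w and q are quantified inside the first motive because q starts at f u'.
  After contraction of p the source of q is generalized from f u to t, so that q can be contracted
  as well.\<close>

definition tr_ap_tm :: open_tm where
  "tr_ap_tm = hLam hX (\<lambda>u. hLam hX (\<lambda>u'. hLam (path u u') (\<lambda>p.
     hEqInd (\<lambda>u u' p. hPi hX (\<lambda>w. hPi (path (hf u') w) (\<lambda>q. tr_ap_goal u u' p w q)))
       (\<lambda>u. hLam hX (\<lambda>w. hLam (path (hf u) w) (\<lambda>q.
          hEqInd (\<lambda>t w q. hEq (path t w) q (tr_target t t w (tr_target t t w q (hRefl t)) (hRefl t)))
            (\<lambda>t. hRefl (hRefl t)) (hf u) w q)))
       u u' p)))"

text \<open>
  Equivalently: \<open>\<gamma>\<close> underlies a path from \<open>(u, c)\<close> to \<open>(f x, I x)\<close> in \<open>\<Sigma>v. f v = v\<close>.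
\<close>

definition natural :: "open_tm \<Rightarrow> open_tm \<Rightarrow> open_tm \<Rightarrow> open_tm \<Rightarrow> open_tm" where
  "natural u x \<gamma> c = hEq (path (hf (hf x)) (hf x)) (hI x) (tr_square u (hf x) u (hf x) \<gamma> \<gamma> c)"

definition natural_step :: open_tm where
  "natural_step = hPi hX (\<lambda>y. hPi hX (\<lambda>x. hPi (path (hf y) x) (\<lambda>\<alpha>. hPi hX (\<lambda>u. hPi (path u (hf x)) (\<lambda>\<gamma>.
     hPi (path (hf u) u) (\<lambda>c. hPi (natural u x \<gamma> c) (\<lambda>h. natural u y (step_path u x y \<alpha> \<gamma>) c)))))))"

text \<open>Contracting \<alpha> gives x = f y, and contracting \<gamma>, whose target is fixed,
  gives u = f (f y). Now h has type I (f y) = c and is contracted too; J replaces I (f y) by ap_f (I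
  y). The remaining goal is the law \<open>tr_ap\<close> with both paths equal to I y. Here
  \<open>bvar 5\<close>, \<open>bvar 6\<close> and \<open>bvar 7\<close> are \<open>based_J\<close>,
  \<open>based_J'\<close> and \<open>tr_ap\<close>.\<close>

definition natural_step_tm :: open_tm where
  "natural_step_tm = hLam hX (\<lambda>y. hLam hX (\<lambda>x. hLam (path (hf y) x) (\<lambda>\<alpha>.
     by_J (bvar 5) hX (hf y) (\<lambda>x \<alpha>. hPi hX (\<lambda>u. hPi (path u (hf x)) (\<lambda>\<gamma>.
         hPi (path (hf u) u) (\<lambda>c. hPi (natural u x \<gamma> c) (\<lambda>h. natural u y (step_path u x y \<alpha> \<gamma>) c)))))
       (hLam hX (\<lambda>u. hLam (path u (hf (hf y))) (\<lambda>\<gamma>.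
          by_J' (bvar 6) hX (hf (hf y)) (\<lambda>u \<gamma>. hPi (path (hf u) u) (\<lambda>c. hPi (natural u (hf y) \<gamma> c) (\<lambda>h.
              natural u y (step_path u (hf y) y (hRefl (hf y)) \<gamma>) c)))
            (hLam (path (hf (hf (hf y))) (hf (hf y))) (\<lambda>c. hLam (hEq (path (hf (hf (hf y))) (hf (hf y))) (hI (hf y)) c) (\<lambda>h.
               by_J (bvar 5) (path (hf (hf (hf y))) (hf (hf y))) (hI (hf y))
                 (\<lambda>c h. natural (hf (hf y)) y (step_path (hf (hf y)) (hf y) y (hRefl (hf y)) (hRefl (hf (hf y)))) c)
                 (by_J (bvar 5) (path (hf (hf (hf y))) (hf (hf y))) (ap_F (hf (hf y)) (hf y) (hI y))
                   (\<lambda>c h. natural (hf (hf y)) y (step_path (hf (hf y)) (hf y) y (hRefl (hf y)) (hRefl (hf (hf y)))) c)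
                   (bvar 7 \<diamondop> hf (hf y) \<diamondop> hf y \<diamondop> hI y \<diamondop> hf y \<diamondop> hI y) (hI (hf y)) (hJ y))
                 c h)))
            u \<gamma>)))
       x \<alpha>)))"

text \<open>
  With \<open>x = a n\<close>, \<open>y = a (n + 1)\<close>, \<open>z = a (n + 2)\<close> and \<open>\<gamma> = \<gamma> (n + 1)\<close> this is the condition
  \<open>htpy_over\<close> at \<open>n\<close> for the homotopy from the constant sequence.
\<close>

definition coherence_goal ::
    "open_tm \<Rightarrow> open_tm \<Rightarrow> open_tm \<Rightarrow> open_tm \<Rightarrow> open_tm \<Rightarrow> open_tm \<Rightarrow> open_tm \<Rightarrow> open_tm \<Rightarrow> open_tm" where
  "coherence_goal z y \<alpha>' x \<alpha> u \<gamma> c = hEq (path (hf y) x) \<alpha>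
     (tr_square u y u x (tr_target u (hf z) y \<alpha>' (step_path u y z \<alpha>' \<gamma>)) (tr_target u (hf y) x \<alpha> \<gamma>) c)"

definition coherence :: open_tm where
  "coherence = hPi hX (\<lambda>z. hPi hX (\<lambda>y. hPi (path (hf z) y) (\<lambda>\<alpha>'. hPi hX (\<lambda>x. hPi (path (hf y) x) (\<lambda>\<alpha>.
     hPi hX (\<lambda>u. hPi (path u (hf y)) (\<lambda>\<gamma>. hPi (path (hf u) u) (\<lambda>c. hPi (natural u y \<gamma> c) (\<lambda>h.
     coherence_goal z y \<alpha>' x \<alpha> u \<gamma> c)))))))))"

text \<open>The contractions are those of \<open>natural_step_tm\<close>, with \<alpha>' and
  \<alpha> in turn, so that y becomes f z and both x and u become f (f z). After J the goal is
  \<open>tr_ap\<close> for the path I z with q = refl.\<close>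

definition coherence_tm :: open_tm where
  "coherence_tm = hLam hX (\<lambda>z. hLam hX (\<lambda>y. hLam (path (hf z) y) (\<lambda>\<alpha>'.
     by_J (bvar 5) hX (hf z) (\<lambda>y \<alpha>'. hPi hX (\<lambda>x. hPi (path (hf y) x) (\<lambda>\<alpha>.
         hPi hX (\<lambda>u. hPi (path u (hf y)) (\<lambda>\<gamma>. hPi (path (hf u) u) (\<lambda>c. hPi (natural u y \<gamma> c) (\<lambda>h.
         coherence_goal z y \<alpha>' x \<alpha> u \<gamma> c)))))))
       (hLam hX (\<lambda>x. hLam (path (hf (hf z)) x) (\<lambda>\<alpha>.
          by_J (bvar 5) hX (hf (hf z)) (\<lambda>x \<alpha>.
              hPi hX (\<lambda>u. hPi (path u (hf (hf z))) (\<lambda>\<gamma>. hPi (path (hf u) u) (\<lambda>c. hPi (natural u (hf z) \<gamma> c) (\<lambda>h.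
              coherence_goal z (hf z) (hRefl (hf z)) x \<alpha> u \<gamma> c)))))
            (hLam hX (\<lambda>u. hLam (path u (hf (hf z))) (\<lambda>\<gamma>.
               by_J' (bvar 6) hX (hf (hf z)) (\<lambda>u \<gamma>. hPi (path (hf u) u) (\<lambda>c. hPi (natural u (hf z) \<gamma> c) (\<lambda>h.
                   coherence_goal z (hf z) (hRefl (hf z)) (hf (hf z)) (hRefl (hf (hf z))) u \<gamma> c)))
                 (hLam (path (hf (hf (hf z))) (hf (hf z))) (\<lambda>c. hLam (hEq (path (hf (hf (hf z))) (hf (hf z))) (hI (hf z)) c) (\<lambda>h.
                    by_J (bvar 5) (path (hf (hf (hf z))) (hf (hf z))) (hI (hf z))
                      (\<lambda>c h. coherence_goal z (hf z) (hRefl (hf z)) (hf (hf z)) (hRefl (hf (hf z))) (hf (hf z)) (hRefl (hf (hf z))) c)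
                      (by_J (bvar 5) (path (hf (hf (hf z))) (hf (hf z))) (ap_F (hf (hf z)) (hf z) (hI z))
                        (\<lambda>c h. coherence_goal z (hf z) (hRefl (hf z)) (hf (hf z)) (hRefl (hf (hf z))) (hf (hf z)) (hRefl (hf (hf z))) c)
                        (bvar 7 \<diamondop> hf (hf z) \<diamondop> hf z \<diamondop> hI z \<diamondop> hf (hf z) \<diamondop> hRefl (hf (hf z))) (hI (hf z)) (hJ z))
                      c h)))
                 u \<gamma>)))
            x \<alpha>)))
       y \<alpha>')))"

section \<open>The limit of the tower and its paths\<close>

abbreviation "sequence \<equiv> hNat \<rightarrow>\<^sub>h hX"

definition compatible :: "open_tm \<Rightarrow> open_tm" where
  "compatible a = hPi hNat (\<lambda>n. path (hf (a \<diamondop> hSucc n)) (a \<diamondop> n))"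

definition limit :: open_tm where
  "limit = hSg sequence compatible"

definition into_limit :: open_tm where
  "into_limit = hLam hX (\<lambda>x. hPair limit (hLam hNat (\<lambda>n. hf x)) (hLam hNat (\<lambda>n. hI x)))"

definition from_limit :: open_tm where
  "from_limit = hLam limit (\<lambda>w. hSgInd (\<lambda>w. hX) (\<lambda>a \<alpha>. a \<diamondop> hZero) w)"

definition htpy_over :: "open_tm \<Rightarrow> open_tm \<Rightarrow> open_tm \<Rightarrow> open_tm \<Rightarrow> open_tm \<Rightarrow> open_tm" where
  "htpy_over a \<alpha> a' \<beta> \<alpha>' = hPi hNat (\<lambda>n. hEq (path (hf (a' \<diamondop> hSucc n)) (a' \<diamondop> n)) (\<alpha>' \<diamondop> n)
     (tr_square (a \<diamondop> hSucc n) (a' \<diamondop> hSucc n) (a \<diamondop> n) (a' \<diamondop> n) (\<beta> \<diamondop> hSucc n) (\<beta> \<diamondop> n) (\<alpha> \<diamondop> n)))"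

definition limit_ext :: open_tm where
  "limit_ext = hPi sequence (\<lambda>a. hPi (compatible a) (\<lambda>\<alpha>. hPi sequence (\<lambda>a'.
     hPi (hPi hNat (\<lambda>n. path (a \<diamondop> n) (a' \<diamondop> n))) (\<lambda>\<beta>. hPi (compatible a') (\<lambda>\<alpha>'.
     hPi (htpy_over a \<alpha> a' \<beta> \<alpha>') (\<lambda>\<kappa>. hEq limit (hPair limit a \<alpha>) (hPair limit a' \<alpha>')))))))"

text \<open>Here \<open>bvar 5\<close> is \<open>htpy_ind\<close>. Its first use contracts \<beta>,
  whereupon the transports in \<open>htpy_over\<close> reduce and \<kappa> becomes a homotopy from
  \<alpha>' to \<alpha>. This orientation is why the second use is based at \<alpha>' and varies
  \<alpha>.\<close>

definition limit_ext_tm :: open_tm where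
  "limit_ext_tm = hLam sequence (\<lambda>a. hLam (compatible a) (\<lambda>\<alpha>. hLam sequence (\<lambda>a'.
     hLam (hPi hNat (\<lambda>n. path (a \<diamondop> n) (a' \<diamondop> n))) (\<lambda>\<beta>.
     bvar 5 \<diamondop> hNat \<diamondop> hLam hNat (\<lambda>n. hX) \<diamondop> a
       \<diamondop> hLam sequence (\<lambda>a'. hLam (hPi hNat (\<lambda>n. path (a \<diamondop> n) (a' \<diamondop> n))) (\<lambda>\<beta>.
           hPi (compatible a') (\<lambda>\<alpha>'. hPi (htpy_over a \<alpha> a' \<beta> \<alpha>') (\<lambda>\<kappa>.
             hEq limit (hPair limit a \<alpha>) (hPair limit a' \<alpha>')))))
       \<diamondop> hLam (compatible a) (\<lambda>\<alpha>'.
           hLam (hPi hNat (\<lambda>n. hEq (path (hf (a \<diamondop> hSucc n)) (a \<diamondop> n)) (\<alpha>' \<diamondop> n) (\<alpha> \<diamondop> n))) (\<lambda>\<kappa>.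
           bvar 5 \<diamondop> hNat \<diamondop> hLam hNat (\<lambda>n. path (hf (a \<diamondop> hSucc n)) (a \<diamondop> n)) \<diamondop> \<alpha>'
             \<diamondop> hLam (compatible a) (\<lambda>\<alpha>.
                 hLam (hPi hNat (\<lambda>n. hEq (path (hf (a \<diamondop> hSucc n)) (a \<diamondop> n)) (\<alpha>' \<diamondop> n) (\<alpha> \<diamondop> n))) (\<lambda>\<kappa>.
                 hEq limit (hPair limit a \<alpha>) (hPair limit a \<alpha>')))
             \<diamondop> hRefl (hPair limit a \<alpha>') \<diamondop> \<alpha> \<diamondop> \<kappa>))
       \<diamondop> a' \<diamondop> \<beta>))))"

definition gamma :: "open_tm \<Rightarrow> open_tm \<Rightarrow> open_tm \<Rightarrow> open_tm" where
  "gamma a \<alpha> m = hNatInd (\<lambda>m. path (hf (a \<diamondop> hZero)) (hf (a \<diamondop> m))) (hRefl (hf (a \<diamondop> hZero)))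
     (\<lambda>m \<gamma>. step_path (hf (a \<diamondop> hZero)) (a \<diamondop> m) (a \<diamondop> hSucc m) (\<alpha> \<diamondop> m) \<gamma>) m"

text \<open>At zero the transports run along refl and vanish, so refl suffices. Here
  \<open>bvar 5\<close> is \<open>natural_step\<close>, applied with u = f (a 0) and c = I (a
  0).\<close>

definition gamma_natural :: "open_tm \<Rightarrow> open_tm \<Rightarrow> open_tm \<Rightarrow> open_tm" where
  "gamma_natural a \<alpha> m =
     hNatInd (\<lambda>m. natural (hf (a \<diamondop> hZero)) (a \<diamondop> m) (gamma a \<alpha> m) (hI (a \<diamondop> hZero))) (hRefl (hI (a \<diamondop> hZero)))
     (\<lambda>m h. bvar 5 \<diamondop> (a \<diamondop> hSucc m) \<diamondop> (a \<diamondop> m) \<diamondop> (\<alpha> \<diamondop> m) \<diamondop> hf (a \<diamondop> hZero) \<diamondop> gamma a \<alpha> m \<diamondop> hI (a \<diamondop> hZero) \<diamondop> h) m"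

definition retraction :: open_tm where
  "retraction = hPi limit (\<lambda>w. hEq limit (into_limit \<diamondop> (from_limit \<diamondop> w)) w)"

text \<open>Here \<open>bvar 7\<close> is \<open>limit_ext\<close> and \<open>bvar 6\<close> is
  \<open>coherence\<close>. The first pair is the normal form of r (s (a, \<alpha>)), two constant
  sequences. The homotopy at n + 1 involves \<gamma> (n + 2), which unfolds to a
  \<open>step_path\<close> over \<gamma> (n + 1); this is the form in which \<open>coherence\<close>
  is stated.\<close>

definition retraction_tm :: open_tm where
  "retraction_tm = hLam limit (\<lambda>w. hSgInd (\<lambda>w. hEq limit (into_limit \<diamondop> (from_limit \<diamondop> w)) w) (\<lambda>a \<alpha>.
     bvar 7 \<diamondop> hLam hNat (\<lambda>n. hf (a \<diamondop> hZero)) \<diamondop> hLam hNat (\<lambda>n. hI (a \<diamondop> hZero)) \<diamondop> a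
       \<diamondop> hLam hNat (\<lambda>n. tr_target (hf (a \<diamondop> hZero)) (hf (a \<diamondop> hSucc n)) (a \<diamondop> n) (\<alpha> \<diamondop> n) (gamma a \<alpha> (hSucc n)))
       \<diamondop> \<alpha>
       \<diamondop> hLam hNat (\<lambda>n. bvar 6 \<diamondop> (a \<diamondop> hSucc (hSucc n)) \<diamondop> (a \<diamondop> hSucc n) \<diamondop> (\<alpha> \<diamondop> hSucc n) \<diamondop> (a \<diamondop> n) \<diamondop> (\<alpha> \<diamondop> n)
           \<diamondop> hf (a \<diamondop> hZero) \<diamondop> gamma a \<alpha> (hSucc n) \<diamondop> hI (a \<diamondop> hZero) \<diamondop> gamma_natural a \<alpha> (hSucc n))) w)"

definition section_eq :: open_tm where
  "section_eq = hPi hX (\<lambda>x. path (from_limit \<diamondop> (into_limit \<diamondop> x)) (hf x))"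

definition section_eq_tm :: open_tm where
  "section_eq_tm = hLam hX (\<lambda>x. hRefl (hf x))"

section \<open>Running the checker on the proof terms\<close>

definition agree :: "result \<Rightarrow> result \<Rightarrow> bool" where
  "agree x y \<longleftrightarrow> (\<exists>u T i. x = Some (u, T) \<and> y = Some (T, Univ i))"

lemma agree_eval: "agree (Some (u, T)) (Some (T, Univ i)) = True"
  by (auto simp: agree_def)

text \<open>The normal form of the type and its universe are existential in \<open>agree\<close>, so
  evaluation finds them; \<open>agree_eval\<close> fires only if the inferred type is literally the
  normal form of the goal.\<close>

lemma typing_by_agree: "\<lbrakk>\<turnstile> \<Gamma> ctx; agree (norm l n \<Gamma> t) (norm l n \<Gamma> A)\<rbrakk> \<Longrightarrow> \<Gamma> \<turnstile> t \<^bold>: A"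
  by (auto simp: agree_def intro: typing_by_norm)

definition is_univ :: "result \<Rightarrow> bool" where
  "is_univ x \<longleftrightarrow> (\<exists>u i. x = Some (u, Univ i))"

lemma is_univ_eval: "is_univ (Some (u, Univ i)) = True"
  by (auto simp: is_univ_def)

lemma ctx_by_norm: "\<lbrakk>\<turnstile> \<Gamma> ctx; is_univ (norm l n \<Gamma> A)\<rbrakk> \<Longrightarrow> \<turnstile> A # \<Gamma> ctx"
  unfolding is_univ_def using soundD[OF norm_sound] jdeq_right ctx_ext by blast

text \<open>Reverses the simp rule \<open>lift_eq_shift\<close>: the evaluation uses
  \<open>simp only\<close> and has to turn every shift into the computable
  \<open>lift\<close>.\<close>

lemma shift_eq_lift: "\<up> m t = lift 0 m t"
  by simp

lemmas eval_rules = norm_rules agree_eval is_univ_eval shift_eq_lift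
  One_nat_def numeral_eq_Suc pred_numeral_simps BitM.simps base_ctx_def hoas_defs
  FunExt_def Let_def isequiv_def times_def arrow_def Pi_fam_def htpy_def happly_def

lemmas term_defs = ap_F_def by_J_def by_J'_def hPi_fam_def hhtpy_def hhapply_def tr_target_def tr_source_def
  tr_square_def step_path_def tr_ap_goal_def natural_def coherence_goal_def compatible_def limit_def
  htpy_over_def gamma_def gamma_natural_def into_limit_def from_limit_def

lemma base_ctx: "\<turnstile> base_ctx i ctx"
  unfolding base_ctx_def
  by (intro ctx_by_norm[of _ i 30] ctx_empty) (simp_all only: eval_rules term_defs)

lemma based_J_typing: "base_ctx i \<turnstile> based_J_tm i 5 \<^bold>: based_J i 5"
  by (rule typing_by_agree[OF base_ctx, where l = i and n = 60])
    (simp only: eval_rules term_defs based_J_tm_def based_J_def)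

lemma based_J'_typing: "base_ctx i \<turnstile> based_J'_tm i 5 \<^bold>: based_J' i 5"
  by (rule typing_by_agree[OF base_ctx, where l = i and n = 60])
    (simp only: eval_rules term_defs based_J'_tm_def based_J'_def)

lemma tr_ap_typing: "base_ctx i \<turnstile> tr_ap_tm 5 \<^bold>: tr_ap 5"
  by (rule typing_by_agree[OF base_ctx, where l = i and n = 60])
    (simp only: eval_rules term_defs tr_ap_tm_def tr_ap_def)

lemma shift_type_ctx:
  assumes "is_type \<Gamma> A" "subst_ok (wk k) \<Gamma> \<Delta>"
  shows "\<turnstile> \<up> k A # \<Delta> ctx" "subst_ok (wk (Suc k)) \<Gamma> (\<up> k A # \<Delta>)"
  using is_type_subst[OF assms] subst_ok_wk[OF assms(2)] ctx_ext by (auto simp: is_type_def shift_eq_subst)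

lemma cut:
  assumes a: "\<Gamma> \<turnstile> a \<^bold>: A" and t: "\<turnstile> A # \<Gamma> ctx \<Longrightarrow> A # \<Gamma> \<turnstile> t \<^bold>: \<up> 1 T"
  shows "\<exists>t. \<Gamma> \<turnstile> t \<^bold>: T"
proof -
  have "\<turnstile> A # \<Gamma> ctx" using regularity(2)[OF a] ctx_ext by (auto simp: is_type_def)
  from typing_inst[OF t[OF this] a] show ?thesis by auto
qed

text \<open>All three lemmas are derived over the same context, hence the shifts of \<open>B\<close>
  and \<open>C\<close>; simultaneous substitution of the three proof terms removes the variables
  again.\<close>

lemma cut3:
  assumes abc: "\<Gamma> \<turnstile> a \<^bold>: A" "\<Gamma> \<turnstile> b \<^bold>: B" "\<Gamma> \<turnstile> c \<^bold>: C"
    and t: "\<turnstile> \<up> 2 C # \<up> 1 B # A # \<Gamma> ctx \<Longrightarrow> \<up> 2 C # \<up> 1 B # A # \<Gamma> \<turnstile> t \<^bold>: \<up> 3 T"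
  shows "\<exists>t. \<Gamma> \<turnstile> t \<^bold>: T"
proof -
  have ok: "subst_ok (wk 0) \<Gamma> \<Gamma>" using abc(1) by (simp add: subst_ok_Var typing_ctx)
  have 1: "subst_ok (wk (Suc 0)) \<Gamma> (A # \<Gamma>)" using shift_type_ctx(2)[OF regularity(2)[OF abc(1)] ok] by simp
  have 2: "subst_ok (wk 2) \<Gamma> (\<up> 1 B # A # \<Gamma>)"
    using shift_type_ctx(2)[OF regularity(2)[OF abc(2)] 1] by (simp add: numeral_2_eq_2)
  have "subst_ok (c \<bullet> b \<bullet> a \<bullet> Var) (\<up> 2 C # \<up> 1 B # A # \<Gamma>) \<Gamma>"
    using abc by (intro subst_ok_scons subst_ok_Var) (auto simp: subst_shift dest: typing_ctx)
  from typing_subst[OF t[OF shift_type_ctx(1)[OF regularity(2)[OF abc(3)] 2]] this]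
  show ?thesis by (auto simp: subst_shift numeral_3_eq_3)
qed

lemma htpy_ind_inhabited: "\<exists>t. base_ctx i \<turnstile> t \<^bold>: htpy_ind i 5"
  by (rule cut[OF based_J_typing], rule typing_by_agree[where l = i and n = 60 and t = "htpy_ind_tm i 6"], assumption)
    (simp only: eval_rules term_defs htpy_ind_tm_def htpy_ind_def based_J_def)

lemma natural_step_inhabited: "\<exists>t. base_ctx i \<turnstile> t \<^bold>: natural_step 5"
  by (rule cut3[OF based_J_typing based_J'_typing tr_ap_typing],
      rule typing_by_agree[where l = i and n = 60 and t = "natural_step_tm 8"], assumption)
    (simp only: eval_rules term_defs natural_step_tm_def natural_step_def based_J_def based_J'_def tr_ap_def)

lemma coherence_inhabited: "\<exists>t. base_ctx i \<turnstile> t \<^bold>: coherence 5"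
  by (rule cut3[OF based_J_typing based_J'_typing tr_ap_typing],
      rule typing_by_agree[where l = i and n = 60 and t = "coherence_tm 8"], assumption)
    (simp only: eval_rules term_defs coherence_tm_def coherence_def based_J_def based_J'_def tr_ap_def)

lemma limit_ext_inhabited: "\<exists>t. base_ctx i \<turnstile> t \<^bold>: limit_ext 5"
proof -
  obtain h where h: "base_ctx i \<turnstile> h \<^bold>: htpy_ind i 5" using htpy_ind_inhabited by blast
  show ?thesis
    by (rule cut[OF h], rule typing_by_agree[where l = i and n = 60 and t = "limit_ext_tm 6"], assumption)
      (simp only: eval_rules term_defs limit_ext_tm_def limit_ext_def htpy_ind_def)
qed

lemma retraction_inhabited: "\<exists>t. base_ctx i \<turnstile> t \<^bold>: retraction 5"
proof -
  obtain s c e where sce: "base_ctx i \<turnstile> s \<^bold>: natural_step 5" "base_ctx i \<turnstile> c \<^bold>: coherence 5"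
      "base_ctx i \<turnstile> e \<^bold>: limit_ext 5"
    using natural_step_inhabited coherence_inhabited limit_ext_inhabited by blast
  show ?thesis
    by (rule cut3[OF sce], rule typing_by_agree[where l = i and n = 60 and t = "retraction_tm 8"], assumption)
      (simp only: eval_rules term_defs retraction_tm_def retraction_def natural_step_def coherence_def limit_ext_def)
qed

lemma limit_typing: "base_ctx i \<turnstile> limit 5 \<^bold>: Univ i"
  by (rule typing_by_agree[OF base_ctx, where l = i and n = 60]) (simp only: eval_rules term_defs)

lemma into_limit_typing: "base_ctx i \<turnstile> into_limit 5 \<^bold>: Var 3 \<rightarrow>\<^sub>t limit 5"
  by (rule typing_by_agree[OF base_ctx, where l = i and n = 60]) (simp only: eval_rules term_defs)

lemma from_limit_typing: "base_ctx i \<turnstile> from_limit 5 \<^bold>: limit 5 \<rightarrow>\<^sub>t Var 3"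
  by (rule typing_by_agree[OF base_ctx, where l = i and n = 60]) (simp only: eval_rules term_defs)

lemma section_eq_typing: "base_ctx i \<turnstile> section_eq_tm 5 \<^bold>: section_eq 5"
  by (rule typing_by_agree[OF base_ctx, where l = i and n = 60]) (simp only: eval_rules term_defs section_eq_tm_def section_eq_def)

text \<open>Evaluation has already distributed the weakenings; here they are folded back into
  explicit shifts, through which \<open>subst_up_shift\<close> can move the final
  substitution.\<close>

lemma retraction_shift: "retraction 5 = Pi (limit 5) (Eq (\<up> 1 (limit 5)) (\<up> 1 (into_limit 5) \<cdot> (\<up> 1 (from_limit 5) \<cdot> Var 0)) (Var 0))"
  by (simp only: eval_rules term_defs retraction_def)

lemma section_eq_shift: "section_eq 5 = Pi (Var 3) (Eq (Var 4) (\<up> 1 (from_limit 5) \<cdot> (\<up> 1 (into_limit 5) \<cdot> Var 0)) (Var 3 \<cdot> Var 0))"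
  by (simp only: eval_rules term_defs section_eq_def)

theorem theorem5p3:
  fixes \<Gamma> :: "tm list" and i :: nat and funext X f I J :: tm
  assumes "\<Gamma> \<turnstile> funext \<^bold>: FunExt i"
    and "\<Gamma> \<turnstile> X \<^bold>: Univ i"
    and "\<Gamma> \<turnstile> f \<^bold>: X \<rightarrow>\<^sub>t X"
    and "\<Gamma> \<turnstile> I \<^bold>: Pi X (Eq (\<up> 1 X) (\<up> 1 f \<cdot> (\<up> 1 f \<cdot> Var 0)) (\<up> 1 f \<cdot> Var 0))"
    and "\<Gamma> \<turnstile> J \<^bold>: Pi X
      (Eq (Eq (\<up> 1 X) (\<up> 1 f \<cdot> (\<up> 1 f \<cdot> (\<up> 1 f \<cdot> Var 0))) (\<up> 1 f \<cdot> (\<up> 1 f \<cdot> Var 0)))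
          (ap (\<up> 1 X) (\<up> 1 f) (\<up> 1 f \<cdot> (\<up> 1 f \<cdot> Var 0)) (\<up> 1 f \<cdot> Var 0) (\<up> 1 I \<cdot> Var 0))
          (\<up> 1 I \<cdot> (\<up> 1 f \<cdot> Var 0)))"
  shows "\<exists>A r s H K.
      \<Gamma> \<turnstile> A \<^bold>: Univ i \<and>
      \<Gamma> \<turnstile> r \<^bold>: X \<rightarrow>\<^sub>t A \<and>
      \<Gamma> \<turnstile> s \<^bold>: A \<rightarrow>\<^sub>t X \<and>
      \<Gamma> \<turnstile> H \<^bold>: Pi A (Eq (\<up> 1 A) (\<up> 1 r \<cdot> (\<up> 1 s \<cdot> Var 0)) (Var 0)) \<and>
      \<Gamma> \<turnstile> K \<^bold>: Pi X (Eq (\<up> 1 X) (\<up> 1 s \<cdot> (\<up> 1 r \<cdot> Var 0)) (\<up> 1 f \<cdot> Var 0))"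
proof -
  \<comment> \<open>Everything so far lives in \<open>base_ctx\<close>, where the hypotheses are
    variables; this substitution supplies the given terms, the most recent variable first. Since
    \<open>base_ctx\<close> rests on the empty context, \<open>subst_ok_Nil\<close> accepts any
    tail.\<close>
  let ?\<sigma> = "J \<bullet> I \<bullet> f \<bullet> X \<bullet> funext \<bullet> Var"
  have "subst_ok ?\<sigma> (base_ctx i) \<Gamma>"
    unfolding base_ctx_def
    using assms typing_ctx[OF assms(1)]
    by (intro subst_ok_scons subst_ok_Nil) (simp_all add: hoas_defs ap_F_def ap_def arrow_def numeral_eq_Suc)
  note inst = typing_subst[OF _ this]
  obtain H where H: "base_ctx i \<turnstile> H \<^bold>: retraction 5" using retraction_inhabited by blast
  show ?thesis
    using inst[OF limit_typing] inst[OF into_limit_typing] inst[OF from_limit_typing]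
      inst[OF H] inst[OF section_eq_typing]
    unfolding retraction_shift section_eq_shift arrow_def subst.simps subst_up_shift
    by (intro exI conjI) (simp_all add: numeral_eq_Suc)
qed

end
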